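(* Let $1<p<\infty$ and $p^\star-1:=\max\{p-1,(p-1)^{-1}\}$. Let $B_{\mathfrak{i}}=-R_1^+R_2^--R_1^-R_2^+$ be the imaginary part of the discrete Beurling--Ahlfors operator on $\mathbb{Z}^2$. Then $$\|B_{\mathfrak{i}}\|_{\ell^p(\mathbb{Z}^2)\to\ell^p(\mathbb{Z}^2)}=p^\star-1 .$$
   Context: Functions are real valued on $\mathbb{Z}^2$, with canonical basis $e_1,e_2$. Put $\partial_i^+f(x)=f(x+e_i)-f(x)$, $\partial_i^-f(x)=f(x)-f(x-e_i)$, and $\Delta f(x)=\sum_{i=1}^2\bigl(f(x+e_i)-2f(x)+f(x-e_i)\bigr)$. On $\ell^2(\mathbb{Z}^2)$ one has $\Delta\le 0$, with Fourier multiplier $-4\sum_{i=1}^2\sin^2(\theta_i/2)$, $\theta\in\mathbb{T}^2$. The discrete Riesz transforms are $R_i^\pm=\partial_i^\pm\circ(-\Delta)^{-1/2}$, understood as Fourier multipliers on $\ell^2(\mathbb{Z}^2)$: with $\hat f(\theta)=\sum_x f(x)e^{-ix\cdot\theta}$, $R_i^+$ has multiplier $(e^{i\theta_i}-1)\bigl(4\sum_k\sin^2(\theta_k/2)\bigr)^{-1/2}$ and $R_i^-$ has multiplier $(1-e^{-i\theta_i})\bigl(4\sum_k\sin^2(\theta_k/2)\bigr)^{-1/2}$. All these operators commute and are bounded on $\ell^p$ for $1<p<\infty$ (as the unique bounded extensions from finitely supported functions). Equivalently $B_{\mathfrak{i}}=-\tfrac12\bigl(R_1^+R_2^-+R_2^+R_1^-+R_1^-R_2^++R_2^-R_1^+\bigr)$.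 The norm is the operator norm on real $\ell^p(\mathbb{Z}^2)$. *)

theory Defs
  imports "HOL-Analysis.Analysis"
begin

section \<open>Fourier multipliers on $\ell^2(\mathbb{Z}^2)$\<close>

definition torus :: "(real \<times> real) measure" where
  "torus = restrict_space lborel ({-pi..pi} \<times> {-pi..pi})"

definition pairing :: "int \<times> int \<Rightarrow> real \<times> real \<Rightarrow> real" where
  "pairing x \<theta> = of_int (fst x) * fst \<theta> + of_int (snd x) * snd \<theta>"

text \<open>
  \<open>has_fourier_transform f F\<close>: the series $\sum_x f(x) e^{-i x\cdot\theta}$ converges
  (unconditionally) to \<open>F\<close> in $L^2$ of the torus.  Such an \<open>F\<close> exists exactly when \<open>f\<close> is
  square summable, and it is then unique up to null sets.
\<close>

definition has_fourier_transform ::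
    "(int \<times> int \<Rightarrow> real) \<Rightarrow> (real \<times> real \<Rightarrow> complex) \<Rightarrow> bool" where
  "has_fourier_transform f F \<longleftrightarrow>
     F \<in> borel_measurable torus \<and>
     integrable torus (\<lambda>\<theta>. (cmod (F \<theta>))\<^sup>2) \<and>
     ((\<lambda>A. \<integral>\<theta>. (cmod (F \<theta> - (\<Sum>x\<in>A. of_real (f x) * cis (- pairing x \<theta>))))\<^sup>2 \<partial>torus)
        \<longlongrightarrow> 0) (finite_subsets_at_top UNIV)"

text \<open>
  The operator on $\ell^2(\mathbb{Z}^2)$ with multiplier \<open>m\<close>.  It maps real functions to real
  functions when \<open>m\<close> is bounded, measurable and satisfies
  $m(-\theta) = \overline{m(\theta)}$, as do all multipliers below.
\<close>

definition fourier_multiplier ::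
    "(real \<times> real \<Rightarrow> complex) \<Rightarrow> (int \<times> int \<Rightarrow> real) \<Rightarrow> (int \<times> int \<Rightarrow> real)" where
  "fourier_multiplier m f =
     (THE g. \<exists>F. has_fourier_transform f F \<and> has_fourier_transform g (\<lambda>\<theta>. m \<theta> * F \<theta>))"


section \<open>Discrete Riesz transforms and the Beurling--Ahlfors operator\<close>

definition neg_laplacian_symbol :: "real \<times> real \<Rightarrow> real" where
  "neg_laplacian_symbol \<theta> = 4 * ((sin (fst \<theta> / 2))\<^sup>2 + (sin (snd \<theta> / 2))\<^sup>2)"

text \<open>
  The coordinate index is passed as a projection: $R_1^\pm$ is obtained with \<open>fst\<close> and
  $R_2^\pm$ with \<open>snd\<close>.  The value of the multipliers at $\theta = 0$ (here 0, by division
  by zero) is irrelevant, since a point is a null set.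
\<close>

definition riesz_plus ::
    "(real \<times> real \<Rightarrow> real) \<Rightarrow> (int \<times> int \<Rightarrow> real) \<Rightarrow> (int \<times> int \<Rightarrow> real)" where
  "riesz_plus coord =
     fourier_multiplier (\<lambda>\<theta>. (cis (coord \<theta>) - 1) / of_real (sqrt (neg_laplacian_symbol \<theta>)))"

definition riesz_minus ::
    "(real \<times> real \<Rightarrow> real) \<Rightarrow> (int \<times> int \<Rightarrow> real) \<Rightarrow> (int \<times> int \<Rightarrow> real)" where
  "riesz_minus coord =
     fourier_multiplier (\<lambda>\<theta>. (1 - cis (- coord \<theta>)) / of_real (sqrt (neg_laplacian_symbol \<theta>)))"

definition beurling_ahlfors_im :: "(int \<times> int \<Rightarrow> real) \<Rightarrow> (int \<times> int \<Rightarrow> real)" where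
  "beurling_ahlfors_im f =
     (\<lambda>x. - riesz_plus fst (riesz_minus snd f) x - riesz_minus fst (riesz_plus snd f) x)"


section \<open>Operators on $\ell^p(\mathbb{Z}^2)$\<close>

definition lp :: "real \<Rightarrow> (int \<times> int \<Rightarrow> real) set" where
  "lp p = {f. (\<lambda>x. \<bar>f x\<bar> powr p) summable_on UNIV}"

definition lp_norm :: "real \<Rightarrow> (int \<times> int \<Rightarrow> real) \<Rightarrow> real" where
  "lp_norm p f = (\<Sum>\<^sub>\<infinity>x. \<bar>f x\<bar> powr p) powr (1 / p)"

definition bounded_linear_lp ::
    "real \<Rightarrow> ((int \<times> int \<Rightarrow> real) \<Rightarrow> (int \<times> int \<Rightarrow> real)) \<Rightarrow> bool" where
  "bounded_linear_lp p T \<longleftrightarrow>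
     (\<forall>f\<in>lp p. T f \<in> lp p) \<and>
     (\<forall>f\<in>lp p. \<forall>g\<in>lp p. T (\<lambda>x. f x + g x) = (\<lambda>x. T f x + T g x)) \<and>
     (\<forall>c. \<forall>f\<in>lp p. T (\<lambda>x. c * f x) = (\<lambda>x. c * T f x)) \<and>
     (\<exists>C. \<forall>f\<in>lp p. lp_norm p (T f) \<le> C * lp_norm p f)"

text \<open>
  \<open>T\<close> is the bounded extension to $\ell^p$ of the restriction of \<open>S\<close> to finitely supported
  functions.  The last clause only fixes the values of the total function \<open>T\<close> outside
  $\ell^p$, so that \<open>T\<close> is unique.
\<close>

definition is_lp_extension ::
    "real \<Rightarrow> ((int \<times> int \<Rightarrow> real) \<Rightarrow> (int \<times> int \<Rightarrow> real)) \<Rightarrow>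
     ((int \<times> int \<Rightarrow> real) \<Rightarrow> (int \<times> int \<Rightarrow> real)) \<Rightarrow> bool" where
  "is_lp_extension p S T \<longleftrightarrow>
     bounded_linear_lp p T \<and>
     (\<forall>f. finite {x. f x \<noteq> 0} \<longrightarrow> T f = S f) \<and>
     (\<forall>f. f \<notin> lp p \<longrightarrow> T f = (\<lambda>x. 0))"

definition lp_extension ::
    "real \<Rightarrow> ((int \<times> int \<Rightarrow> real) \<Rightarrow> (int \<times> int \<Rightarrow> real)) \<Rightarrow>
     ((int \<times> int \<Rightarrow> real) \<Rightarrow> (int \<times> int \<Rightarrow> real))" where
  "lp_extension p S = (THE T. is_lp_extension p S T)"

text \<open>Meaningful for operators that are bounded on $\ell^p$ (the supremum is a real one).\<close>

definition lp_onorm ::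
    "real \<Rightarrow> ((int \<times> int \<Rightarrow> real) \<Rightarrow> (int \<times> int \<Rightarrow> real)) \<Rightarrow> real" where
  "lp_onorm p T = (SUP f\<in>{f \<in> lp p. lp_norm p f \<le> 1}. lp_norm p (T f))"

end

theory Submission
  imports Defs
begin

text \<open>
  Write \<open>a\<close>, \<open>b\<close> for the two frequencies.  The symbol of the operator is
  \<open>1 - (2 - 2 cos (a - b)) / (4 - 2 cos a - 2 cos b)\<close>, so it maps \<open>-\<Delta> u\<close> to
  \<open>-\<Delta> u + D u\<close>, where \<open>D\<close> is the second difference in the direction \<open>e1 - e2\<close>.

  Upper bound, \<open>p \<ge> 2\<close>.  Let a lazy random walk first choose one of the pairs
  \<open>{x + e1, x + e2}\<close>, \<open>{x - e1, x - e2}\<close> and then a point of it, and evaluate a martingale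
  along it.  Keeping the first half of each increment and changing the sign of the second is
  a martingale transform by signs; projected back to the lattice, it has a symbol that
  converges to the one above when the laziness increases.  The bound \<open>p - 1\<close> is then
  Burkholder's, used in its dual form: the Legendre transform of Burkholder's function is a
  Bellman function for the bilinear form of the operator.

  Lower bound, \<open>p \<ge> 2\<close>.  Consider the supremum, over periodic \<open>u\<close> on the lattice, of the
  mean of \<open>\<bar>y - \<Delta> u + D u\<bar>\<^sup>p - S\<^sup>p \<bar>x - \<Delta> u\<bar>\<^sup>p\<close>.  Superposing fine oscillations on slowly varying
  plane waves in the directions \<open>e1 + e2\<close> and \<open>e1 - e2\<close> shows that it is a zigzag concave
  function of \<open>(x, y)\<close>; if \<open>S\<close> bounds the norm, it is finite, and being homogeneous and
  concave forces \<open>S \<ge> p - 1\<close>.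

  The case \<open>p < 2\<close> follows by duality, as the operator is symmetric.
\<close>

text \<open>Let \<open>s\<close>, \<open>d\<close>, \<open>w\<close> be the symbols of
  \<open>-\<Delta>\<close>, of \<open>-D\<close> and of the walk that moves with probability
  \<open>e\<close>. A whole step has covariance \<open>1 - w^2\<close>, of which the second half
  contributes \<open>e d / 4\<close>; changing its sign leaves \<open>1 - w^2 - e d / 2\<close>.
  Summing over all times divides by \<open>1 - w^2\<close>, which is \<open>e s / 2\<close> up to
  order \<open>e^2\<close>, so the quotient tends to \<open>1 - d / s\<close>. No martingale has to
  be built: the argument is an induction on a pointwise inequality for the Bellman function, and the
  dual form is bilinear, so that Parseval can recognise the operator in the sum. For the lower
  bound, a plane wave along \<open>e1 + e2\<close> moves the pair (\<open>-\<Delta> u\<close>,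
  \<open>-\<Delta> u + D u\<close>) in direction (1, 1), and a slow one along \<open>e1 - e2\<close>
  nearly in direction (1, -1). These are the two directions in which Burkholder's function is
  concave, which is why the bounds meet. The definitions through \<open>THE\<close> call for
  existence as well. The kernel is the image of a point mass, so the upper bound itself puts it in
  every space of exponent above 1, and the extension becomes a convergent convolution.\<close>

lemma torus_box_cbox: "{-pi..pi} \<times> {-pi..pi} = cbox (-pi,-pi) (pi,pi::real)"
  by (auto simp: cbox_def Basis_prod_def)

lemma sets_torus_box [measurable, simp]: "{-pi..pi} \<times> {-pi..pi} \<in> sets borel"
  unfolding torus_box_cbox by simp

lemma space_torus: "space torus = {-pi..pi} \<times> {-pi..pi}"
  by (simp add: torus_def space_restrict_space)

lemma finite_measure_torus: "finite_measure torus"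
proof (rule finite_measureI)
  have "emeasure torus (space torus) = emeasure lborel ({-pi..pi} \<times> {-pi..pi})"
    unfolding space_torus unfolding torus_def
    by (subst emeasure_restrict_space) auto
  also have "\<dots> \<noteq> \<infinity>"
    unfolding torus_box_cbox
    using emeasure_lborel_cbox_finite[of "(-pi,-pi)" "(pi,pi)"] by (metis less_irrefl)
  finally show "emeasure torus (space torus) \<noteq> \<infinity>" .
qed

interpretation torus: finite_measure torus by (rule finite_measure_torus)

lemma borel_measurable_torus:
  "f \<in> borel_measurable borel \<Longrightarrow> f \<in> borel_measurable torus"
  unfolding torus_def by (rule measurable_restrict_space1) simp

lemma continuous_torus: "continuous_on UNIV f \<Longrightarrow> f \<in> borel_measurable torus"
  by (intro borel_measurable_torus borel_measurable_continuous_onI)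

lemma integral_torus_prod:
  fixes f g :: "real \<Rightarrow> complex"
  assumes f: "continuous_on UNIV f" and g: "continuous_on UNIV g"
  shows "(\<integral>\<theta>. f (fst \<theta>) * g (snd \<theta>) \<partial>torus) =
     (\<integral>x. indicator {-pi..pi} x *\<^sub>R f x \<partial>lborel) * (\<integral>x. indicator {-pi..pi} x *\<^sub>R g x \<partial>lborel)"
proof -
  define F where "F = (\<lambda>x. indicator {-pi..pi} x *\<^sub>R f x)"
  define G where "G = (\<lambda>x. indicator {-pi..pi} x *\<^sub>R g x)"
  obtain Bf where Bf: "\<And>x. x \<in> {-pi..pi} \<Longrightarrow> cmod (f x) \<le> Bf"
    using compact_imp_bounded[OF compact_continuous_image[OF continuous_on_subset[OF f] compact_Icc[of "-pi" pi]]]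
    unfolding bounded_iff by fastforce
  obtain Bg where Bg: "\<And>x. x \<in> {-pi..pi} \<Longrightarrow> cmod (g x) \<le> Bg"
    using compact_imp_bounded[OF compact_continuous_image[OF continuous_on_subset[OF g] compact_Icc[of "-pi" pi]]]
    unfolding bounded_iff by fastforce
  have "0 \<le> Bf" using order_trans[OF norm_ge_zero Bf[of 0]] by simp
  have eq: "indicator ({-pi..pi} \<times> {-pi..pi}) \<theta> *\<^sub>R (f (fst \<theta>) * g (snd \<theta>)) = F (fst \<theta>) * G (snd \<theta>)" for \<theta>
    by (cases \<theta>) (auto simp: F_def G_def indicator_def)
  have cont: "continuous_on UNIV (\<lambda>\<theta>. f (fst \<theta>) * g (snd \<theta>))"
    by (intro continuous_intros continuous_on_compose2[OF f] continuous_on_compose2[OF g]) auto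
  have "integrable torus (\<lambda>\<theta>. f (fst \<theta>) * g (snd \<theta>))"
  proof (rule torus.integrable_const_bound[where B="Bf*Bg"])
    show "AE x in torus. cmod (f (fst x) * g (snd x)) \<le> Bf * Bg"
      using Bf Bg \<open>0 \<le> Bf\<close> by (intro AE_I2) (auto simp: space_torus norm_mult intro!: mult_mono)
    show "(\<lambda>\<theta>. f (fst \<theta>) * g (snd \<theta>)) \<in> borel_measurable torus"
      by (rule continuous_torus[OF cont])
  qed
  then have int: "integrable lborel (\<lambda>\<theta>. F (fst \<theta>) * G (snd \<theta>))"
    unfolding torus_def by (subst (asm) integrable_restrict_space) (auto simp: eq)
  have "(\<integral>\<theta>. f (fst \<theta>) * g (snd \<theta>) \<partial>torus) = (\<integral>\<theta>. F (fst \<theta>) * G (snd \<theta>) \<partial>lborel)"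
    unfolding torus_def by (subst integral_restrict_space) (auto simp: eq)
  also have "\<dots> = (\<integral>x. (\<integral>y. F x * G y \<partial>lborel) \<partial>lborel)"
    using lborel_pair.integral_fst'[of "\<lambda>\<theta>. F (fst \<theta>) * G (snd \<theta>)"] int
    by (simp add: lborel_prod)
  also have "\<dots> = (\<integral>x. F x \<partial>lborel) * (\<integral>y. G y \<partial>lborel)"
    by simp
  finally show ?thesis by (simp only: F_def G_def)
qed

lemma integral_cis_int:
  "(\<integral>x. indicator {-pi..pi} x *\<^sub>R cis (of_int k * x) \<partial>lborel) = (if k = 0 then of_real (2 * pi) else 0)"
proof (cases "k = 0")
  case False
  have "(\<integral>x. indicator {-pi..pi} x *\<^sub>R cis (of_int k * x) \<partial>lborel) =
     cis (of_int k * pi) / (\<i> * of_int k) - cis (of_int k * (- pi)) / (\<i> * of_int k)"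
  proof (rule integral_FTC_Icc)
    fix x :: real
    show "((\<lambda>x. cis (of_int k * x) / (\<i> * of_int k)) has_vector_derivative cis (of_int k * x))
        (at x within {-pi..pi})"
      unfolding cis_conv_exp using False
      by (auto intro!: derivative_eq_intros has_vector_derivative_real_field simp: field_simps)
  qed (auto intro!: continuous_intros)
  also have "cis (of_int k * (- pi)) = cis (of_int k * pi)"
  proof -
    have "cis (of_int k * pi) = cis (of_int k * (-pi)) * cis (2 * pi * of_int k)"
      by (simp add: cis_mult algebra_simps)
    then show ?thesis by (simp add: cis_multiple_2pi)
  qed
  finally show ?thesis using False by simp
next
  case True
  then show ?thesis by (simp add: scaleR_conv_of_real)
qed

lemma pairing_add: "pairing (x + y) \<theta> = pairing x \<theta> + pairing y \<theta>"
  and pairing_diff: "pairing (x - y) \<theta> = pairing x \<theta> - pairing y \<theta>"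
  and pairing_minus: "pairing (- x) \<theta> = - pairing x \<theta>"
  and pairing_zero [simp]: "pairing 0 \<theta> = 0"
  by (simp_all add: pairing_def algebra_simps)

lemma continuous_pairing [continuous_intros]: "continuous_on S (pairing x)"
  unfolding pairing_def by (intro continuous_intros)

lemma integral_cis_pairing:
  "(\<integral>\<theta>. cis (pairing x \<theta>) \<partial>torus) = (if x = 0 then of_real (4 * pi\<^sup>2) else 0)"
proof -
  have "(\<integral>\<theta>. cis (pairing x \<theta>) \<partial>torus) =
      (\<integral>\<theta>. cis (of_int (fst x) * fst \<theta>) * cis (of_int (snd x) * snd \<theta>) \<partial>torus)"
    by (simp add: cis_mult pairing_def)
  also have "\<dots> = (if x = 0 then of_real (4 * pi\<^sup>2) else 0)"
    by (subst integral_torus_prod)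
       (auto simp: integral_cis_int prod_eq_iff power2_eq_square intro!: continuous_intros)
  finally show ?thesis .
qed

section \<open>Trigonometric polynomials with real coefficients\<close>

definition trig_sum :: "(int \<times> int \<Rightarrow> real) \<Rightarrow> (int \<times> int) set \<Rightarrow> real \<times> real \<Rightarrow> complex" where
  "trig_sum c A \<theta> = (\<Sum>x\<in>A. of_real (c x) * cis (- pairing x \<theta>))"

text \<open>Real coefficients encode the symmetry \<open>T (- \<theta>) = cnj (T \<theta>)\<close>,
  so multiplying by such a \<open>T\<close> takes transforms of real functions to transforms of real
  functions.\<close>

definition trig_poly :: "(real \<times> real \<Rightarrow> complex) \<Rightarrow> bool" where
  "trig_poly T \<longleftrightarrow> (\<exists>A c. finite A \<and> T = trig_sum c A)"

lemma continuous_trig_sum [continuous_intros]: "continuous_on S (trig_sum c A)"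
  unfolding trig_sum_def [abs_def] by (intro continuous_intros)

lemma trig_sum_superset:
  "finite B \<Longrightarrow> A \<subseteq> B \<Longrightarrow> trig_sum c A = trig_sum (\<lambda>x. if x \<in> A then c x else 0) B"
  unfolding trig_sum_def [abs_def]
  by (intro ext sum.mono_neutral_cong_left) auto

lemma trig_sum_diff: "trig_sum c A \<theta> - trig_sum d A \<theta> = trig_sum (\<lambda>x. c x - d x) A \<theta>"
  unfolding trig_sum_def by (simp add: sum_subtractf algebra_simps)

lemma trig_poly_cis: "trig_poly (\<lambda>\<theta>. cis (pairing x \<theta>))"
  unfolding trig_poly_def
  by (intro exI[of _ "{- x}"] exI[of _ "\<lambda>_. 1"]) (auto simp: trig_sum_def pairing_minus fun_eq_iff)

lemma trig_poly_add:
  assumes "trig_poly S" "trig_poly T"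
  shows "trig_poly (\<lambda>\<theta>. S \<theta> + T \<theta>)"
proof -
  obtain A a B b where *: "finite A" "S = trig_sum a A" "finite B" "T = trig_sum b B"
    using assms unfolding trig_poly_def by blast
  let ?a = "\<lambda>x. if x \<in> A then a x else 0" and ?b = "\<lambda>x. if x \<in> B then b x else 0"
  have "S = trig_sum ?a (A \<union> B)" "T = trig_sum ?b (A \<union> B)"
    using * by (auto intro!: trig_sum_superset)
  then have "(\<lambda>\<theta>. S \<theta> + T \<theta>) = trig_sum (\<lambda>x. ?a x + ?b x) (A \<union> B)"
    by (simp add: trig_sum_def fun_eq_iff sum.distrib [symmetric] algebra_simps)
  then show ?thesis using * unfolding trig_poly_def by blast
qed

lemma trig_poly_const_mult:
  assumes "trig_poly T" shows "trig_poly (\<lambda>\<theta>. of_real r * T \<theta>)"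
proof -
  obtain B b where *: "finite B" "T = trig_sum b B"
    using assms unfolding trig_poly_def by blast
  then have "(\<lambda>\<theta>. of_real r * T \<theta>) = trig_sum (\<lambda>x. r * b x) B"
    by (simp add: trig_sum_def fun_eq_iff sum_distrib_left algebra_simps)
  then show ?thesis using * unfolding trig_poly_def by blast
qed

lemma trig_poly_const: "trig_poly (\<lambda>\<theta>. of_real r)"
  using trig_poly_const_mult[OF trig_poly_cis[of 0]] by simp

lemma trig_poly_sum:
  "finite A \<Longrightarrow> (\<And>x. x \<in> A \<Longrightarrow> trig_poly (T x)) \<Longrightarrow> trig_poly (\<lambda>\<theta>. \<Sum>x\<in>A. T x \<theta>)"
  by (induction A rule: finite_induct) (auto intro: trig_poly_add trig_poly_const[of 0, simplified])

lemma trig_poly_mult: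
  assumes "trig_poly S" "trig_poly T"
  shows "trig_poly (\<lambda>\<theta>. S \<theta> * T \<theta>)"
proof -
  obtain A a B b where *: "finite A" "S = trig_sum a A" "finite B" "T = trig_sum b B"
    using assms unfolding trig_poly_def by blast
  have "(\<lambda>\<theta>. S \<theta> * T \<theta>) = (\<lambda>\<theta>. \<Sum>x\<in>A. \<Sum>y\<in>B. of_real (a x * b y) * cis (pairing (- (x + y)) \<theta>))"
    by (simp add: * trig_sum_def fun_eq_iff sum_product pairing_def cis_mult algebra_simps)
  moreover have "trig_poly \<dots>"
    using * by (intro trig_poly_sum trig_poly_const_mult trig_poly_cis)
  ultimately show ?thesis by simp
qed

lemma trig_poly_continuous: "trig_poly T \<Longrightarrow> continuous_on S T"
  unfolding trig_poly_def by (auto intro: continuous_intros)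

lemma trig_poly_bounded: "trig_poly T \<Longrightarrow> \<exists>K. \<forall>\<theta>. cmod (T \<theta>) \<le> K"
proof -
  assume "trig_poly T"
  then obtain A c where "T = trig_sum c A" unfolding trig_poly_def by blast
  then have "cmod (T \<theta>) \<le> (\<Sum>x\<in>A. \<bar>c x\<bar>)" for \<theta>
    unfolding trig_sum_def by (auto intro!: order_trans[OF norm_sum] sum_mono simp: norm_mult)
  then show ?thesis by blast
qed

lemma trig_poly_measurable [measurable_dest]: "trig_poly T \<Longrightarrow> T \<in> borel_measurable torus"
  by (intro continuous_torus trig_poly_continuous)

subsection \<open>Square integrable functions on the torus\<close>

definition L2 :: "(real \<times> real \<Rightarrow> complex) \<Rightarrow> bool" where
  "L2 F \<longleftrightarrow> F \<in> borel_measurable torus \<and> integrable torus (\<lambda>\<theta>. (cmod (F \<theta>))\<^sup>2)"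

abbreviation sqint :: "(real \<times> real \<Rightarrow> complex) \<Rightarrow> real" where
  "sqint F \<equiv> \<integral>\<theta>. (cmod (F \<theta>))\<^sup>2 \<partial>torus"

lemma L2_bounded_mult:
  assumes "L2 F" and [measurable]: "m \<in> borel_measurable torus" and K: "\<And>\<theta>. cmod (m \<theta>) \<le> K"
  shows "L2 (\<lambda>\<theta>. m \<theta> * F \<theta>)" "sqint (\<lambda>\<theta>. m \<theta> * F \<theta>) \<le> K\<^sup>2 * sqint F"
proof -
  have [measurable]: "F \<in> borel_measurable torus" using assms by (simp add: L2_def)
  have int: "integrable torus (\<lambda>\<theta>. (cmod (F \<theta>))\<^sup>2)" using assms by (simp add: L2_def)
  have le: "(cmod (m \<theta> * F \<theta>))\<^sup>2 \<le> K\<^sup>2 * (cmod (F \<theta>))\<^sup>2" for \<theta>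
    using K[of \<theta>] by (auto simp: norm_mult power_mult_distrib intro!: mult_right_mono power_mono)
  have int': "integrable torus (\<lambda>\<theta>. (cmod (m \<theta> * F \<theta>))\<^sup>2)"
    by (rule Bochner_Integration.integrable_bound[OF integrable_mult_right[OF int, of "K\<^sup>2"]])
       (use le in auto)
  then show "L2 (\<lambda>\<theta>. m \<theta> * F \<theta>)" by (simp add: L2_def)
  have "sqint (\<lambda>\<theta>. m \<theta> * F \<theta>) \<le> (\<integral>\<theta>. K\<^sup>2 * (cmod (F \<theta>))\<^sup>2 \<partial>torus)"
    by (intro integral_mono int' integrable_mult_right int le)
  then show "sqint (\<lambda>\<theta>. m \<theta> * F \<theta>) \<le> K\<^sup>2 * sqint F" by simp
qed

lemma L2_trig_poly: "trig_poly T \<Longrightarrow> L2 T"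
proof -
  assume T: "trig_poly T"
  obtain K where K: "\<And>\<theta>. cmod (T \<theta>) \<le> K" using trig_poly_bounded[OF T] by blast
  have [measurable]: "T \<in> borel_measurable torus" by (rule trig_poly_measurable[OF T])
  have "integrable torus (\<lambda>\<theta>. (cmod (T \<theta>))\<^sup>2)"
    by (rule torus.integrable_const_bound[where B="K\<^sup>2"]) (auto intro!: power_mono K)
  then show "L2 T" by (simp add: L2_def)
qed

lemma norm_diff_squared_le: "(cmod (a - b))\<^sup>2 \<le> 2 * (cmod a)\<^sup>2 + 2 * (cmod b)\<^sup>2"
proof -
  have "(cmod (a - b))\<^sup>2 \<le> (cmod a + cmod b)\<^sup>2"
    by (intro power_mono norm_triangle_ineq4) auto
  also have "\<dots> \<le> 2 * (cmod a)\<^sup>2 + 2 * (cmod b)\<^sup>2"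
    using sum_squares_bound[of "cmod a" "cmod b"] by (simp add: power2_sum)
  finally show ?thesis .
qed

lemma L2_diff:
  assumes F: "L2 F" and G: "L2 G"
  shows "L2 (\<lambda>\<theta>. F \<theta> - G \<theta>)" "sqint (\<lambda>\<theta>. F \<theta> - G \<theta>) \<le> 2 * sqint F + 2 * sqint G"
proof -
  have [measurable]: "F \<in> borel_measurable torus" "G \<in> borel_measurable torus"
    using assms by (auto simp: L2_def)
  have int: "integrable torus (\<lambda>\<theta>. 2 * (cmod (F \<theta>))\<^sup>2 + 2 * (cmod (G \<theta>))\<^sup>2)"
    using assms by (auto simp: L2_def)
  have int': "integrable torus (\<lambda>\<theta>. (cmod (F \<theta> - G \<theta>))\<^sup>2)"
    by (rule Bochner_Integration.integrable_bound[OF int]) (use norm_diff_squared_le in auto)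
  then show "L2 (\<lambda>\<theta>. F \<theta> - G \<theta>)" by (simp add: L2_def)
  have "sqint (\<lambda>\<theta>. F \<theta> - G \<theta>) \<le> (\<integral>\<theta>. 2 * (cmod (F \<theta>))\<^sup>2 + 2 * (cmod (G \<theta>))\<^sup>2 \<partial>torus)"
    by (intro integral_mono int int' norm_diff_squared_le)
  also have "\<dots> = 2 * sqint F + 2 * sqint G" using F G by (simp add: L2_def)
  finally show "sqint (\<lambda>\<theta>. F \<theta> - G \<theta>) \<le> 2 * sqint F + 2 * sqint G" .
qed

lemma borel_measurable_cnj [measurable (raw)]:
  "f \<in> borel_measurable M \<Longrightarrow> (\<lambda>x. cnj (f x)) \<in> borel_measurable M"
  by (rule borel_measurable_continuous_on[OF continuous_on_cnj[OF continuous_on_id]])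

lemma L2_integrable_mult:
  assumes "L2 F" "L2 G" shows "integrable torus (\<lambda>\<theta>. F \<theta> * cnj (G \<theta>))"
proof -
  have [measurable]: "F \<in> borel_measurable torus" "G \<in> borel_measurable torus"
    using assms by (auto simp: L2_def)
  have int: "integrable torus (\<lambda>\<theta>. (cmod (F \<theta>))\<^sup>2 + (cmod (G \<theta>))\<^sup>2)"
    using assms by (auto simp: L2_def)
  have le: "cmod (F \<theta> * cnj (G \<theta>)) \<le> (cmod (F \<theta>))\<^sup>2 + (cmod (G \<theta>))\<^sup>2" for \<theta>
  proof -
    have "2 * (cmod (F \<theta>) * cmod (G \<theta>)) \<le> (cmod (F \<theta>))\<^sup>2 + (cmod (G \<theta>))\<^sup>2"
      using sum_squares_bound[of "cmod (F \<theta>)" "cmod (G \<theta>)"] by simp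
    moreover have "0 \<le> cmod (F \<theta>) * cmod (G \<theta>)" by simp
    ultimately show ?thesis unfolding norm_mult complex_mod_cnj by linarith
  qed
  show ?thesis
    by (rule Bochner_Integration.integrable_bound[OF int]) (use le in auto)
qed

lemma L2_one: "L2 (\<lambda>_. 1)"
  using L2_trig_poly[OF trig_poly_const[of 1]] by simp

text \<open>Weighted AM-GM replaces the Cauchy--Schwarz inequality.\<close>

lemma integral_norm_le_sqint:
  assumes F: "L2 F" and "0 < \<eta>"
  shows "integrable torus F" "(\<integral>\<theta>. cmod (F \<theta>) \<partial>torus) \<le> \<eta> * measure torus (space torus) + sqint F / \<eta>"
proof -
  show int: "integrable torus F" using L2_integrable_mult[OF F L2_one] by simp
  have *: "cmod (F \<theta>) \<le> \<eta> + (cmod (F \<theta>))\<^sup>2 / \<eta>" for \<theta>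
  proof (cases "cmod (F \<theta>) \<le> \<eta>")
    case True then show ?thesis using \<open>0 < \<eta>\<close> by (auto intro: add_increasing2)
  next
    case False
    then have "cmod (F \<theta>) \<le> (cmod (F \<theta>))\<^sup>2 / \<eta>" using \<open>0 < \<eta>\<close>
      by (simp add: field_simps power2_eq_square mult_right_mono)
    then show ?thesis using \<open>0 < \<eta>\<close> by simp
  qed
  have "(\<integral>\<theta>. cmod (F \<theta>) \<partial>torus) \<le> (\<integral>\<theta>. \<eta> + (cmod (F \<theta>))\<^sup>2 / \<eta> \<partial>torus)"
    using F int by (intro integral_mono *) (auto simp: L2_def)
  also have "\<dots> = \<eta> * measure torus (space torus) + sqint F / \<eta>"
    using F by (subst Bochner_Integration.integral_add) (auto simp: L2_def)
  finally show "(\<integral>\<theta>. cmod (F \<theta>) \<partial>torus) \<le> \<eta> * measure torus (space torus) + sqint F / \<eta>" .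
qed

lemma sqint_nonneg: "0 \<le> sqint F" by simp

text \<open>On a finite measure convergence in the square mean controls the first mean, and the
  first mean is what bounds Fourier coefficients.\<close>

lemma sqint_tendsto_0_imp:
  assumes F: "\<And>i. L2 (F i)" and lim: "((\<lambda>i. sqint (F i)) \<longlongrightarrow> 0) L"
  shows "((\<lambda>i. \<integral>\<theta>. cmod (F i \<theta>) \<partial>torus) \<longlongrightarrow> 0) L"
proof (rule tendstoI)
  fix e :: real assume "0 < e"
  define \<mu> where "\<mu> = measure torus (space torus)"
  define \<eta> where "\<eta> = e / (2 * (\<mu> + 1))"
  have "0 \<le> \<mu>" by (simp add: \<mu>_def)
  have "0 < \<eta>" using \<open>0 < e\<close> \<open>0 \<le> \<mu>\<close> by (simp add: \<eta>_def)
  have "\<eta> * \<mu> \<le> e / 2"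
  proof -
    have "\<eta> * \<mu> = (e / 2) * (\<mu> / (\<mu> + 1))" by (simp add: \<eta>_def)
    also have "\<dots> \<le> (e / 2) * 1" using \<open>0 < e\<close> \<open>0 \<le> \<mu>\<close> by (intro mult_left_mono) (auto simp: field_simps)
    finally show ?thesis by simp
  qed
  have "0 < \<eta> * e / 2" using \<open>0 < e\<close> \<open>0 < \<eta>\<close> by simp
  from order_tendstoD(2)[OF lim this]
  show "\<forall>\<^sub>F i in L. dist (\<integral>\<theta>. cmod (F i \<theta>) \<partial>torus) 0 < e"
  proof eventually_elim
    case (elim i)
    have "(\<integral>\<theta>. cmod (F i \<theta>) \<partial>torus) \<le> \<eta> * \<mu> + sqint (F i) / \<eta>"
      unfolding \<mu>_def by (rule integral_norm_le_sqint[OF F \<open>0 < \<eta>\<close>])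
    also have "sqint (F i) / \<eta> < e / 2" using elim \<open>0 < \<eta>\<close> by (simp add: field_simps)
    finally show ?case using \<open>\<eta> * \<mu> \<le> e / 2\<close> by (simp add: dist_real_def)
  qed
qed

subsection \<open>Fourier transforms\<close>

lemma has_fourier_transform_iff:
  "has_fourier_transform f F \<longleftrightarrow> L2 F \<and>
     ((\<lambda>A. sqint (\<lambda>\<theta>. F \<theta> - trig_sum f A \<theta>)) \<longlongrightarrow> 0) (finite_subsets_at_top UNIV)"
  unfolding has_fourier_transform_def L2_def trig_sum_def by auto

lemma finite_subsets_eventually:
  "finite A0 \<Longrightarrow> (\<And>A. finite A \<Longrightarrow> A0 \<subseteq> A \<Longrightarrow> P A) \<Longrightarrow> eventually P (finite_subsets_at_top UNIV)"
  unfolding eventually_finite_subsets_at_top by blast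

lemma L2_trig_sum: "finite A \<Longrightarrow> L2 (trig_sum c A)"
  by (intro L2_trig_poly) (auto simp: trig_poly_def)

lemma integrable_L2_cis: "L2 F \<Longrightarrow> integrable torus (\<lambda>\<theta>. F \<theta> * cis (pairing x \<theta>))"
proof -
  assume F: "L2 F"
  have "L2 (\<lambda>\<theta>. cnj (cis (pairing x \<theta>)))"
    using L2_trig_poly[OF trig_poly_cis[of "-x"]] by (simp add: pairing_minus cis_cnj)
  from L2_integrable_mult[OF F this] show ?thesis by simp
qed

text \<open>\<open>Re\<close> only adjusts the type: for a limit of polynomials with real
  coefficients the integral is already real. The factor \<open>4 * pi\<^sup>2\<close> is the measure
  of the torus.\<close>

definition fourier_coeff :: "(real \<times> real \<Rightarrow> complex) \<Rightarrow> int \<times> int \<Rightarrow> real" where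
  "fourier_coeff H x = Re (\<integral>\<theta>. H \<theta> * cis (pairing x \<theta>) \<partial>torus) / (4 * pi\<^sup>2)"

lemma fourier_coeff_cong_AE:
  "L2 F \<Longrightarrow> L2 G \<Longrightarrow> AE \<theta> in torus. F \<theta> = G \<theta> \<Longrightarrow> fourier_coeff F = fourier_coeff G"
  unfolding fourier_coeff_def fun_eq_iff
  by (intro allI arg_cong2[where f="(/)"] arg_cong[where f=Re] integral_cong_AE refl
       borel_measurable_integrable[OF integrable_L2_cis]) auto

lemma fourier_coeff_diff:
  "L2 F \<Longrightarrow> L2 G \<Longrightarrow> fourier_coeff (\<lambda>\<theta>. F \<theta> - G \<theta>) x = fourier_coeff F x - fourier_coeff G x"
  unfolding fourier_coeff_def
  by (simp add: left_diff_distrib diff_divide_distrib integrable_L2_cis)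

lemma fourier_coeff_const_mult:
  "L2 F \<Longrightarrow> fourier_coeff (\<lambda>\<theta>. of_real r * F \<theta>) x = r * fourier_coeff F x"
  unfolding fourier_coeff_def
  by (simp add: mult.assoc integrable_L2_cis)

lemma fourier_coeff_trig_sum:
  assumes "finite A" shows "fourier_coeff (trig_sum c A) x = (if x \<in> A then c x else 0)"
proof -
  have *: "cis (- pairing y \<theta>) * cis (pairing x \<theta>) = cis (pairing (x - y) \<theta>)" for y \<theta>
    by (simp add: cis_mult pairing_diff)
  have "(\<integral>\<theta>. trig_sum c A \<theta> * cis (pairing x \<theta>) \<partial>torus) =
     (\<integral>\<theta>. (\<Sum>y\<in>A. of_real (c y) * cis (pairing (x - y) \<theta>)) \<partial>torus)"
    unfolding trig_sum_def sum_distrib_right by (simp only: mult.assoc *)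
  also have "\<dots> = (\<Sum>y\<in>A. \<integral>\<theta>. of_real (c y) * cis (pairing (x - y) \<theta>) \<partial>torus)"
    using integrable_L2_cis[OF L2_one] by (intro Bochner_Integration.integral_sum) simp
  also have "\<dots> = (\<Sum>y\<in>A. of_real (c y) * (if x = y then of_real (4 * pi\<^sup>2) else 0))"
    by (simp add: integral_cis_pairing)
  also have "\<dots> = (if x \<in> A then of_real (c x * (4 * pi\<^sup>2)) else 0)"
    using assms by (simp add: if_distrib[where f="\<lambda>z. _ * z"] sum.delta' cong: if_cong)
  finally show ?thesis by (simp add: fourier_coeff_def)
qed

lemma fourier_coeff_le: "L2 F \<Longrightarrow> \<bar>fourier_coeff F x\<bar> \<le> (\<integral>\<theta>. cmod (F \<theta>) \<partial>torus) / (4 * pi\<^sup>2)"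
proof -
  assume F: "L2 F"
  have "\<bar>Re (\<integral>\<theta>. F \<theta> * cis (pairing x \<theta>) \<partial>torus)\<bar> \<le> cmod (\<integral>\<theta>. F \<theta> * cis (pairing x \<theta>) \<partial>torus)"
    by (rule abs_Re_le_cmod)
  also have "\<dots> \<le> (\<integral>\<theta>. cmod (F \<theta> * cis (pairing x \<theta>)) \<partial>torus)"
    by (rule integral_norm_bound)
  finally show ?thesis by (simp add: fourier_coeff_def norm_mult divide_right_mono)
qed

text \<open>A partial sum over \<open>A\<close> has coefficient \<open>f x\<close> at
  \<open>x\<close> as soon as \<open>x\<close> lies in \<open>A\<close>, and coefficients are
  continuous for the first mean. This is one of the two uniqueness facts behind the
  \<open>THE\<close> of \<open>fourier_multiplier\<close>.\<close>

lemma fourier_coeff_unique: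
  assumes "has_fourier_transform f F" shows "f = fourier_coeff F"
proof
  fix x
  have F: "L2 F" and lim: "((\<lambda>A. sqint (\<lambda>\<theta>. F \<theta> - trig_sum f A \<theta>)) \<longlongrightarrow> 0) (finite_subsets_at_top UNIV)"
    using assms by (auto simp: has_fourier_transform_iff)
  \<comment> \<open>\<open>sqint_tendsto_0_imp\<close> asks for square integrability at every index,
    so infinite \<open>A\<close> get the zero function.\<close>
  let ?g = "\<lambda>A. if finite A then trig_sum f A else (\<lambda>_. 0)"
  have L2g: "L2 (\<lambda>\<theta>. F \<theta> - ?g A \<theta>)" for A
    using L2_diff(1)[OF F L2_trig_sum] F by auto
  have "((\<lambda>A. sqint (\<lambda>\<theta>. F \<theta> - ?g A \<theta>)) \<longlongrightarrow> 0) (finite_subsets_at_top UNIV)"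
    by (rule Lim_transform_eventually[OF lim]) (auto intro: finite_subsets_eventually[of "{}"])
  from sqint_tendsto_0_imp[OF L2g this]
  have lim': "((\<lambda>A. (\<integral>\<theta>. cmod (F \<theta> - ?g A \<theta>) \<partial>torus) / (4 * pi\<^sup>2)) \<longlongrightarrow> 0) (finite_subsets_at_top UNIV)"
    by (rule tendsto_divide_zero)
  have "((\<lambda>A. fourier_coeff (\<lambda>\<theta>. F \<theta> - ?g A \<theta>) x) \<longlongrightarrow> 0) (finite_subsets_at_top UNIV)"
    by (rule Lim_null_comparison[OF _ lim']) (use fourier_coeff_le[OF L2g] in auto)
  moreover have "\<forall>\<^sub>F A in finite_subsets_at_top UNIV. fourier_coeff (\<lambda>\<theta>. F \<theta> - ?g A \<theta>) x = fourier_coeff F x - f x"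
    by (rule finite_subsets_eventually[of "{x}"])
       (auto simp: fourier_coeff_diff F L2_trig_sum fourier_coeff_trig_sum)
  ultimately have "((\<lambda>A::(int\<times>int) set. fourier_coeff F x - f x) \<longlongrightarrow> 0) (finite_subsets_at_top UNIV)"
    by (rule Lim_transform_eventually)
  then show "f x = fourier_coeff F x"
    by (simp add: tendsto_const_iff)
qed

lemma fourier_transform_unique_AE:
  assumes F: "has_fourier_transform f F" and G: "has_fourier_transform f G"
  shows "AE \<theta> in torus. F \<theta> = G \<theta>"
proof -
  have L2: "L2 F" "L2 G" using assms by (auto simp: has_fourier_transform_iff)
  let ?S = "\<lambda>A. 2 * sqint (\<lambda>\<theta>. F \<theta> - trig_sum f A \<theta>) + 2 * sqint (\<lambda>\<theta>. G \<theta> - trig_sum f A \<theta>)"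
  have "(?S \<longlongrightarrow> 2 * 0 + 2 * 0) (finite_subsets_at_top UNIV)"
    using assms unfolding has_fourier_transform_iff by (intro tendsto_intros) auto
  then have lim: "(?S \<longlongrightarrow> 0) (finite_subsets_at_top UNIV)" by simp
  have ev: "\<forall>\<^sub>F A in finite_subsets_at_top UNIV. sqint (\<lambda>\<theta>. F \<theta> - G \<theta>) \<le> ?S A"
  proof (rule finite_subsets_eventually[of "{}"])
    fix A :: "(int\<times>int) set" assume "finite A"
    then show "sqint (\<lambda>\<theta>. F \<theta> - G \<theta>) \<le> ?S A"
      using L2_diff(2)[OF L2_diff(1)[OF L2(1) L2_trig_sum] L2_diff(1)[OF L2(2) L2_trig_sum], of A A f f]
      by simp
  qed simp
  have "sqint (\<lambda>\<theta>. F \<theta> - G \<theta>) \<le> 0"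
    by (rule tendsto_lowerbound[OF lim ev]) simp
  then have "sqint (\<lambda>\<theta>. F \<theta> - G \<theta>) = 0" using sqint_nonneg[of "\<lambda>\<theta>. F \<theta> - G \<theta>"] by linarith
  then have "AE \<theta> in torus. (cmod (F \<theta> - G \<theta>))\<^sup>2 = 0"
    using L2_diff(1)[OF L2] by (subst (asm) integral_nonneg_eq_0_iff_AE) (auto simp: L2_def)
  then show ?thesis by simp
qed

text \<open>Pythagoras: the error \<open>E\<close> of the Fourier partial sum has vanishing
  coefficients on \<open>A\<close>, so it is orthogonal to the difference \<open>Q\<close> of the
  two candidates. As \<open>Q\<close> has real coefficients, the real part of the inner product only
  involves the real parts that \<open>fourier_coeff\<close> records.\<close>

lemma best_approximation:
  assumes H: "L2 H" and A: "finite A"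
  shows "sqint (\<lambda>\<theta>. H \<theta> - trig_sum (fourier_coeff H) A \<theta>) \<le> sqint (\<lambda>\<theta>. H \<theta> - trig_sum t A \<theta>)"
proof -
  define E where "E = (\<lambda>\<theta>. H \<theta> - trig_sum (fourier_coeff H) A \<theta>)"
  define Q where "Q = trig_sum (\<lambda>x. fourier_coeff H x - t x) A"
  have E: "L2 E" unfolding E_def by (intro L2_diff H L2_trig_sum A)
  have Q: "L2 Q" unfolding Q_def by (intro L2_trig_sum A)
  have EQ: "H \<theta> - trig_sum t A \<theta> = E \<theta> + Q \<theta>" for \<theta>
    unfolding E_def Q_def trig_sum_diff[symmetric] by simp
  have fcE: "fourier_coeff E x = 0" if "x \<in> A" for x
    unfolding E_def using that by (simp add: fourier_coeff_diff H L2_trig_sum A fourier_coeff_trig_sum)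
  have "Re (\<integral>\<theta>. E \<theta> * cnj (Q \<theta>) \<partial>torus) =
     Re (\<integral>\<theta>. (\<Sum>x\<in>A. of_real (fourier_coeff H x - t x) * (E \<theta> * cis (pairing x \<theta>))) \<partial>torus)"
    unfolding Q_def trig_sum_def by (simp add: sum_distrib_left cis_cnj mult_ac)
  also have "\<dots> = Re (\<Sum>x\<in>A. of_real (fourier_coeff H x - t x) * (\<integral>\<theta>. E \<theta> * cis (pairing x \<theta>) \<partial>torus))"
    using integrable_L2_cis[OF E] by (subst Bochner_Integration.integral_sum) auto
  also have "\<dots> = (\<Sum>x\<in>A. (fourier_coeff H x - t x) * (fourier_coeff E x * (4 * pi\<^sup>2)))"
    by (simp add: fourier_coeff_def)
  also have "\<dots> = 0" using fcE by simp
  finally have 0: "Re (\<integral>\<theta>. E \<theta> * cnj (Q \<theta>) \<partial>torus) = 0" .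
  have sq: "(cmod (E \<theta> + Q \<theta>))\<^sup>2 = (cmod (E \<theta>))\<^sup>2 + (cmod (Q \<theta>))\<^sup>2 + 2 * Re (E \<theta> * cnj (Q \<theta>))" for \<theta>
    unfolding cmod_power2 by (simp add: power2_eq_square algebra_simps)
  have intR: "integrable torus (\<lambda>\<theta>. Re (E \<theta> * cnj (Q \<theta>)))"
    by (intro integrable_Re L2_integrable_mult E Q)
  have "sqint (\<lambda>\<theta>. H \<theta> - trig_sum t A \<theta>) = sqint E + sqint Q + 2 * (\<integral>\<theta>. Re (E \<theta> * cnj (Q \<theta>)) \<partial>torus)"
    unfolding EQ sq using E Q intR by (simp add: L2_def del: times_complex.sel complex_cnj)
  also have "(\<integral>\<theta>. Re (E \<theta> * cnj (Q \<theta>)) \<partial>torus) = 0"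
    using 0 L2_integrable_mult[OF E Q] by (simp del: times_complex.sel complex_cnj)
  finally show ?thesis using sqint_nonneg[of Q] by (simp add: E_def)
qed

text \<open>A single approximant yields unconditional convergence: on every \<open>A\<close> that
  contains its frequencies, the Fourier partial sum is at least as good. This stands in for
  completeness of the trigonometric system.\<close>

lemma trig_approx_imp_fourier_transform:
  assumes H: "L2 H" and approx: "\<And>e. 0 < e \<Longrightarrow> \<exists>T. trig_poly T \<and> sqint (\<lambda>\<theta>. H \<theta> - T \<theta>) < e"
  shows "has_fourier_transform (fourier_coeff H) H"
  unfolding has_fourier_transform_iff
proof (intro conjI H tendstoI)
  fix e :: real assume "0 < e"
  obtain A0 t where A0: "finite A0" and t: "sqint (\<lambda>\<theta>. H \<theta> - trig_sum t A0 \<theta>) < e"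
    using approx[OF \<open>0 < e\<close>] unfolding trig_poly_def by blast
  show "\<forall>\<^sub>F A in finite_subsets_at_top UNIV. dist (sqint (\<lambda>\<theta>. H \<theta> - trig_sum (fourier_coeff H) A \<theta>)) 0 < e"
  proof (rule finite_subsets_eventually[OF A0])
    fix A assume A: "finite A" "A0 \<subseteq> A"
    show "dist (sqint (\<lambda>\<theta>. H \<theta> - trig_sum (fourier_coeff H) A \<theta>)) 0 < e"
      using best_approximation[OF H A(1), of "\<lambda>x. if x \<in> A0 then t x else 0"] t
      unfolding trig_sum_superset[OF A, of t, symmetric] by (simp add: dist_real_def)
  qed
qed

subsection \<open>Fourier multipliers\<close>

text \<open>The uniform bound \<open>K\<close> feeds dominated convergence, and the polynomials
  \<open>M n\<close> carry approximability by trigonometric polynomials from \<open>F\<close> to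
  \<open>m F\<close>. Existence of the multiplied function thus follows from
  \<open>trig_approx_imp_fourier_transform\<close>, and it is real because the coefficients
  are.\<close>

definition admissible_multiplier :: "(real \<times> real \<Rightarrow> complex) \<Rightarrow> bool" where
  "admissible_multiplier m \<longleftrightarrow> m \<in> borel_measurable torus \<and>
     (\<exists>M K. (\<forall>n. trig_poly (M n)) \<and> (\<forall>n. \<forall>\<theta>. cmod (M n \<theta>) \<le> K) \<and> (\<forall>\<theta>. cmod (m \<theta>) \<le> K) \<and>
        (AE \<theta> in torus. (\<lambda>n. M n \<theta>) \<longlonglongrightarrow> m \<theta>))"

lemma fourier_multiplier_transform:
  assumes m: "admissible_multiplier m" and f: "has_fourier_transform f F"
  shows "has_fourier_transform (fourier_coeff (\<lambda>\<theta>. m \<theta> * F \<theta>)) (\<lambda>\<theta>. m \<theta> * F \<theta>)"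
proof -
  obtain M K where m_meas [measurable]: "m \<in> borel_measurable torus"
    and M: "\<And>n. trig_poly (M n)" and MK: "\<And>n \<theta>. cmod (M n \<theta>) \<le> K" and mK: "\<And>\<theta>. cmod (m \<theta>) \<le> K"
    and lim: "AE \<theta> in torus. (\<lambda>n. M n \<theta>) \<longlonglongrightarrow> m \<theta>"
    using m unfolding admissible_multiplier_def by blast
  have M_meas [measurable]: "M n \<in> borel_measurable torus" for n by (rule trig_poly_measurable[OF M])
  have F: "L2 F" and limF: "((\<lambda>A. sqint (\<lambda>\<theta>. F \<theta> - trig_sum f A \<theta>)) \<longlongrightarrow> 0) (finite_subsets_at_top UNIV)"
    using f by (auto simp: has_fourier_transform_iff)
  have [measurable]: "F \<in> borel_measurable torus" using F by (simp add: L2_def)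
  have mF: "L2 (\<lambda>\<theta>. m \<theta> * F \<theta>)" by (rule L2_bounded_mult[OF F m_meas mK])
  have "(\<lambda>n. sqint (\<lambda>\<theta>. (m \<theta> - M n \<theta>) * F \<theta>)) \<longlonglongrightarrow> (\<integral>\<theta>. 0 \<partial>torus)"
  proof (rule integral_dominated_convergence[where w="\<lambda>\<theta>. (2 * K)\<^sup>2 * (cmod (F \<theta>))\<^sup>2"])
    show "AE \<theta> in torus. (\<lambda>n. (cmod ((m \<theta> - M n \<theta>) * F \<theta>))\<^sup>2) \<longlonglongrightarrow> 0"
      using lim
    proof eventually_elim
      case (elim \<theta>)
      have "(\<lambda>n. (cmod ((m \<theta> - M n \<theta>) * F \<theta>))\<^sup>2) \<longlonglongrightarrow> (cmod ((m \<theta> - m \<theta>) * F \<theta>))\<^sup>2"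
        by (intro tendsto_intros elim)
      then show ?case by simp
    qed
    show "AE \<theta> in torus. norm ((cmod ((m \<theta> - M n \<theta>) * F \<theta>))\<^sup>2) \<le> (2 * K)\<^sup>2 * (cmod (F \<theta>))\<^sup>2" for n
    proof (rule AE_I2)
      fix \<theta>
      have "cmod (m \<theta> - M n \<theta>) \<le> 2 * K"
        using norm_triangle_ineq4[of "m \<theta>" "M n \<theta>"] mK[of \<theta>] MK[of n \<theta>] by linarith
      then show "norm ((cmod ((m \<theta> - M n \<theta>) * F \<theta>))\<^sup>2) \<le> (2 * K)\<^sup>2 * (cmod (F \<theta>))\<^sup>2"
        unfolding norm_mult power_mult_distrib[of "cmod _" "cmod _"] real_norm_def abs_mult abs_power2
        by (intro mult_right_mono power_mono) auto
    qed
  qed (use F in \<open>auto simp: L2_def\<close>)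
  then have lim1: "(\<lambda>n. sqint (\<lambda>\<theta>. (m \<theta> - M n \<theta>) * F \<theta>)) \<longlonglongrightarrow> 0" by simp
  show ?thesis
  proof (rule trig_approx_imp_fourier_transform[OF mF])
    fix e :: real assume "0 < e"
    have "0 < e / 4" using \<open>0 < e\<close> by simp
    from eventually_happens[OF order_tendstoD(2)[OF lim1 this]]
    obtain n where n: "sqint (\<lambda>\<theta>. (m \<theta> - M n \<theta>) * F \<theta>) < e / 4" by auto
    have "0 < e / (4 * (K\<^sup>2 + 1))" using \<open>0 < e\<close> by (intro divide_pos_pos) (auto intro: add_nonneg_pos)
    from order_tendstoD(2)[OF limF this] obtain A where A: "finite A"
      "sqint (\<lambda>\<theta>. F \<theta> - trig_sum f A \<theta>) < e / (4 * (K\<^sup>2 + 1))"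
      unfolding eventually_finite_subsets_at_top by blast
    have L: "L2 (\<lambda>\<theta>. F \<theta> - trig_sum f A \<theta>)" by (intro L2_diff F L2_trig_sum A)
    have "sqint (\<lambda>\<theta>. M n \<theta> * (F \<theta> - trig_sum f A \<theta>)) \<le> K\<^sup>2 * sqint (\<lambda>\<theta>. F \<theta> - trig_sum f A \<theta>)"
      by (rule L2_bounded_mult[OF L M_meas MK])
    also have "\<dots> \<le> (K\<^sup>2 + 1) * sqint (\<lambda>\<theta>. F \<theta> - trig_sum f A \<theta>)"
      by (intro mult_right_mono) auto
    also have "\<dots> < e / 4"
    proof -
      have "0 < K\<^sup>2 + 1" by (intro add_nonneg_pos) auto
      with A(2) show ?thesis by (simp add: field_simps)
    qed
    finally have 2: "sqint (\<lambda>\<theta>. M n \<theta> * (F \<theta> - trig_sum f A \<theta>)) < e / 4" .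
    have La: "L2 (\<lambda>\<theta>. (m \<theta> - M n \<theta>) * F \<theta>)"
      unfolding left_diff_distrib by (rule L2_diff(1)[OF mF L2_bounded_mult(1)[OF F M_meas MK]])
    \<comment> \<open>\<open>M n\<close> gets a minus sign because \<open>L2_diff\<close> estimates
      differences: with \<open>T\<close> the partial sum,
      \<open>(m - M n) F - (- M n) (F - T)\<close> is \<open>m F - M n T\<close>.\<close>
    have Lb: "L2 (\<lambda>\<theta>. (- M n \<theta>) * (F \<theta> - trig_sum f A \<theta>))"
      by (intro L2_bounded_mult(1)[OF L, where K=K]) (simp_all add: MK)
    have "sqint (\<lambda>\<theta>. (- M n \<theta>) * (F \<theta> - trig_sum f A \<theta>)) = sqint (\<lambda>\<theta>. M n \<theta> * (F \<theta> - trig_sum f A \<theta>))"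
      by (simp add: norm_mult)
    then have "sqint (\<lambda>\<theta>. (m \<theta> - M n \<theta>) * F \<theta> - (- M n \<theta>) * (F \<theta> - trig_sum f A \<theta>)) < e"
      using n 2 L2_diff(2)[OF La Lb] by linarith
    moreover have "(m \<theta> - M n \<theta>) * F \<theta> - (- M n \<theta>) * (F \<theta> - trig_sum f A \<theta>) =
        m \<theta> * F \<theta> - M n \<theta> * trig_sum f A \<theta>" for \<theta>
      by (simp add: algebra_simps)
    ultimately have "sqint (\<lambda>\<theta>. m \<theta> * F \<theta> - M n \<theta> * trig_sum f A \<theta>) < e" by (simp only:)
    moreover have "trig_poly (\<lambda>\<theta>. M n \<theta> * trig_sum f A \<theta>)"
      using A by (intro trig_poly_mult M) (auto simp: trig_poly_def)
    ultimately show "\<exists>T. trig_poly T \<and> sqint (\<lambda>\<theta>. m \<theta> * F \<theta> - T \<theta>) < e"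
      by (intro exI[of _ "\<lambda>\<theta>. M n \<theta> * trig_sum f A \<theta>"] conjI)
  qed
qed

lemma fourier_multiplier_eq:
  assumes m: "admissible_multiplier m" and f: "has_fourier_transform f F"
  shows "fourier_multiplier m f = fourier_coeff (\<lambda>\<theta>. m \<theta> * F \<theta>)"
  unfolding fourier_multiplier_def
proof (rule the_equality)
  show "\<exists>F'. has_fourier_transform f F' \<and> has_fourier_transform (fourier_coeff (\<lambda>\<theta>. m \<theta> * F \<theta>)) (\<lambda>\<theta>. m \<theta> * F' \<theta>)"
    using f fourier_multiplier_transform[OF m f] by blast
  fix g assume "\<exists>F'. has_fourier_transform f F' \<and> has_fourier_transform g (\<lambda>\<theta>. m \<theta> * F' \<theta>)"
  then obtain F' where F': "has_fourier_transform f F'" "has_fourier_transform g (\<lambda>\<theta>. m \<theta> * F' \<theta>)" by blast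
  have "AE \<theta> in torus. F' \<theta> = F \<theta>" by (rule fourier_transform_unique_AE[OF F'(1) f])
  then have "AE \<theta> in torus. m \<theta> * F' \<theta> = m \<theta> * F \<theta>" by eventually_elim simp
  then have "fourier_coeff (\<lambda>\<theta>. m \<theta> * F' \<theta>) = fourier_coeff (\<lambda>\<theta>. m \<theta> * F \<theta>)"
    using F'(2) fourier_multiplier_transform[OF m f]
    by (intro fourier_coeff_cong_AE) (auto simp: has_fourier_transform_iff)
  then show "g = fourier_coeff (\<lambda>\<theta>. m \<theta> * F \<theta>)"
    using fourier_coeff_unique[OF F'(2)] by simp
qed

subsection \<open>Finitely supported functions\<close>

abbreviation finsupp :: "(int \<times> int \<Rightarrow> real) \<Rightarrow> bool" where
  "finsupp f \<equiv> finite {x. f x \<noteq> 0}"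

definition fourier :: "(int \<times> int \<Rightarrow> real) \<Rightarrow> real \<times> real \<Rightarrow> complex" where
  "fourier f = trig_sum f {x. f x \<noteq> 0}"

lemma fourier_superset: "finite A \<Longrightarrow> {x. f x \<noteq> 0} \<subseteq> A \<Longrightarrow> fourier f = trig_sum f A"
  unfolding fourier_def trig_sum_def [abs_def]
  by (intro ext sum.mono_neutral_left) auto

lemma trig_poly_fourier: "finsupp f \<Longrightarrow> trig_poly (fourier f)"
  by (auto simp: fourier_def trig_poly_def)

lemma L2_fourier: "finsupp f \<Longrightarrow> L2 (fourier f)"
  by (intro L2_trig_poly trig_poly_fourier)

lemma has_fourier_transform_fourier:
  assumes "finsupp f" shows "has_fourier_transform f (fourier f)"
  unfolding has_fourier_transform_iff
proof (intro conjI L2_fourier[OF assms])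
  have "\<forall>\<^sub>F A in finite_subsets_at_top UNIV. 0 = sqint (\<lambda>\<theta>. fourier f \<theta> - trig_sum f A \<theta>)"
    by (rule finite_subsets_eventually[OF assms]) (simp add: fourier_superset)
  then show "((\<lambda>A. sqint (\<lambda>\<theta>. fourier f \<theta> - trig_sum f A \<theta>)) \<longlongrightarrow> 0) (finite_subsets_at_top UNIV)"
    by (rule Lim_transform_eventually[OF tendsto_const])
qed

lemma finsupp_add: "finsupp f \<Longrightarrow> finsupp g \<Longrightarrow> finsupp (\<lambda>x. f x + g x)"
  by (rule finite_subset[of _ "{x. f x \<noteq> 0} \<union> {x. g x \<noteq> 0}"]) auto

lemma finsupp_diff: "finsupp f \<Longrightarrow> finsupp g \<Longrightarrow> finsupp (\<lambda>x. f x - g x)"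
  by (rule finite_subset[of _ "{x. f x \<noteq> 0} \<union> {x. g x \<noteq> 0}"]) auto

lemma finsupp_cmult: "finsupp f \<Longrightarrow> finsupp (\<lambda>x. c * f x)"
  by (rule finite_subset[of _ "{x. f x \<noteq> 0}"]) auto

lemma finsupp_shift: "finsupp f \<Longrightarrow> finsupp (\<lambda>x. f (x + v))"
proof -
  assume "finsupp f"
  have "{x. f (x + v) \<noteq> 0} = (\<lambda>x. x - v) ` {x. f x \<noteq> 0}"
    by (auto simp: image_iff) (metis add_diff_cancel_right' surj_pair)
  then show ?thesis using \<open>finsupp f\<close> by simp
qed

lemma fourier_add:
  assumes "finsupp f" "finsupp g"
  shows "fourier (\<lambda>x. f x + g x) \<theta> = fourier f \<theta> + fourier g \<theta>"
proof -
  let ?A = "{x. f x \<noteq> 0} \<union> {x. g x \<noteq> 0}"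
  have "finite ?A" using assms by auto
  then have "fourier (\<lambda>x. f x + g x) = trig_sum (\<lambda>x. f x + g x) ?A" "fourier f = trig_sum f ?A"
    "fourier g = trig_sum g ?A" by (auto intro!: fourier_superset)
  then show ?thesis by (simp add: trig_sum_def sum.distrib algebra_simps)
qed

lemma fourier_cmult:
  assumes "finsupp f" shows "fourier (\<lambda>x. c * f x) \<theta> = of_real c * fourier f \<theta>"
proof -
  have "fourier (\<lambda>x. c * f x) = trig_sum (\<lambda>x. c * f x) {x. f x \<noteq> 0}"
    using assms by (intro fourier_superset) auto
  then show ?thesis by (simp add: fourier_def trig_sum_def sum_distrib_left algebra_simps)
qed

lemma fourier_diff:
  assumes "finsupp f" "finsupp g"
  shows "fourier (\<lambda>x. f x - g x) \<theta> = fourier f \<theta> - fourier g \<theta>"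
  using fourier_add[OF assms(1) finsupp_cmult[OF assms(2), of "-1"], of \<theta>] fourier_cmult[OF assms(2), of "-1" \<theta>]
  by simp

lemma fourier_shift:
  assumes "finsupp f" shows "fourier (\<lambda>x. f (x + v)) \<theta> = cis (pairing v \<theta>) * fourier f \<theta>"
proof -
  have *: "{x. f (x + v) \<noteq> 0} = (\<lambda>x. x - v) ` {x. f x \<noteq> 0}"
    by (auto simp: image_iff) (metis add_diff_cancel_right' surj_pair)
  have "fourier (\<lambda>x. f (x + v)) \<theta> = (\<Sum>x | f x \<noteq> 0. of_real (f x) * cis (- pairing (x - v) \<theta>))"
    unfolding fourier_def trig_sum_def *
    by (subst sum.reindex) (auto simp: inj_on_def)
  also have "\<dots> = (\<Sum>x | f x \<noteq> 0. cis (pairing v \<theta>) * (of_real (f x) * cis (- pairing x \<theta>)))"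
    by (intro sum.cong refl) (simp add: pairing_diff cis_mult)
  finally show ?thesis by (simp add: fourier_def trig_sum_def sum_distrib_left)
qed

lemma fourier_coeff_fourier: "finsupp f \<Longrightarrow> fourier_coeff (fourier f) = f"
  unfolding fourier_def by (intro ext) (simp add: fourier_coeff_trig_sum)

subsection \<open>The symbol of the operator\<close>

definition diag_symbol :: "real \<times> real \<Rightarrow> real" where
  "diag_symbol \<theta> = 2 - 2 * cos (fst \<theta> - snd \<theta>)"

definition ba_symbol :: "real \<times> real \<Rightarrow> real" where
  "ba_symbol \<theta> = 1 - diag_symbol \<theta> / neg_laplacian_symbol \<theta>"

lemma cos_half_sin: "2 - 2 * cos a = 4 * (sin (a / 2))\<^sup>2" for a :: real
  using cos_double_sin[of "a/2"] by simp

lemma neg_laplacian_symbol_cos: "neg_laplacian_symbol \<theta> = 4 - 2 * cos (fst \<theta>) - 2 * cos (snd \<theta>)"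
  unfolding neg_laplacian_symbol_def using cos_half_sin[of "fst \<theta>"] cos_half_sin[of "snd \<theta>"] by simp

lemma neg_laplacian_symbol_bounds: "0 \<le> neg_laplacian_symbol \<theta>" "neg_laplacian_symbol \<theta> \<le> 8"
  unfolding neg_laplacian_symbol_cos
  using cos_le_one[of "fst \<theta>"] cos_le_one[of "snd \<theta>"] cos_ge_minus_one[of "fst \<theta>"] cos_ge_minus_one[of "snd \<theta>"]
  by linarith+

lemma cmod_cis_minus_one: "(cmod (cis a - 1))\<^sup>2 = 2 - 2 * cos a"
proof -
  have "(cmod (cis a - 1))\<^sup>2 = (cos a)\<^sup>2 + (sin a)\<^sup>2 + 1 - 2 * cos a"
    unfolding cmod_power2 by (simp add: power2_eq_square algebra_simps)
  then show ?thesis by simp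
qed

lemma cmod_cis_diff: "(cmod (cis a - cis b))\<^sup>2 = 2 - 2 * cos (a - b)"
proof -
  have "cis a - cis b = cis b * (cis (a - b) - 1)" by (simp add: algebra_simps cis_mult)
  then show ?thesis by (simp add: norm_mult cmod_cis_minus_one)
qed

text \<open>\<open>cis a - cis b\<close> is the difference of \<open>cis a - 1\<close> and
  \<open>cis b - 1\<close>, whose squared norms add up to the Laplacian symbol. The factor 2 is what
  confines \<open>ba_symbol\<close> to the interval from -1 to 1.\<close>

lemma diag_symbol_bounds: "0 \<le> diag_symbol \<theta>" "diag_symbol \<theta> \<le> 2 * neg_laplacian_symbol \<theta>"
proof -
  show "0 \<le> diag_symbol \<theta>" using cos_le_one[of "fst \<theta> - snd \<theta>"] by (simp add: diag_symbol_def)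
  have "diag_symbol \<theta> = (cmod ((cis (fst \<theta>) - 1) - (cis (snd \<theta>) - 1)))\<^sup>2"
    by (simp add: diag_symbol_def cmod_cis_diff)
  also have "\<dots> \<le> 2 * (cmod (cis (fst \<theta>) - 1))\<^sup>2 + 2 * (cmod (cis (snd \<theta>) - 1))\<^sup>2"
    by (rule norm_diff_squared_le)
  finally show "diag_symbol \<theta> \<le> 2 * neg_laplacian_symbol \<theta>"
    by (simp add: cmod_cis_minus_one neg_laplacian_symbol_cos)
qed

lemma neg_laplacian_symbol_eq_0:
  assumes "\<theta> \<in> space torus" "neg_laplacian_symbol \<theta> = 0" shows "\<theta> = (0, 0)"
proof -
  have "(sin (fst \<theta> / 2))\<^sup>2 + (sin (snd \<theta> / 2))\<^sup>2 = 0"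
    using assms(2) unfolding neg_laplacian_symbol_def by (simp only: mult_eq_0_iff) auto
  then have *: "sin (fst \<theta> / 2) = 0" "sin (snd \<theta> / 2) = 0"
    using zero_le_power2[of "sin (fst \<theta> / 2)"] zero_le_power2[of "sin (snd \<theta> / 2)"]
    by (auto simp: add_nonneg_eq_0_iff)
  have **: "t = 0" if "sin (t / 2) = 0" "-pi \<le> t" "t \<le> pi" for t :: real
    using sin_eq_0_pi[of "t/2"] that pi_gt_zero by linarith
  have "-pi \<le> fst \<theta>" "fst \<theta> \<le> pi" "-pi \<le> snd \<theta>" "snd \<theta> \<le> pi"
    using assms(1) by (auto simp: space_torus)
  then have "fst \<theta> = 0" "snd \<theta> = 0"
    using **[OF *(1)] **[OF *(2)] by blast+
  then show ?thesis by (simp add: prod_eq_iff)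
qed

lemma AE_neg_laplacian_symbol: "AE \<theta> in torus. 0 < neg_laplacian_symbol \<theta>"
proof -
  have "AE \<theta> in lborel. \<theta> \<in> {-pi..pi} \<times> {-pi..pi} \<longrightarrow> \<theta> \<noteq> (0, 0 :: real)"
    using AE_lborel_singleton[of "(0, 0 :: real)"] by eventually_elim simp
  then have "AE \<theta> in torus. \<theta> \<noteq> (0, 0)"
    unfolding torus_def by (subst AE_restrict_space_iff) auto
  then show ?thesis
    using AE_space
  proof eventually_elim
    case (elim \<theta>)
    then show ?case using neg_laplacian_symbol_eq_0[of \<theta>] neg_laplacian_symbol_bounds(1)[of \<theta>] by fastforce
  qed
qed

lemma continuous_symbols [continuous_intros]:
  "continuous_on S neg_laplacian_symbol" "continuous_on S diag_symbol"
  unfolding neg_laplacian_symbol_def [abs_def] diag_symbol_def [abs_def]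
  by (auto intro!: continuous_intros)

lemma measurable_symbols [measurable]:
  "neg_laplacian_symbol \<in> borel_measurable torus" "diag_symbol \<in> borel_measurable torus"
  "ba_symbol \<in> borel_measurable torus"
proof -
  show [measurable]: "neg_laplacian_symbol \<in> borel_measurable torus" "diag_symbol \<in> borel_measurable torus"
    by (intro continuous_torus continuous_symbols)+
  show "ba_symbol \<in> borel_measurable torus" unfolding ba_symbol_def [abs_def] by measurable
qed

lemma trig_poly_neg_laplacian_symbol: "trig_poly (\<lambda>\<theta>. of_real (neg_laplacian_symbol \<theta>))"
proof -
  have "(\<lambda>\<theta>. complex_of_real (neg_laplacian_symbol \<theta>)) =
    (\<lambda>\<theta>. of_real 4 + (of_real (-1) * (cis (pairing (1,0) \<theta>) + cis (pairing (-1,0) \<theta>)) +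
       of_real (-1) * (cis (pairing (0,1) \<theta>) + cis (pairing (0,-1) \<theta>))))"
    by (auto simp: fun_eq_iff neg_laplacian_symbol_cos pairing_def complex_eq_iff)
  moreover have "trig_poly \<dots>"
    by (intro trig_poly_add trig_poly_const_mult trig_poly_const trig_poly_cis)
  ultimately show ?thesis by simp
qed

lemma trig_poly_polynomial:
  assumes T: "trig_poly (\<lambda>\<theta>. of_real (t \<theta>))" and "real_polynomial_function q"
  shows "trig_poly (\<lambda>\<theta>. of_real (q (t \<theta>)))"
  using assms(2)
proof (induction rule: real_polynomial_function.induct)
  case (linear f)
  then obtain c where "f = (\<lambda>x. x * c)" unfolding real_bounded_linear by blast
  then show ?case using trig_poly_const_mult[OF T, of c] by (simp add: mult.commute)
next
  case (const c) then show ?case by (rule trig_poly_const)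
next
  case (add f g) then show ?case using trig_poly_add[OF add.IH] by simp
next
  case (mult f g) then show ?case using trig_poly_mult[OF mult.IH] by simp
qed

text \<open>\<open>1 / sqrt s\<close> is singular at the origin, but the numerator is at most
  \<open>sqrt s\<close> there. So \<open>1 / sqrt (s + 1 / Suc n)\<close> is approximated by
  polynomials in \<open>s\<close> on the range \<open>{0..8}\<close> of the symbol, and a polynomial
  in a real trigonometric polynomial is again one.\<close>

lemma admissible_riesz:
  assumes T: "trig_poly T" and le: "\<And>\<theta>. (cmod (T \<theta>))\<^sup>2 \<le> neg_laplacian_symbol \<theta>"
  shows "admissible_multiplier (\<lambda>\<theta>. T \<theta> / of_real (sqrt (neg_laplacian_symbol \<theta>)))"
proof -
  let ?s = neg_laplacian_symbol
  have [measurable]: "T \<in> borel_measurable torus" by (rule trig_poly_measurable[OF T])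
  have le': "cmod (T \<theta>) \<le> sqrt (?s \<theta>)" for \<theta>
    by (rule real_le_rsqrt[OF le])
  have "\<exists>q. real_polynomial_function q \<and> (\<forall>x\<in>{0..8}. \<bar>1 / sqrt (x + 1 / real (Suc n)) - q x\<bar> < 1 / real (Suc n))" for n
  proof -
    have "continuous_on {0..8} (\<lambda>x. 1 / sqrt (x + 1 / real (Suc n)))"
      by (intro continuous_intros) (auto simp: add_nonneg_eq_0_iff)
    from Stone_Weierstrass_real_polynomial_function[OF compact_Icc this, of "1 / real (Suc n)"]
    show ?thesis by (metis zero_less_divide_1_iff of_nat_0_less_iff zero_less_Suc)
  qed
  then obtain q where q: "\<And>n. real_polynomial_function (q n)"
    and approx: "\<And>n x. x \<in> {0..8} \<Longrightarrow> \<bar>1 / sqrt (x + 1 / real (Suc n)) - q n x\<bar> < 1 / real (Suc n)"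
    by metis
  define M where "M = (\<lambda>n \<theta>. T \<theta> * of_real (q n (?s \<theta>)))"
  have s: "?s \<theta> \<in> {0..8}" for \<theta> using neg_laplacian_symbol_bounds[of \<theta>] by simp
  have "trig_poly (M n)" for n
    unfolding M_def by (intro trig_poly_mult T trig_poly_polynomial[OF trig_poly_neg_laplacian_symbol q])
  \<comment> \<open>1 comes from \<open>sqrt s / sqrt (s + 1 / Suc n)\<close>, and 3 from the
    approximation error, at most 1, times \<open>sqrt s\<close>, which is at most
    \<open>sqrt 8\<close>.\<close>
  moreover have "cmod (M n \<theta>) \<le> 4" for n \<theta>
  proof -
    let ?x = "?s \<theta>"
    have sq8: "sqrt ?x \<le> 3" using s[of \<theta>] by (intro real_le_lsqrt) auto
    have "1 / real (Suc n) \<le> 1" by simp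
    moreover have "0 \<le> 1 / sqrt (?x + 1 / real (Suc n))" using s[of \<theta>] by simp
    ultimately have "\<bar>q n ?x\<bar> \<le> 1 / sqrt (?x + 1 / real (Suc n)) + 1"
      using approx[OF s[of \<theta>], of n] unfolding abs_less_iff abs_le_iff by linarith
    then have "cmod (M n \<theta>) \<le> sqrt ?x * (1 / sqrt (?x + 1 / real (Suc n)) + 1)"
      unfolding M_def norm_mult norm_of_real using s[of \<theta>] by (intro mult_mono le') auto
    also have "\<dots> = sqrt ?x / sqrt (?x + 1 / real (Suc n)) + sqrt ?x" by (simp add: algebra_simps)
    also have "sqrt ?x / sqrt (?x + 1 / real (Suc n)) \<le> 1"
      using s[of \<theta>] by (auto simp: divide_le_eq_1 add_nonneg_pos)
    finally show ?thesis using sq8 by simp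
  qed
  moreover have "cmod (T \<theta> / of_real (sqrt (?s \<theta>))) \<le> 4" for \<theta>
  proof -
    have "cmod (T \<theta> / of_real (sqrt (?s \<theta>))) \<le> 1"
      using le'[of \<theta>] s[of \<theta>] by (auto simp: norm_divide divide_le_eq_1)
    then show ?thesis by simp
  qed
  moreover have "AE \<theta> in torus. (\<lambda>n. M n \<theta>) \<longlonglongrightarrow> T \<theta> / of_real (sqrt (?s \<theta>))"
    using AE_neg_laplacian_symbol
  proof eventually_elim
    case (elim \<theta>)
    have lim: "(\<lambda>n. 1 / real (Suc n)) \<longlonglongrightarrow> 0" using LIMSEQ_inverse_real_of_nat by (simp add: inverse_eq_divide)
    have "(\<lambda>n. 1 / sqrt (?s \<theta> + 1 / real (Suc n))) \<longlonglongrightarrow> 1 / sqrt (?s \<theta> + 0)"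
      using elim by (intro tendsto_intros lim) auto
    moreover have "(\<lambda>n. 1 / sqrt (?s \<theta> + 1 / real (Suc n)) - q n (?s \<theta>)) \<longlonglongrightarrow> 0"
      by (rule Lim_null_comparison[OF _ lim]) (auto simp del: of_nat_Suc intro!: always_eventually less_imp_le approx s)
    ultimately have "(\<lambda>n. 1 / sqrt (?s \<theta> + 1 / real (Suc n)) - (1 / sqrt (?s \<theta> + 1 / real (Suc n)) - q n (?s \<theta>)))
        \<longlonglongrightarrow> 1 / sqrt (?s \<theta> + 0) - 0"
      by (rule tendsto_diff)
    then have "(\<lambda>n. q n (?s \<theta>)) \<longlonglongrightarrow> 1 / sqrt (?s \<theta>)" by simp
    then have "(\<lambda>n. T \<theta> * of_real (q n (?s \<theta>))) \<longlonglongrightarrow> T \<theta> * of_real (1 / sqrt (?s \<theta>))"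
      by (intro tendsto_intros)
    then show ?case by (simp add: M_def)
  qed
  ultimately show ?thesis unfolding admissible_multiplier_def by (intro conjI) (measurable, blast)
qed

lemma admissible_riesz_plus:
  "admissible_multiplier (\<lambda>\<theta>. (cis (fst \<theta>) - 1) / of_real (sqrt (neg_laplacian_symbol \<theta>)))"
  "admissible_multiplier (\<lambda>\<theta>. (cis (snd \<theta>) - 1) / of_real (sqrt (neg_laplacian_symbol \<theta>)))"
proof -
  have le: "2 - 2 * cos a \<le> neg_laplacian_symbol (a, b)" "2 - 2 * cos b \<le> neg_laplacian_symbol (a, b)" for a b
    by (simp_all add: neg_laplacian_symbol_cos)
  have "trig_poly (\<lambda>\<theta>. cis (pairing x \<theta>) + of_real (-1))" for x
    by (intro trig_poly_add trig_poly_cis trig_poly_const)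
  from this[of "(1,0)"] this[of "(0,1)"]
  have "trig_poly (\<lambda>\<theta>. cis (fst \<theta>) - 1)" "trig_poly (\<lambda>\<theta>. cis (snd \<theta>) - 1)"
    by (simp_all add: pairing_def)
  then show "admissible_multiplier (\<lambda>\<theta>. (cis (fst \<theta>) - 1) / of_real (sqrt (neg_laplacian_symbol \<theta>)))"
    "admissible_multiplier (\<lambda>\<theta>. (cis (snd \<theta>) - 1) / of_real (sqrt (neg_laplacian_symbol \<theta>)))"
    by (auto intro!: admissible_riesz simp: cmod_cis_minus_one le)
qed

lemma admissible_riesz_minus:
  "admissible_multiplier (\<lambda>\<theta>. (1 - cis (- fst \<theta>)) / of_real (sqrt (neg_laplacian_symbol \<theta>)))"
  "admissible_multiplier (\<lambda>\<theta>. (1 - cis (- snd \<theta>)) / of_real (sqrt (neg_laplacian_symbol \<theta>)))"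
proof -
  have le: "2 - 2 * cos a \<le> neg_laplacian_symbol (a, b)" "2 - 2 * cos b \<le> neg_laplacian_symbol (a, b)" for a b
    by (simp_all add: neg_laplacian_symbol_cos)
  have "trig_poly (\<lambda>\<theta>. of_real 1 + of_real (-1) * cis (pairing x \<theta>))" for x
    by (intro trig_poly_add trig_poly_const_mult trig_poly_cis trig_poly_const)
  from this[of "(-1,0)"] this[of "(0,-1)"]
  have "trig_poly (\<lambda>\<theta>. 1 - cis (- fst \<theta>))" "trig_poly (\<lambda>\<theta>. 1 - cis (- snd \<theta>))"
    by (simp_all add: pairing_def)
  then show "admissible_multiplier (\<lambda>\<theta>. (1 - cis (- fst \<theta>)) / of_real (sqrt (neg_laplacian_symbol \<theta>)))"
    "admissible_multiplier (\<lambda>\<theta>. (1 - cis (- snd \<theta>)) / of_real (sqrt (neg_laplacian_symbol \<theta>)))"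
    by (auto intro!: admissible_riesz simp: norm_minus_commute[of 1] cmod_cis_minus_one le)
qed

lemma ba_symbol_bound: "\<bar>ba_symbol \<theta>\<bar> \<le> 1"
proof -
  have "0 \<le> diag_symbol \<theta> / neg_laplacian_symbol \<theta>"
    using diag_symbol_bounds(1) neg_laplacian_symbol_bounds(1) by simp
  moreover have "diag_symbol \<theta> / neg_laplacian_symbol \<theta> \<le> 2"
    using diag_symbol_bounds[of \<theta>] neg_laplacian_symbol_bounds(1)[of \<theta>]
    by (cases "neg_laplacian_symbol \<theta> = 0") (auto simp: divide_le_eq)
  ultimately show ?thesis unfolding ba_symbol_def by linarith
qed

text \<open>At zeros of the Laplacian symbol the diagonal symbol vanishes as well, so the value that
  division by zero assigns there is harmless.\<close>

lemma ba_symbol_mult: "ba_symbol \<theta> * neg_laplacian_symbol \<theta> = neg_laplacian_symbol \<theta> - diag_symbol \<theta>"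
  using diag_symbol_bounds[of \<theta>] by (auto simp: ba_symbol_def field_simps)

lemma riesz_symbols_product:
  assumes "0 < neg_laplacian_symbol \<theta>"
  shows "of_real (-1) * ((cis (fst \<theta>) - 1) / of_real (sqrt (neg_laplacian_symbol \<theta>)) *
      ((1 - cis (- snd \<theta>)) / of_real (sqrt (neg_laplacian_symbol \<theta>)) * F)) -
    (1 - cis (- fst \<theta>)) / of_real (sqrt (neg_laplacian_symbol \<theta>)) *
      ((cis (snd \<theta>) - 1) / of_real (sqrt (neg_laplacian_symbol \<theta>)) * F) = of_real (ba_symbol \<theta>) * F"
proof -
  let ?s = "neg_laplacian_symbol \<theta>"
  let ?a = "fst \<theta>" and ?b = "snd \<theta>"
  let ?r = "complex_of_real (sqrt ?s)"
  have r: "?r * ?r = of_real ?s" "?r \<noteq> 0" using assms by (simp_all flip: of_real_mult)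
  \<comment> \<open>Expanding leaves \<open>2 - 2 cos a - 2 cos b + 2 cos (a - b)\<close>, which is
    the Laplacian symbol minus the diagonal one.\<close>
  have num: "- ((cis ?a - 1) * (1 - cis (- ?b))) - (1 - cis (- ?a)) * (cis ?b - 1) = of_real (?s - diag_symbol \<theta>)"
    unfolding neg_laplacian_symbol_cos diag_symbol_def
    by (simp add: complex_eq_iff cos_diff sin_diff algebra_simps)
  have "of_real (-1) * ((cis ?a - 1) / ?r * ((1 - cis (- ?b)) / ?r * F)) - (1 - cis (- ?a)) / ?r * ((cis ?b - 1) / ?r * F) =
     (- ((cis ?a - 1) * (1 - cis (- ?b))) - (1 - cis (- ?a)) * (cis ?b - 1)) / (?r * ?r) * F"
    using r(2) by (simp add: field_simps)
  also have "\<dots> = of_real (ba_symbol \<theta>) * F"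
    unfolding num r ba_symbol_def using assms by (simp add: diff_divide_distrib)
  finally show ?thesis .
qed

lemma L2_ba_symbol: "L2 F \<Longrightarrow> L2 (\<lambda>\<theta>. of_real (ba_symbol \<theta>) * F \<theta>)"
  by (rule L2_bounded_mult[where K=1]) (use ba_symbol_bound in auto)

lemma beurling_ahlfors_im_fourier:
  assumes "finsupp f"
  shows "beurling_ahlfors_im f = fourier_coeff (\<lambda>\<theta>. of_real (ba_symbol \<theta>) * fourier f \<theta>)"
proof -
  note f = has_fourier_transform_fourier[OF assms]
  note t1 = fourier_multiplier_transform[OF admissible_riesz_minus(2) f]
  note t2 = fourier_multiplier_transform[OF admissible_riesz_plus(2) f]
  note u1 = fourier_multiplier_transform[OF admissible_riesz_plus(1) t1]
  note u2 = fourier_multiplier_transform[OF admissible_riesz_minus(1) t2]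
  note L = u1[unfolded has_fourier_transform_iff, THEN conjunct1]
    u2[unfolded has_fourier_transform_iff, THEN conjunct1]
  have 1: "riesz_plus fst (riesz_minus snd f) = fourier_coeff (\<lambda>\<theta>. (cis (fst \<theta>) - 1) / of_real (sqrt (neg_laplacian_symbol \<theta>)) *
      ((1 - cis (- snd \<theta>)) / of_real (sqrt (neg_laplacian_symbol \<theta>)) * fourier f \<theta>))"
    unfolding riesz_plus_def riesz_minus_def fourier_multiplier_eq[OF admissible_riesz_minus(2) f]
      fourier_multiplier_eq[OF admissible_riesz_plus(1) t1] ..
  have 2: "riesz_minus fst (riesz_plus snd f) = fourier_coeff (\<lambda>\<theta>. (1 - cis (- fst \<theta>)) / of_real (sqrt (neg_laplacian_symbol \<theta>)) *
      ((cis (snd \<theta>) - 1) / of_real (sqrt (neg_laplacian_symbol \<theta>)) * fourier f \<theta>))"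
    unfolding riesz_plus_def riesz_minus_def fourier_multiplier_eq[OF admissible_riesz_plus(2) f]
      fourier_multiplier_eq[OF admissible_riesz_minus(1) t2] ..
  note L' = L2_bounded_mult(1)[OF L(1), of "\<lambda>_. of_real (-1)" 1, simplified]
  have "beurling_ahlfors_im f = fourier_coeff (\<lambda>\<theta>. of_real (-1) * ((cis (fst \<theta>) - 1) / of_real (sqrt (neg_laplacian_symbol \<theta>)) *
      ((1 - cis (- snd \<theta>)) / of_real (sqrt (neg_laplacian_symbol \<theta>)) * fourier f \<theta>)) -
    (1 - cis (- fst \<theta>)) / of_real (sqrt (neg_laplacian_symbol \<theta>)) *
      ((cis (snd \<theta>) - 1) / of_real (sqrt (neg_laplacian_symbol \<theta>)) * fourier f \<theta>))"
    unfolding beurling_ahlfors_im_def 1 2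
    by (intro ext, subst fourier_coeff_diff[OF _ L(2)], use L' in simp,
        subst fourier_coeff_const_mult[OF L(1)], simp)
  also have "\<dots> = fourier_coeff (\<lambda>\<theta>. of_real (ba_symbol \<theta>) * fourier f \<theta>)"
  proof (rule fourier_coeff_cong_AE)
    show "L2 (\<lambda>\<theta>. of_real (-1) * ((cis (fst \<theta>) - 1) / of_real (sqrt (neg_laplacian_symbol \<theta>)) *
      ((1 - cis (- snd \<theta>)) / of_real (sqrt (neg_laplacian_symbol \<theta>)) * fourier f \<theta>)) -
    (1 - cis (- fst \<theta>)) / of_real (sqrt (neg_laplacian_symbol \<theta>)) *
      ((cis (snd \<theta>) - 1) / of_real (sqrt (neg_laplacian_symbol \<theta>)) * fourier f \<theta>))"
      by (intro L2_diff(1) L(2)) (use L' in simp)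
    show "L2 (\<lambda>\<theta>. of_real (ba_symbol \<theta>) * fourier f \<theta>)"
      by (intro L2_ba_symbol L2_fourier assms)
    show "AE \<theta> in torus. of_real (-1) * ((cis (fst \<theta>) - 1) / of_real (sqrt (neg_laplacian_symbol \<theta>)) *
      ((1 - cis (- snd \<theta>)) / of_real (sqrt (neg_laplacian_symbol \<theta>)) * fourier f \<theta>)) -
    (1 - cis (- fst \<theta>)) / of_real (sqrt (neg_laplacian_symbol \<theta>)) *
      ((cis (snd \<theta>) - 1) / of_real (sqrt (neg_laplacian_symbol \<theta>)) * fourier f \<theta>) =
        of_real (ba_symbol \<theta>) * fourier f \<theta>"
      using AE_neg_laplacian_symbol by eventually_elim (rule riesz_symbols_product)
  qed
  finally show ?thesis .
qed

text \<open>The inverse transform of the symbol, that is, the image of the point mass at 0. The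
  cosine makes it visibly even, which is the source of the symmetry of the operator.\<close>

definition ba_kernel :: "int \<times> int \<Rightarrow> real" where
  "ba_kernel w = (\<integral>\<theta>. ba_symbol \<theta> * cos (pairing w \<theta>) \<partial>torus) / (4 * pi\<^sup>2)"

lemma ba_kernel_minus: "ba_kernel (- w) = ba_kernel w"
  by (simp add: ba_kernel_def pairing_minus)

lemma fourier_coeff_mult_fourier:
  assumes "finsupp f" and [measurable]: "m \<in> borel_measurable torus" and K: "\<And>\<theta>. \<bar>m \<theta>\<bar> \<le> K"
  shows "fourier_coeff (\<lambda>\<theta>. of_real (m \<theta>) * fourier f \<theta>) x =
    (\<Sum>y | f y \<noteq> 0. f y * ((\<integral>\<theta>. m \<theta> * cos (pairing (x - y) \<theta>) \<partial>torus) / (4 * pi\<^sup>2)))"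
proof -
  have int: "integrable torus (\<lambda>\<theta>. of_real (m \<theta>) * cis (pairing w \<theta>))" for w
    by (rule integrable_L2_cis, rule L2_bounded_mult(1)[OF L2_one, of _ K, simplified]) (use K in auto)
  have *: "(of_real (m \<theta>) * fourier f \<theta>) * cis (pairing x \<theta>) =
    (\<Sum>y | f y \<noteq> 0. of_real (f y) * (of_real (m \<theta>) * cis (pairing (x - y) \<theta>)))" for \<theta>
  proof -
    have "(of_real (m \<theta>) * fourier f \<theta>) * cis (pairing x \<theta>) =
      (\<Sum>y | f y \<noteq> 0. of_real (f y) * (of_real (m \<theta>) * (cis (- pairing y \<theta>) * cis (pairing x \<theta>))))"
      unfolding fourier_def trig_sum_def sum_distrib_left sum_distrib_right by (simp add: mult_ac)
    then show ?thesis by (simp add: cis_mult pairing_diff)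
  qed
  have "fourier_coeff (\<lambda>\<theta>. of_real (m \<theta>) * fourier f \<theta>) x =
    (\<Sum>y | f y \<noteq> 0. f y * (Re (\<integral>\<theta>. of_real (m \<theta>) * cis (pairing (x - y) \<theta>) \<partial>torus) / (4 * pi\<^sup>2)))"
    unfolding fourier_coeff_def * using int
    by (subst Bochner_Integration.integral_sum) (auto simp: sum_divide_distrib)
  moreover have "Re (\<integral>\<theta>. of_real (m \<theta>) * cis (pairing w \<theta>) \<partial>torus) = (\<integral>\<theta>. m \<theta> * cos (pairing w \<theta>) \<partial>torus)" for w
    by (subst integral_Re[OF int, symmetric]) simp
  ultimately show ?thesis by simp
qed

lemma beurling_ahlfors_im_kernel:
  assumes "finsupp f"
  shows "beurling_ahlfors_im f x = (\<Sum>y | f y \<noteq> 0. f y * ba_kernel (x - y))"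
  unfolding beurling_ahlfors_im_fourier[OF assms] ba_kernel_def
  by (rule fourier_coeff_mult_fourier[OF assms _ ba_symbol_bound]) measurable

lemma multiplier_form:
  assumes f: "finsupp f" and g: "finsupp g" and [measurable]: "m \<in> borel_measurable torus"
    and K: "\<And>\<theta>. \<bar>m \<theta>\<bar> \<le> K"
  shows "(\<Sum>x | g x \<noteq> 0. fourier_coeff (\<lambda>\<theta>. of_real (m \<theta>) * fourier f \<theta>) x * g x) =
    (\<integral>\<theta>. m \<theta> * Re (fourier f \<theta> * cnj (fourier g \<theta>)) \<partial>torus) / (4 * pi\<^sup>2)"
proof -
  have L: "L2 (\<lambda>\<theta>. of_real (m \<theta>) * fourier f \<theta>)"
    by (rule L2_bounded_mult(1)[OF L2_fourier[OF f], of _ K]) (use K in auto)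
  have "(\<integral>\<theta>. m \<theta> * Re (fourier f \<theta> * cnj (fourier g \<theta>)) \<partial>torus) =
     (\<integral>\<theta>. Re (of_real (m \<theta>) * fourier f \<theta> * cnj (fourier g \<theta>)) \<partial>torus)"
    by (simp add: algebra_simps)
  also have "\<dots> = Re (\<integral>\<theta>. of_real (m \<theta>) * fourier f \<theta> * cnj (fourier g \<theta>) \<partial>torus)"
    by (rule integral_Re[OF L2_integrable_mult[OF L L2_fourier[OF g]]])
  also have "\<dots> = Re (\<integral>\<theta>. (\<Sum>x | g x \<noteq> 0. of_real (g x) * (of_real (m \<theta>) * fourier f \<theta> * cis (pairing x \<theta>))) \<partial>torus)"
    unfolding fourier_def[of g] trig_sum_def by (simp add: sum_distrib_left cis_cnj mult_ac)
  also have "\<dots> = (\<Sum>x | g x \<noteq> 0. g x * Re (\<integral>\<theta>. of_real (m \<theta>) * fourier f \<theta> * cis (pairing x \<theta>) \<partial>torus))"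
    using integrable_L2_cis[OF L] by (subst Bochner_Integration.integral_sum) auto
  finally show ?thesis by (simp add: fourier_coeff_def sum_divide_distrib mult.commute)
qed

lemma parseval:
  assumes "finsupp f" "finsupp g"
  shows "(\<Sum>x | g x \<noteq> 0. f x * g x) = (\<integral>\<theta>. Re (fourier f \<theta> * cnj (fourier g \<theta>)) \<partial>torus) / (4 * pi\<^sup>2)"
  using multiplier_form[OF assms, of "\<lambda>_. 1" 1] by (simp add: fourier_coeff_fourier[OF assms(1)])

section \<open>The operator on images of the Laplacian\<close>

definition neg_laplacian :: "(int \<times> int \<Rightarrow> real) \<Rightarrow> int \<times> int \<Rightarrow> real" where
  "neg_laplacian u x = 4 * u x - u (x + (1,0)) - u (x + (-1,0)) - u (x + (0,1)) - u (x + (0,-1))"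

definition diag_laplacian :: "(int \<times> int \<Rightarrow> real) \<Rightarrow> int \<times> int \<Rightarrow> real" where
  "diag_laplacian u x = u (x + (1,-1)) + u (x + (-1,1)) - 2 * u x"

lemma finsupp_laplacian:
  assumes "finsupp u" shows "finsupp (neg_laplacian u)" "finsupp (diag_laplacian u)"
  unfolding neg_laplacian_def diag_laplacian_def
  by (intro finsupp_add finsupp_diff finsupp_cmult finsupp_shift assms)+

lemma fourier_neg_laplacian:
  assumes "finsupp u"
  shows "fourier (neg_laplacian u) \<theta> = of_real (neg_laplacian_symbol \<theta>) * fourier u \<theta>"
proof -
  note S = finsupp_shift[OF assms] and C = finsupp_cmult[OF assms]
  note d1 = finsupp_diff[OF C S] note d2 = finsupp_diff[OF d1 S] note d3 = finsupp_diff[OF d2 S]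
  have "fourier (neg_laplacian u) \<theta> = 4 * fourier u \<theta> - cis (pairing (1,0) \<theta>) * fourier u \<theta>
    - cis (pairing (-1,0) \<theta>) * fourier u \<theta> - cis (pairing (0,1) \<theta>) * fourier u \<theta> - cis (pairing (0,-1) \<theta>) * fourier u \<theta>"
    unfolding neg_laplacian_def [abs_def] fourier_diff[OF d3 S] fourier_diff[OF d2 S] fourier_diff[OF d1 S]
      fourier_diff[OF C S] fourier_cmult[OF assms] fourier_shift[OF assms] by simp
  also have "\<dots> = (4 - cis (pairing (1,0) \<theta>) - cis (pairing (-1,0) \<theta>) - cis (pairing (0,1) \<theta>) - cis (pairing (0,-1) \<theta>)) * fourier u \<theta>"
    by (simp add: algebra_simps)
  also have "4 - cis (pairing (1,0) \<theta>) - cis (pairing (-1,0) \<theta>) - cis (pairing (0,1) \<theta>) - cis (pairing (0,-1) \<theta>) = of_real (neg_laplacian_symbol \<theta>)"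
    by (simp add: neg_laplacian_symbol_cos pairing_def complex_eq_iff)
  finally show ?thesis .
qed

lemma fourier_diag_laplacian:
  assumes "finsupp u"
  shows "fourier (diag_laplacian u) \<theta> = - of_real (diag_symbol \<theta>) * fourier u \<theta>"
proof -
  note S = finsupp_shift[OF assms] and C = finsupp_cmult[OF assms]
  have "fourier (diag_laplacian u) \<theta> = cis (pairing (1,-1) \<theta>) * fourier u \<theta>
    + cis (pairing (-1,1) \<theta>) * fourier u \<theta> - 2 * fourier u \<theta>"
    unfolding diag_laplacian_def [abs_def] fourier_diff[OF finsupp_add[OF S S] C] fourier_add[OF S S]
      fourier_cmult[OF assms] fourier_shift[OF assms] by simp
  also have "\<dots> = (cis (pairing (1,-1) \<theta>) + cis (pairing (-1,1) \<theta>) - 2) * fourier u \<theta>"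
    by (simp add: algebra_simps)
  also have "cis (pairing (1,-1) \<theta>) + cis (pairing (-1,1) \<theta>) - 2 = - of_real (diag_symbol \<theta>)"
    by (simp add: diag_symbol_def pairing_def complex_eq_iff cos_diff sin_diff cos_add sin_add)
  finally show ?thesis by simp
qed

text \<open>On the range of the Laplacian the denominator of the symbol cancels, and a nonlocal
  operator becomes a finite difference. All test functions of the lower bound for
  \<open>p \<ge> 2\<close> are of this form.\<close>

lemma beurling_ahlfors_im_neg_laplacian:
  assumes "finsupp u"
  shows "beurling_ahlfors_im (neg_laplacian u) = (\<lambda>x. neg_laplacian u x + diag_laplacian u x)"
proof -
  have "of_real (ba_symbol \<theta>) * fourier (neg_laplacian u) \<theta> = fourier (\<lambda>x. neg_laplacian u x + diag_laplacian u x) \<theta>" for \<theta>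
  proof -
    have "complex_of_real (ba_symbol \<theta>) * (of_real (neg_laplacian_symbol \<theta>) * fourier u \<theta>) =
       of_real (ba_symbol \<theta> * neg_laplacian_symbol \<theta>) * fourier u \<theta>" by simp
    then show ?thesis
      unfolding fourier_add[OF finsupp_laplacian[OF assms]] fourier_neg_laplacian[OF assms]
        fourier_diag_laplacian[OF assms] ba_symbol_mult by (simp add: algebra_simps)
  qed
  then show ?thesis
    unfolding beurling_ahlfors_im_fourier[OF finsupp_laplacian(1)[OF assms]]
    by (simp only: fourier_coeff_fourier[OF finsupp_add[OF finsupp_laplacian[OF assms]]])
qed

subsection \<open>Burkholder's function\<close>

text \<open>The constant \<open>p * ((p - 1) / p) powr (p - 1)\<close> makes it tangent to
  \<open>\<bar>y\<bar> powr p - ((p - 1) * \<bar>x\<bar>) powr p\<close> along the rays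
  \<open>\<bar>y\<bar> = (p - 1) * \<bar>x\<bar>\<close>, where both vanish.\<close>

definition burkholder :: "real \<Rightarrow> real \<Rightarrow> real \<Rightarrow> real" where
  "burkholder p x y = p * ((p - 1) / p) powr (p - 1) * (\<bar>y\<bar> - (p - 1) * \<bar>x\<bar>) * (\<bar>x\<bar> + \<bar>y\<bar>) powr (p - 1)"

text \<open>Weighted AM-GM for \<open>p\<close> and 1 with weights \<open>(p - 2) / (p - 1)\<close>
  and \<open>1 / (p - 1)\<close>, whose arithmetic mean is \<open>p - 1\<close>. It says that the
  constant of \<open>burkholder\<close> is at least 1, which is the majorant property at
  \<open>x = 0\<close>.\<close>

lemma powr_le_powr_pred:
  assumes "2 \<le> (p::real)" shows "p powr (p - 2) \<le> (p - 1) powr (p - 1)"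
proof -
  have "p powr ((p - 2) / (p - 1)) * 1 powr (1 / (p - 1)) \<le> (p - 2) / (p - 1) * p + 1 / (p - 1) * 1"
    using assms by (intro Youngs_inequality_0) (auto simp: field_simps)
  also have "\<dots> = p - 1" using assms by (simp add: field_simps)
  finally have "(p powr ((p - 2) / (p - 1))) powr (p - 1) \<le> (p - 1) powr (p - 1)"
    using assms by (intro powr_mono2) auto
  then show ?thesis using assms by (simp add: powr_powr)
qed

text \<open>\<open>p * E\<close> is the derivative of the gap in
  \<open>burkholder_ineq_normalized\<close>, so these signs put its minimum at \<open>D = 0\<close>.
  Each sign comes from AM-GM with its own weights.\<close>

lemma burkholder_derivative_sign:
  fixes p D :: real
  assumes p: "2 \<le> p" and "-1 < D"
  defines "c \<equiv> (p - 1) / p"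
  defines "E \<equiv> (1 + c * D) powr (p - 2) * (1 + (p - 1) * D) - (1 + D) powr (p - 1)"
  shows "0 \<le> D \<Longrightarrow> 0 \<le> E" "D \<le> 0 \<Longrightarrow> E \<le> 0"
proof -
  have c: "0 < c" "c < 1" using p by (auto simp: c_def)
  have base: "0 < 1 + c * D"
  proof -
    have "c * (-1) < c * D" using c \<open>-1 < D\<close> by (intro mult_strict_left_mono) auto
    then show ?thesis using c by simp
  qed
  have split: "(1 + D) powr (p - 1) = (1 + D) powr (p - 2) * (1 + D)"
    using \<open>-1 < D\<close> powr_add[of "1 + D" "p - 2" 1] by simp
  show "0 \<le> E" if "0 \<le> D"
  proof -
    \<comment> \<open>With this weight \<open>(1 + c * D) / (1 + D)\<close> and
      \<open>(1 + (p - 1) * D) / (1 + D)\<close> are means of 1 with \<open>c\<close> and with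
      \<open>p - 1\<close>, so AM-GM bounds them below by \<open>c powr v\<close> and
      \<open>(p - 1) powr v\<close>. What remains is
      \<open>1 \<le> c powr (p - 2) * (p - 1)\<close>.\<close>
    define v where "v = D / (1 + D)"
    have v: "0 \<le> v" "v \<le> 1" "1 - v = 1 / (1 + D)" using that by (auto simp: v_def field_simps)
    have 1: "c powr v \<le> (1 + c * D) / (1 + D)"
    proof -
      have "v * c + (1 - v) * 1 = (1 + c * D) / (1 + D)"
        unfolding v(3) by (simp add: v_def add_divide_distrib algebra_simps)
      then show ?thesis using Youngs_inequality_0[of v "1 - v" c 1] v(1,2) c by simp
    qed
    have 2: "(p - 1) powr v \<le> (1 + (p - 1) * D) / (1 + D)"
    proof -
      have "v * (p - 1) + (1 - v) * 1 = (1 + (p - 1) * D) / (1 + D)"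
        unfolding v(3) by (simp add: v_def flip: add_divide_distrib)
      then show ?thesis using Youngs_inequality_0[of v "1 - v" "p - 1" 1] v(1,2) p by simp
    qed
    have "1 \<le> c powr (p - 2) * (p - 1)"
    proof -
      have "p powr (p - 2) \<le> (p - 1) powr (p - 2) * (p - 1)"
        using powr_le_powr_pred[OF p] p powr_add[of "p - 1" "p - 2" 1] by simp
      then show ?thesis using p by (simp add: c_def powr_divide field_simps)
    qed
    then have "1 \<le> (c powr (p - 2) * (p - 1)) powr v"
      using v by (intro ge_one_powr_ge_zero) auto
    also have "\<dots> = (c powr v) powr (p - 2) * (p - 1) powr v"
      using p c by (simp add: powr_mult powr_powr mult.commute)
    also have "\<dots> \<le> ((1 + c * D) / (1 + D)) powr (p - 2) * ((1 + (p - 1) * D) / (1 + D))"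
      using 1 2 p by (intro mult_mono powr_mono2) auto
    also have "\<dots> = (1 + c * D) powr (p - 2) * (1 + (p - 1) * D) / (1 + D) powr (p - 1)"
      using that base by (simp add: powr_divide split)
    finally show ?thesis using that by (simp add: E_def field_simps)
  qed
  show "E \<le> 0" if "D \<le> 0"
  proof (cases "1 + (p - 1) * D \<le> 0")
    case True
    have "(1 + c * D) powr (p - 2) * (1 + (p - 1) * D) \<le> 0"
      using True by (intro mult_nonneg_nonpos) auto
    then show ?thesis using powr_ge_zero[of "1 + D" "p - 1"] unfolding E_def by linarith
  next
    case False
    \<comment> \<open>The left side is the \<open>(p - 1)\<close>-th root of the product in
      \<open>E\<close>; the mean on the right is \<open>1 + D\<close> plus a term with the sign of
      \<open>D\<close>.\<close>
    have "(1 + c * D) powr ((p - 2) / (p - 1)) * (1 + (p - 1) * D) powr (1 / (p - 1))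
       \<le> (p - 2) / (p - 1) * (1 + c * D) + 1 / (p - 1) * (1 + (p - 1) * D)"
      using p base False by (intro Youngs_inequality_0) (auto simp: field_simps)
    also have "\<dots> = 1 + D + (p - 2) / (p - 1) * (c * D)"
    proof -
      have eqs: "(p - 2) / (p - 1) = 1 - 1 / (p - 1)" "1 / (p - 1) * (1 + (p - 1) * D) = 1 / (p - 1) + D"
        using p by (simp_all add: field_simps)
      show ?thesis unfolding eqs by (simp add: algebra_simps add_divide_distrib)
    qed
    also have "\<dots> \<le> 1 + D"
    proof -
      have "(p - 2) / (p - 1) * (c * D) \<le> 0"
        using p c that by (intro mult_nonneg_nonpos) (auto intro: mult_nonneg_nonpos)
      then show ?thesis by simp
    qed
    finally have "((1 + c * D) powr ((p - 2) / (p - 1)) * (1 + (p - 1) * D) powr (1 / (p - 1))) powr (p - 1)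
        \<le> (1 + D) powr (p - 1)"
      using p base False by (intro powr_mono2) auto
    then show ?thesis using p base False by (simp add: E_def powr_mult powr_powr)
  qed
qed

lemma burkholder_ineq_normalized:
  fixes p D :: real
  assumes p: "2 \<le> p" and "-1 < D"
  shows "(1 + D) powr p - 1 \<le> p * D * (1 + (p - 1) / p * D) powr (p - 1)"
proof -
  let ?c = "(p - 1) / p"
  define h where "h = (\<lambda>D. p * D * (1 + ?c * D) powr (p - 1) - (1 + D) powr p + 1)"
  have c: "0 < ?c" "?c < 1" using p by auto
  define G where "G = (\<lambda>x. (1 + ?c * x) powr (p - 2) * (1 + (p - 1) * x) - (1 + x) powr (p - 1))"
  have der: "(h has_real_derivative p * G x) (at x)" if "-1 < x" for x
  proof -
    have base: "0 < 1 + ?c * x"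
    proof -
      have "?c * (-1) < ?c * x" using c that by (intro mult_strict_left_mono) auto
      then show ?thesis using c by linarith
    qed
    have split: "(1 + ?c * x) powr (p - 1) = (1 + ?c * x) powr (p - 2) * (1 + ?c * x)"
      using base powr_add[of "1 + ?c * x" "p - 2" 1] by simp
    have "(h has_real_derivative p * (1 + ?c * x) powr (p - 1) +
        p * x * ((p - 1) * (1 + ?c * x) powr (p - 2) * ?c) - p * (1 + x) powr (p - 1)) (at x)"
      unfolding h_def using that base p by (auto intro!: derivative_eq_intros)
    moreover have "p * (1 + ?c * x) powr (p - 1) +
        p * x * ((p - 1) * (1 + ?c * x) powr (p - 2) * ?c) - p * (1 + x) powr (p - 1) =
      p * ((1 + ?c * x) powr (p - 2) * (1 + (p - 1) * x) - (1 + x) powr (p - 1))"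
    proof -
      have *: "?c * p = p - 1" using p by simp
      have "p * (R * (1 + k * x)) + p * x * ((p - 1) * R * k) - p * Q =
         p * (R * (1 + (k * p) * x) - Q)" for R k Q by (simp add: algebra_simps)
      from this[of "(1 + ?c * x) powr (p - 2)" ?c "(1 + x) powr (p - 1)"]
      show ?thesis unfolding split * .
    qed
    ultimately show ?thesis by (simp add: G_def)
  qed
  have "h 0 \<le> h D"
  proof (cases "0 \<le> D")
    case True
    show ?thesis
    proof (rule DERIV_nonneg_imp_nondecreasing[OF True])
      fix x assume "0 \<le> x" "x \<le> D"
      then show "\<exists>y. (h has_real_derivative y) (at x) \<and> 0 \<le> y"
        using burkholder_derivative_sign(1)[OF p, of x] p
        by (intro exI[of _ "p * G x"] conjI der mult_nonneg_nonneg) (auto simp: G_def)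
    qed
  next
    case False
    then have "D \<le> 0" by simp
    then show ?thesis
    proof (rule DERIV_nonpos_imp_nonincreasing)
      fix x assume "D \<le> x" "x \<le> 0"
      then show "\<exists>y. (h has_real_derivative y) (at x) \<and> y \<le> 0"
        using burkholder_derivative_sign(2)[OF p, of x] p \<open>-1 < D\<close>
        by (intro exI[of _ "p * G x"] conjI der mult_nonneg_nonpos) (auto simp: G_def)
    qed
  qed
  then show ?thesis by (simp add: h_def)
qed

text \<open>With \<open>A = \<bar>y\<bar>\<close> and \<open>B = (p - 1) * \<bar>x\<bar>\<close>,
  the function is \<open>p * (A - B) * M powr (p - 1)\<close> for the mean
  \<open>M = ((p - 1) * A + B) / p\<close>. By homogeneity only the ratio counts, which leaves the
  inequality in \<open>D = A / B - 1\<close>; \<open>A = 0\<close> and \<open>B = 0\<close> fall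
  outside its range and are done by hand.\<close>

lemma burkholder_majorant:
  assumes p: "2 \<le> p"
  shows "\<bar>y\<bar> powr p - ((p - 1) * \<bar>x\<bar>) powr p \<le> burkholder p x y"
proof -
  define A where "A = \<bar>y\<bar>"
  define B where "B = (p - 1) * \<bar>x\<bar>"
  have AB: "0 \<le> A" "0 \<le> B" using p by (auto simp: A_def B_def)
  let ?M = "(p - 1) / p * A + B / p"
  have "?M = (p - 1) / p * (\<bar>x\<bar> + \<bar>y\<bar>)" using p by (simp add: A_def B_def field_simps)
  then have "?M powr (p - 1) = ((p - 1) / p) powr (p - 1) * (\<bar>x\<bar> + \<bar>y\<bar>) powr (p - 1)"
    using p by (simp only: powr_mult)
  then have U: "burkholder p x y = p * (A - B) * ?M powr (p - 1)"
    unfolding burkholder_def by (simp add: A_def B_def)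
  have "A powr p - B powr p \<le> p * (A - B) * ?M powr (p - 1)"
  proof (cases "B = 0")
    case True
    show ?thesis
    proof (cases "A = 0")
      case False
      then have "A > 0" using AB by simp
      have "p powr (p - 1) = p * p powr (p - 2)" using p powr_add[of p "p - 2" 1] by simp
      also have "\<dots> \<le> p * (p - 1) powr (p - 1)" using powr_le_powr_pred[OF p] p by simp
      finally have "1 \<le> p * ((p - 1) / p) powr (p - 1)" using p by (simp add: powr_divide field_simps)
      then have "A powr p * 1 \<le> A powr p * (p * ((p - 1) / p) powr (p - 1))" by (intro mult_left_mono) auto
      also have "A powr p = A * A powr (p - 1)" using \<open>A > 0\<close> powr_add[of A "p - 1" 1] by simp
      also have "A * A powr (p - 1) * (p * ((p - 1) / p) powr (p - 1)) = p * (A - B) * ?M powr (p - 1)"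
        using True p \<open>A > 0\<close> by (simp add: powr_mult powr_divide)
      finally show ?thesis using True p \<open>A > 0\<close> powr_add[of A "p - 1" 1] by simp
    qed (use True in simp)
  next
    case False
    then have B: "B > 0" using AB by simp
    show ?thesis
    proof (cases "A = 0")
      case True
      have "p * p powr (- (p - 1)) \<le> 1"
      proof -
        have "p * p powr (- (p - 1)) = p powr (2 - p)" using p powr_add[of p 1 "1 - p"] by simp
        also have "\<dots> \<le> p powr 0" using p by (intro powr_mono) auto
        finally show ?thesis using p by simp
      qed
      moreover have "(1 / p) powr (p - 1) = p powr (- (p - 1))"
        using p by (simp add: powr_divide powr_minus_divide del: minus_diff_eq)
      ultimately have "p * (1 / p) powr (p - 1) \<le> 1" by (simp only:)
      then have "B powr p * (p * (1 / p) powr (p - 1)) \<le> B powr p * 1" by (intro mult_left_mono) auto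
      moreover have "B powr p * (p * (1 / p) powr (p - 1)) = p * B * (B / p) powr (p - 1)"
        using B p powr_add[of B "p - 1" 1] by (simp add: powr_divide)
      ultimately show ?thesis using True by simp
    next
      case False
      define D where "D = A / B - 1"
      have D: "-1 < D" "A = B * (1 + D)" using False AB B by (auto simp: D_def field_simps)
      have M: "?M = B * (1 + (p - 1) / p * D)" unfolding D(2) using p by (simp add: field_simps)
      have pos: "0 \<le> 1 + (p - 1) / p * D"
      proof -
        have "(p - 1) / p * (-1) \<le> (p - 1) / p * D" using D p by (intro mult_left_mono) auto
        moreover have "(p - 1) / p \<le> 1" using p by simp
        ultimately show ?thesis by linarith
      qed
      have "B powr p * ((1 + D) powr p - 1) \<le> B powr p * (p * D * (1 + (p - 1) / p * D) powr (p - 1))"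
        by (intro mult_left_mono burkholder_ineq_normalized p D) auto
      also have "\<dots> = p * (B * D) * (B powr (p - 1) * (1 + (p - 1) / p * D) powr (p - 1))"
        using B powr_add[of B "p - 1" 1] by simp
      also have "\<dots> = p * (A - B) * ?M powr (p - 1)"
      proof -
        have "?M powr (p - 1) = B powr (p - 1) * (1 + (p - 1) / p * D) powr (p - 1)"
          unfolding M using B pos by (simp only: powr_mult)
        moreover have "A - B = B * D" using D by (simp add: algebra_simps)
        ultimately show ?thesis by (simp only:)
      qed
      also have "B powr p * ((1 + D) powr p - 1) = A powr p - B powr p"
      proof -
        have "A powr p = B powr p * (1 + D) powr p" unfolding D(2) using B D by (simp only: powr_mult)
        then show ?thesis by (simp add: right_diff_distrib)
      qed
      finally show ?thesis .
    qed
  qed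
  then show ?thesis unfolding U by (simp add: A_def B_def)
qed

lemma burkholder_diagonal:
  assumes "2 \<le> p" "\<bar>x\<bar> = \<bar>y\<bar>" shows "burkholder p x y \<le> 0"
proof -
  have "\<bar>y\<bar> - (p - 1) * \<bar>x\<bar> = (2 - p) * \<bar>x\<bar>" using assms by (simp add: algebra_simps)
  also have "\<dots> \<le> 0" using assms by (simp add: mult_nonpos_nonneg)
  finally show ?thesis unfolding burkholder_def using assms
    by (intro mult_nonpos_nonneg mult_nonneg_nonpos) auto
qed

subsection \<open>Zigzag concavity\<close>

text \<open>A nondecreasing convex function stays convex when it is frozen to the left of
  \<open>d\<close> at its value in \<open>d\<close>, because the slope can only jump upwards
  there.\<close>

lemma convex_on_max:
  fixes d :: real
  assumes conv: "convex_on {d..} f" and mono: "\<And>x y. d \<le> x \<Longrightarrow> x \<le> y \<Longrightarrow> f x \<le> f y"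
  shows "convex_on UNIV (\<lambda>x. f (max x d))"
proof (rule convex_onI)
  fix t x y :: real assume t: "0 < t" "t < 1"
  let ?z = "(1 - t) * max x d + t * max y d"
  have le: "(1 - t) * x + t * y \<le> ?z" using t by (intro add_mono mult_left_mono) auto
  have "(1 - t) * d + t * d \<le> ?z" using t by (intro add_mono mult_left_mono) auto
  then have "d \<le> ?z" by (simp add: algebra_simps)
  then have "f (max ((1 - t) *\<^sub>R x + t *\<^sub>R y) d) \<le> f ?z"
    using le by (intro mono) auto
  also have "\<dots> \<le> (1 - t) * f (max x d) + t * f (max y d)"
    using conv[unfolded convex_on_def] t by (auto dest!: bspec[of _ _ "max x d"] bspec[of _ _ "max y d"])
  finally show "f (max ((1 - t) *\<^sub>R x + t *\<^sub>R y) d) \<le> (1 - t) * f (max x d) + t * f (max y d)" .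
qed simp

lemma convex_on_comp_affine:
  fixes f :: "real \<Rightarrow> real"
  assumes "convex_on UNIV f" shows "convex_on UNIV (\<lambda>x. f (a * x + b))"
proof (rule convex_onI)
  fix t x y :: real assume t: "0 < t" "t < 1"
  have "a * ((1 - t) *\<^sub>R x + t *\<^sub>R y) + b = (1 - t) *\<^sub>R (a * x + b) + t *\<^sub>R (a * y + b)"
    by (simp add: algebra_simps)
  then show "f (a * ((1 - t) *\<^sub>R x + t *\<^sub>R y) + b) \<le> (1 - t) * f (a * x + b) + t * f (a * y + b)"
    using assms t unfolding convex_on_def by auto
qed simp

text \<open>On the line \<open>x - y = d\<close>, in the variable \<open>s = x + y\<close> and up to
  a positive factor, \<open>- burkholder\<close> is affine for \<open>\<bar>s\<bar> \<le> d\<close>.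
  Beyond \<open>s = d\<close> and \<open>s = -d\<close> it exceeds that affine function by
  \<open>H1 s\<close> and \<open>H2 (- s)\<close> up to constants, so that convexity is a matter of
  these two pieces.\<close>

lemma burkholder_convex_pieces:
  fixes p d :: real
  assumes p: "2 \<le> p" and d: "0 < d"
  defines "H1 \<equiv> \<lambda>s. (p - 2) * s powr p + p * d * s powr (p - 1) - p * d powr (p - 1) * s"
  defines "H2 \<equiv> \<lambda>s. (p - 2) * s powr p - p * d * s powr (p - 1) + p * d powr (p - 1) * s"
  shows "convex_on UNIV (\<lambda>x. H1 (max x d))" "convex_on UNIV (\<lambda>x. H2 (max x d))"
proof -
  define D1 where "D1 = (\<lambda>s. (p - 2) * (p * s powr (p - 1)) + p * d * ((p - 1) * s powr (p - 2)) - p * d powr (p - 1))"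
  define D2 where "D2 = (\<lambda>s. (p - 2) * (p * s powr (p - 1)) - p * d * ((p - 1) * s powr (p - 2)) + p * d powr (p - 1))"
  have der1: "(H1 has_real_derivative D1 x) (at x)" if "d \<le> x" for x
    unfolding H1_def D1_def using that d by (auto intro!: derivative_eq_intros)
  have der2: "(H2 has_real_derivative D2 x) (at x)" if "d \<le> x" for x
    unfolding H2_def D2_def using that d by (auto intro!: derivative_eq_intros)
  have dd: "d powr (p - 1) = d * d powr (p - 2)" using d powr_add[of d "p - 2" 1] by simp
  have mono1: "D1 x \<le> D1 y" if "d \<le> x" "x \<le> y" for x y
    unfolding D1_def using that p d
    by (intro diff_right_mono add_mono mult_left_mono powr_mono2) auto
  have "0 \<le> D1 d"
  proof -
    have "D1 d = p * (2 * (p - 2)) * d powr (p - 1)"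
      unfolding D1_def dd by (simp add: algebra_simps)
    then show ?thesis using p by simp
  qed
  then have nn1: "0 \<le> D1 x" if "d \<le> x" for x using mono1[of d x] that by linarith
  have mono2: "D2 x \<le> D2 y" if "d \<le> x" "x \<le> y" for x y
    using that(2)
  proof (rule DERIV_nonneg_imp_nondecreasing)
    fix z assume z: "x \<le> z" "z \<le> y"
    then have z0: "0 < z" "d \<le> z" using that d by auto
    have zz: "z powr (p - 2) = z powr (p - 3) * z" using z0 powr_add[of z "p - 3" 1] by simp
    have "(D2 has_real_derivative (p - 2) * (p * ((p - 1) * z powr (p - 2))) - p * d * ((p - 1) * ((p - 2) * z powr (p - 3)))) (at z)"
      unfolding D2_def using z0 by (auto intro!: derivative_eq_intros)
    moreover have "(p - 2) * (p * ((p - 1) * z powr (p - 2))) - p * d * ((p - 1) * ((p - 2) * z powr (p - 3)))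
       = (p - 2) * p * (p - 1) * z powr (p - 3) * (z - d)"
      unfolding zz by (simp add: algebra_simps)
    moreover have "0 \<le> (p - 2) * p * (p - 1) * z powr (p - 3) * (z - d)" using p z0 by simp
    ultimately show "\<exists>l. (D2 has_real_derivative l) (at z) \<and> 0 \<le> l" by auto
  qed
  \<comment> \<open>So the join at \<open>s = -d\<close> is smooth; at \<open>s = d\<close> the
    slope jumps by \<open>D1 d\<close>, which is nonnegative for \<open>p \<ge> 2\<close>.\<close>
  have "D2 d = 0" unfolding D2_def dd by (simp add: algebra_simps)
  then have nn2: "0 \<le> D2 x" if "d \<le> x" for x using mono2[of d x] that by linarith
  show "convex_on UNIV (\<lambda>x. H1 (max x d))"
  proof (rule convex_on_max)
    show "convex_on {d..} H1" by (rule convex_on_realI[where f'=D1]) (auto intro: der1 mono1)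
    show "H1 x \<le> H1 y" if "d \<le> x" "x \<le> y" for x y
      using that(2) by (rule DERIV_nonneg_imp_nondecreasing) (use that in \<open>auto intro!: exI der1 nn1\<close>)
  qed
  show "convex_on UNIV (\<lambda>x. H2 (max x d))"
  proof (rule convex_on_max)
    show "convex_on {d..} H2" by (rule convex_on_realI[where f'=D2]) (auto intro: der2 mono2)
    show "H2 x \<le> H2 y" if "d \<le> x" "x \<le> y" for x y
      using that(2) by (rule DERIV_nonneg_imp_nondecreasing) (use that in \<open>auto intro!: exI der2 nn2\<close>)
  qed
qed

lemma burkholder_convex_pos:
  fixes p d :: real
  assumes p: "2 \<le> p" and d: "0 < d"
  shows "convex_on UNIV (\<lambda>s. - burkholder p ((s + d) / 2) ((s - d) / 2))"
proof -
  define H1 where "H1 = (\<lambda>s. (p - 2) * s powr p + p * d * s powr (p - 1) - p * d powr (p - 1) * s)"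
  define H2 where "H2 = (\<lambda>s. (p - 2) * s powr p - p * d * s powr (p - 1) + p * d powr (p - 1) * s)"
  define K where "K = p * ((p - 1) / p) powr (p - 1) / 2"
  have "convex_on UNIV (\<lambda>s. K * ((H1 (max s d) + H2 (max (-1 * s + 0) d)) + (p * d powr (p - 1) * s - (p - 2) * d powr p)))"
  proof (intro convex_on_cmul convex_on_add)
    show "convex_on UNIV (\<lambda>s. H1 (max s d))" unfolding H1_def by (rule burkholder_convex_pieces(1)[OF p d])
    show "convex_on UNIV (\<lambda>s. H2 (max (-1 * s + 0) d))"
      unfolding H2_def by (rule convex_on_comp_affine[OF burkholder_convex_pieces(2)[OF p d]])
    show "convex_on UNIV (\<lambda>s. p * d powr (p - 1) * s - (p - 2) * d powr p)"
      by (rule convex_onI) (simp_all add: algebra_simps)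
  qed (use p in \<open>simp add: K_def\<close>)
  moreover have "- burkholder p ((s + d) / 2) ((s - d) / 2) =
     K * ((H1 (max s d) + H2 (max (-1 * s + 0) d)) + (p * d powr (p - 1) * s - (p - 2) * d powr p))" for s
  proof -
    have pw: "t powr p = t * t powr (p - 1)" if "0 < t" for t :: real
      using that powr_add[of t "p - 1" 1] by simp
    have Hd: "H1 d = (p - 2) * d powr p" "H2 d = (p - 2) * d powr p"
      using pw[OF d] by (auto simp: H1_def H2_def)
    have U: "- burkholder p x y = K * (2 * ((p - 1) * \<bar>x\<bar> - \<bar>y\<bar>) * (\<bar>x\<bar> + \<bar>y\<bar>) powr (p - 1))" for x y
      by (simp add: burkholder_def K_def field_simps)
    consider "d \<le> s" | "-d < s" "s < d" | "s \<le> -d" by linarith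
    then have "2 * ((p - 1) * \<bar>(s + d) / 2\<bar> - \<bar>(s - d) / 2\<bar>) * (\<bar>(s + d) / 2\<bar> + \<bar>(s - d) / 2\<bar>) powr (p - 1)
      = (H1 (max s d) + H2 (max (-1 * s + 0) d)) + (p * d powr (p - 1) * s - (p - 2) * d powr p)"
    proof cases
      case 1
      then have e: "\<bar>(s + d) / 2\<bar> = (s + d) / 2" "\<bar>(s - d) / 2\<bar> = (s - d) / 2" "max s d = s" "max (-1 * s + 0) d = d"
        "(s + d) / 2 + (s - d) / 2 = s"
        using d by (auto simp: field_simps)
      have eq: "2 * ((p - 1) * ((s + d) / 2) - (s - d) / 2) = (p - 2) * s + p * d" by (simp add: field_simps)
      show ?thesis unfolding e Hd eq using pw[of s] 1 d by (simp add: H1_def algebra_simps)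
    next
      case 2
      then have e: "\<bar>(s + d) / 2\<bar> = (s + d) / 2" "\<bar>(s - d) / 2\<bar> = (d - s) / 2" "max s d = d" "max (-1 * s + 0) d = d"
        "(s + d) / 2 + (d - s) / 2 = d"
        using d by (auto simp: field_simps)
      have eq: "2 * ((p - 1) * ((s + d) / 2) - (d - s) / 2) = p * s + (p - 2) * d" by (simp add: field_simps)
      show ?thesis unfolding e Hd eq using pw[of d] d by (simp add: algebra_simps)
    next
      case 3
      then have e: "\<bar>(s + d) / 2\<bar> = - (s + d) / 2" "\<bar>(s - d) / 2\<bar> = (d - s) / 2" "max s d = d" "max (-1 * s + 0) d = - s"
        "- (s + d) / 2 + (d - s) / 2 = - s"
        using d by (auto simp: field_simps)
      have eq: "2 * ((p - 1) * (- (s + d) / 2) - (d - s) / 2) = - ((p - 2) * s) - p * d" by (simp add: field_simps)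
      show ?thesis unfolding e Hd eq using pw[of "-s"] 3 d by (simp add: H2_def algebra_simps)
    qed
    then show ?thesis unfolding U by simp
  qed
  ultimately show ?thesis by simp
qed

text \<open>Changing the sign of both arguments preserves \<open>burkholder\<close> and exchanges
  \<open>d\<close> with \<open>- d\<close>; on the line \<open>d = 0\<close> convexity survives as a
  pointwise limit.\<close>

lemma burkholder_convex:
  fixes p d :: real
  assumes p: "2 \<le> p"
  shows "convex_on UNIV (\<lambda>s. - burkholder p ((s + d) / 2) ((s - d) / 2))"
proof -
  consider "0 < d" | "d < 0" | "d = 0" by linarith
  then show ?thesis
  proof cases
    case 1 then show ?thesis by (rule burkholder_convex_pos[OF p])
  next
    case 2
    then have "convex_on UNIV (\<lambda>s. - burkholder p ((s + - d) / 2) ((s - - d) / 2))"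
      by (intro burkholder_convex_pos[OF p]) simp
    from convex_on_comp_affine[OF this, of "-1" 0]
    have "convex_on UNIV (\<lambda>s. - burkholder p ((-1 * s + 0 + - d) / 2) ((-1 * s + 0 - - d) / 2))" .
    moreover have "(-1 * s + 0 + - d) / 2 = - ((s + d) / 2)" "(-1 * s + 0 - - d) / 2 = - ((s - d) / 2)" for s
      by (simp_all add: field_simps)
    moreover have "burkholder p (- x) (- y) = burkholder p x y" for x y by (simp add: burkholder_def)
    ultimately show ?thesis by (simp only:)
  next
    case 3
    define f where "f = (\<lambda>d s. - burkholder p ((s + d) / 2) ((s - d) / 2))"
    have lim: "(\<lambda>n. f (1 / real (Suc n)) s) \<longlonglongrightarrow> f 0 s" for s
    proof -
      have "(\<lambda>n. 1 / real (Suc n)) \<longlonglongrightarrow> 0" using LIMSEQ_inverse_real_of_nat by (simp add: inverse_eq_divide)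
      then show ?thesis unfolding f_def burkholder_def using p
        by (intro tendsto_minus tendsto_mult tendsto_diff tendsto_rabs tendsto_add tendsto_divide tendsto_const tendsto_powr') auto
    qed
    have "convex_on UNIV (f 0)"
    proof (rule convex_onI)
      fix t x y :: real assume t: "0 < t" "t < 1"
      show "f 0 ((1 - t) *\<^sub>R x + t *\<^sub>R y) \<le> (1 - t) * f 0 x + t * f 0 y"
      proof (rule LIMSEQ_le[OF lim])
        show "(\<lambda>n. (1 - t) * f (1 / real (Suc n)) x + t * f (1 / real (Suc n)) y) \<longlonglongrightarrow> (1 - t) * f 0 x + t * f 0 y"
          by (intro tendsto_intros lim)
        have "f (1 / real (Suc n)) ((1 - t) *\<^sub>R x + t *\<^sub>R y) \<le> (1 - t) * f (1 / real (Suc n)) x + t * f (1 / real (Suc n)) y" for n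
          using burkholder_convex_pos[OF p, of "1 / real (Suc n)", unfolded convex_on_def] t
          unfolding f_def by auto
        then show "\<exists>N. \<forall>n\<ge>N. f (1 / real (Suc n)) ((1 - t) *\<^sub>R x + t *\<^sub>R y) \<le> (1 - t) * f (1 / real (Suc n)) x + t * f (1 / real (Suc n)) y"
          by blast
      qed
    qed simp
    then show ?thesis using 3 by (simp add: f_def)
  qed
qed

text \<open>For slope -1 the sum and the difference of the arguments exchange roles, and evenness in
  \<open>y\<close> leads back to the lines already treated.\<close>

lemma burkholder_zigzag:
  fixes p x y \<epsilon> :: real
  assumes p: "2 \<le> p" and \<epsilon>: "\<epsilon> \<in> {1, -1}"
  shows "convex_on UNIV (\<lambda>t. - burkholder p (x + t) (y + \<epsilon> * t))"
proof (cases "\<epsilon> = 1")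
  case True
  have "convex_on UNIV (\<lambda>t. - burkholder p ((2 * t + (x + y) + (x - y)) / 2) ((2 * t + (x + y) - (x - y)) / 2))"
    by (rule convex_on_comp_affine[OF burkholder_convex[OF p]])
  moreover have "(2 * t + (x + y) + (x - y)) / 2 = x + t" "(2 * t + (x + y) - (x - y)) / 2 = y + t" for t
    by (simp_all add: field_simps)
  ultimately have "convex_on UNIV (\<lambda>t. - burkholder p (x + t) (y + t))" by (simp only:)
  then show ?thesis using True by simp
next
  case False
  have "convex_on UNIV (\<lambda>t. - burkholder p ((2 * t + (x - y) + (x + y)) / 2) ((2 * t + (x - y) - (x + y)) / 2))"
    by (rule convex_on_comp_affine[OF burkholder_convex[OF p]])
  moreover have "(2 * t + (x - y) + (x + y)) / 2 = x + t" "(2 * t + (x - y) - (x + y)) / 2 = - (y + - t)" for t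
    by (simp_all add: field_simps)
  moreover have "burkholder p x' (- y') = burkholder p x' y'" for x' y' by (simp add: burkholder_def)
  ultimately have "convex_on UNIV (\<lambda>t. - burkholder p (x + t) (y + - t))" by (simp only:)
  then show ?thesis using False \<epsilon> by simp
qed

lemma burkholder_jensen:
  fixes p x y \<epsilon> :: real and a h :: "'i \<Rightarrow> real"
  assumes p: "2 \<le> p" and \<epsilon>: "\<epsilon> \<in> {1, -1}" and I: "finite I" "I \<noteq> {}"
    and a: "(\<Sum>i\<in>I. a i) = 1" "\<And>i. i \<in> I \<Longrightarrow> 0 \<le> a i" and h: "(\<Sum>i\<in>I. a i * h i) = 0"
  shows "(\<Sum>i\<in>I. a i * burkholder p (x + h i) (y + \<epsilon> * h i)) \<le> burkholder p x y"
  using convex_on_sum[OF I burkholder_zigzag[OF p \<epsilon>, of x y] a, of h] h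
  by (simp add: sum_negf)

subsection \<open>The Bellman function\<close>

text \<open>The Legendre transform of Burkholder's function in its second variable turns zigzag
  concavity into a quantitative convexity that controls the covariance of the increments.\<close>

definition bellman :: "real \<Rightarrow> real \<Rightarrow> real \<Rightarrow> real" where
  "bellman p x y = (SUP t. t * y - burkholder p x t / p)"

text \<open>The Legendre transform reverses order: the majorant property bounds
  \<open>burkholder\<close> below by powers, and Young's inequality transforms these powers.\<close>

lemma bellman_term_le:
  assumes p: "2 \<le> p" and q: "1 / p + 1 / q = 1"
  shows "t * y - burkholder p x t / p \<le> ((p - 1) * \<bar>x\<bar>) powr p / p + \<bar>y\<bar> powr q / q"
proof -
  have "1 / q = (p - 1) / p" using q p by (simp add: field_simps)
  then have q': "q = p / (p - 1)" by (metis inverse_divide inverse_inverse_eq inverse_eq_divide)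
  have "1 < q" unfolding q' using p by (simp add: field_simps)
  have "t * y \<le> \<bar>t\<bar> * \<bar>y\<bar>" by (metis abs_ge_self abs_mult)
  also have "\<dots> \<le> \<bar>t\<bar> powr p / p + \<bar>y\<bar> powr q / q"
    using p q \<open>1 < q\<close> by (intro Youngs_inequality) auto
  finally have "t * y \<le> \<bar>t\<bar> powr p / p + \<bar>y\<bar> powr q / q" .
  moreover have "\<bar>t\<bar> powr p / p - ((p - 1) * \<bar>x\<bar>) powr p / p \<le> burkholder p x t / p"
    using burkholder_majorant[OF p, of t x] p by (simp add: divide_right_mono flip: diff_divide_distrib)
  ultimately show ?thesis by linarith
qed

lemma bellman_bdd:
  assumes "2 \<le> p" shows "bdd_above (range (\<lambda>t. t * y - burkholder p x t / p))"
proof (rule bdd_aboveI2)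
  have "1 / p + 1 / (p / (p - 1)) = 1" using assms by (simp add: field_simps)
  from bellman_term_le[OF assms this] show "t * y - burkholder p x t / p \<le>
    ((p - 1) * \<bar>x\<bar>) powr p / p + \<bar>y\<bar> powr (p / (p - 1)) / (p / (p - 1))" for t .
qed

lemma bellman_upper: "2 \<le> p \<Longrightarrow> t * y - burkholder p x t / p \<le> bellman p x y"
  unfolding bellman_def by (rule cSUP_upper[OF UNIV_I bellman_bdd])

lemma bellman_le:
  assumes "2 \<le> p" "1 / p + 1 / q = 1"
  shows "bellman p x y \<le> ((p - 1) * \<bar>x\<bar>) powr p / p + \<bar>y\<bar> powr q / q"
  unfolding bellman_def by (rule cSUP_least) (use bellman_term_le[OF assms] in auto)

text \<open>The slope \<open>t\<close> is taken on the diagonal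
  \<open>\<bar>t\<bar> = \<bar>x\<bar>\<close>, where \<open>burkholder\<close> is not positive,
  with the sign of \<open>y\<close>. Nonnegativity lets the terminal term be dropped when the walk
  is iterated.\<close>

lemma bellman_nonneg:
  assumes p: "2 \<le> p" shows "0 \<le> bellman p x y"
proof -
  define t where "t = sgn y * \<bar>x\<bar>"
  have "burkholder p x t \<le> 0"
  proof (cases "y = 0")
    case True
    then have "t = 0" by (simp add: t_def)
    then show ?thesis unfolding burkholder_def using p
      by (intro mult_nonpos_nonneg mult_nonneg_nonpos) auto
  next
    case False
    then show ?thesis by (intro burkholder_diagonal p) (simp add: t_def abs_mult)
  qed
  moreover have "t * y = \<bar>x\<bar> * \<bar>y\<bar>" by (simp add: t_def abs_sgn[of y] mult_ac)
  moreover have "0 \<le> \<bar>x\<bar> * \<bar>y\<bar>" by simp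
  moreover have "burkholder p x t / p \<le> 0" using \<open>burkholder p x t \<le> 0\<close> p by (simp add: divide_nonpos_pos)
  ultimately have "0 \<le> t * y - burkholder p x t / p" by linarith
  then show ?thesis using bellman_upper[OF p, of t y x] by linarith
qed

text \<open>For a slope \<open>t\<close> at \<open>(x, y)\<close>, the slope
  \<open>t + \<epsilon> * h i\<close> is tested at the \<open>i\<close>-th point. Zigzag concavity
  controls the average of \<open>burkholder\<close>, while the average of slope times second
  variable produces exactly the covariance of \<open>h\<close> and \<open>k\<close> with sign
  \<open>\<epsilon>\<close>.\<close>

lemma bellman_jensen:
  fixes p x y \<epsilon> :: real and a h k :: "'i \<Rightarrow> real"
  assumes p: "2 \<le> p" and \<epsilon>: "\<epsilon> \<in> {1, -1}" and I: "finite I" "I \<noteq> {}"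
    and a: "(\<Sum>i\<in>I. a i) = 1" "\<And>i. i \<in> I \<Longrightarrow> 0 \<le> a i"
    and h: "(\<Sum>i\<in>I. a i * h i) = 0" and k: "(\<Sum>i\<in>I. a i * k i) = 0"
  shows "bellman p x y + \<epsilon> * (\<Sum>i\<in>I. a i * (h i * k i)) \<le> (\<Sum>i\<in>I. a i * bellman p (x + h i) (y + k i))"
proof -
  have "t * y - burkholder p x t / p \<le> (\<Sum>i\<in>I. a i * bellman p (x + h i) (y + k i)) - \<epsilon> * (\<Sum>i\<in>I. a i * (h i * k i))" for t
  proof -
    have e: "(\<Sum>i\<in>I. a i * ((t + \<epsilon> * h i) * (y + k i) - burkholder p (x + h i) (t + \<epsilon> * h i) / p)) =
       t * y * (\<Sum>i\<in>I. a i) + t * (\<Sum>i\<in>I. a i * k i) + \<epsilon> * y * (\<Sum>i\<in>I. a i * h i) +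
         \<epsilon> * (\<Sum>i\<in>I. a i * (h i * k i)) - (\<Sum>i\<in>I. a i * burkholder p (x + h i) (t + \<epsilon> * h i)) / p"
      unfolding sum_distrib_left sum_divide_distrib sum.distrib[symmetric] sum_subtractf[symmetric]
      by (intro sum.cong refl) (simp add: algebra_simps)
    have "(\<Sum>i\<in>I. a i * burkholder p (x + h i) (t + \<epsilon> * h i)) / p \<le> burkholder p x t / p"
      using burkholder_jensen[OF p \<epsilon> I a h] p by (intro divide_right_mono) auto
    then have "t * y + \<epsilon> * (\<Sum>i\<in>I. a i * (h i * k i)) - burkholder p x t / p \<le>
       (\<Sum>i\<in>I. a i * ((t + \<epsilon> * h i) * (y + k i) - burkholder p (x + h i) (t + \<epsilon> * h i) / p))"
      unfolding e using a h k by simp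
    also have "\<dots> \<le> (\<Sum>i\<in>I. a i * bellman p (x + h i) (y + k i))"
      by (intro sum_mono mult_left_mono bellman_upper p a)
    finally show ?thesis by simp
  qed
  then have "bellman p x y \<le> (\<Sum>i\<in>I. a i * bellman p (x + h i) (y + k i)) - \<epsilon> * (\<Sum>i\<in>I. a i * (h i * k i))"
    unfolding bellman_def[of p x y] by (intro cSUP_least) auto
  then show ?thesis by simp
qed

subsection \<open>Sums of finitely supported functions\<close>

definition total :: "(int \<times> int \<Rightarrow> real) \<Rightarrow> real" where
  "total f = (\<Sum>x | f x \<noteq> 0. f x)"

lemma total_superset: "finite A \<Longrightarrow> {x. f x \<noteq> 0} \<subseteq> A \<Longrightarrow> total f = sum f A"
  unfolding total_def by (intro sum.mono_neutral_left) auto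

text \<open>Linearity of \<open>total\<close> and its invariance under the walk are then read off at
  frequency 0.\<close>

lemma total_fourier: "total f = Re (fourier f 0)"
  by (simp add: total_def fourier_def trig_sum_def pairing_def)

lemma total_add: "finsupp f \<Longrightarrow> finsupp g \<Longrightarrow> total (\<lambda>x. f x + g x) = total f + total g"
  by (simp add: total_fourier fourier_add)

lemma total_diff: "finsupp f \<Longrightarrow> finsupp g \<Longrightarrow> total (\<lambda>x. f x - g x) = total f - total g"
  by (simp add: total_fourier fourier_diff)

lemma total_cmult: "finsupp f \<Longrightarrow> total (\<lambda>x. c * f x) = c * total f"
  by (simp add: total_fourier fourier_cmult)

lemma total_mono:
  assumes "finsupp f" "finsupp g" "\<And>x. f x \<le> g x" shows "total f \<le> total g"
proof -
  let ?A = "{x. f x \<noteq> 0} \<union> {x. g x \<noteq> 0}"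
  have "total f = sum f ?A" "total g = sum g ?A" using assms by (auto intro!: total_superset)
  then show ?thesis using assms by (simp add: sum_mono)
qed

lemma total_nonneg: "(\<And>x. 0 \<le> f x) \<Longrightarrow> 0 \<le> total f"
  unfolding total_def by (intro sum_nonneg) auto

lemma finsupp_mult: "finsupp f \<Longrightarrow> finsupp (\<lambda>x. f x * g x)"
  by (rule finite_subset[of _ "{x. f x \<noteq> 0}"]) auto

lemma finsupp_comp2:
  "finsupp f \<Longrightarrow> finsupp g \<Longrightarrow> \<Phi> 0 0 = 0 \<Longrightarrow> finsupp (\<lambda>x. \<Phi> (f x) (g x))"
  by (rule finite_subset[of _ "{x. f x \<noteq> 0} \<union> {x. g x \<noteq> 0}"]) auto

lemma total_parseval:
  assumes "finsupp f" "finsupp g"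
  shows "total (\<lambda>x. f x * g x) = (\<integral>\<theta>. Re (fourier f \<theta> * cnj (fourier g \<theta>)) \<partial>torus) / (4 * pi\<^sup>2)"
proof -
  have "total (\<lambda>x. f x * g x) = (\<Sum>x | g x \<noteq> 0. f x * g x)"
    using assms by (intro total_superset) auto
  then show ?thesis using parseval[OF assms] by simp
qed

subsection \<open>One step of the lazy random walk\<close>

text \<open>The walk rests with probability \<open>1 - e\<close> and moves to each of the four
  neighbours with probability \<open>e / 4\<close>.\<close>

definition walk :: "real \<Rightarrow> (int \<times> int \<Rightarrow> real) \<Rightarrow> int \<times> int \<Rightarrow> real" where
  "walk e f x = f x - e / 4 * neg_laplacian f x"

text \<open>Not a coordinate gradient: it compares the two points of the pair chosen in the first
  half of a step, and is twice the deviation from their mean.\<close>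

definition grad :: "int \<Rightarrow> (int \<times> int \<Rightarrow> real) \<Rightarrow> int \<times> int \<Rightarrow> real" where
  "grad s f x = f (x + (s, 0)) - f (x + (0, s))"

text \<open>The second half of a step, a fair choice within a pair, taken with sign -1. Deviations
  are half the differences, whence the 4.\<close>

lemma bellman_jensen2:
  assumes p: "2 \<le> p"
  shows "bellman p ((x1 + x2) / 2) ((y1 + y2) / 2) - (x1 - x2) * (y1 - y2) / 4
    \<le> (bellman p x1 y1 + bellman p x2 y2) / 2"
proof -
  let ?a = "\<lambda>_::bool. 1 / 2 :: real" and ?h = "\<lambda>b. if b then (x1 - x2) / 2 else (x2 - x1) / 2"
    and ?k = "\<lambda>b. if b then (y1 - y2) / 2 else (y2 - y1) / 2"
  have "bellman p ((x1 + x2) / 2) ((y1 + y2) / 2) + (-1) * (\<Sum>i\<in>UNIV. ?a i * (?h i * ?k i))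
     \<le> (\<Sum>i\<in>UNIV. ?a i * bellman p ((x1 + x2) / 2 + ?h i) ((y1 + y2) / 2 + ?k i))"
    by (rule bellman_jensen[OF p]) (auto simp: UNIV_bool field_simps)
  moreover have "(x1 + x2) / 2 + (x1 - x2) / 2 = x1" "(x1 + x2) / 2 + (x2 - x1) / 2 = x2"
    "(y1 + y2) / 2 + (y1 - y2) / 2 = y1" "(y1 + y2) / 2 + (y2 - y1) / 2 = y2"
    by (simp_all add: field_simps)
  ultimately show ?thesis by (simp add: UNIV_bool field_simps)
qed

text \<open>The first half of a step, taken with sign +1; \<open>x1\<close> and \<open>x2\<close>
  stand for the averages over the two pairs. The bracket is the covariance, as mean of products
  minus product of means.\<close>

lemma bellman_jensen3:
  fixes x0 x1 x2 y0 y1 y2 e :: real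
  assumes p: "2 \<le> p" and e: "0 \<le> e" "e \<le> 1"
  defines "X \<equiv> (1 - e) * x0 + e / 2 * x1 + e / 2 * x2" and "Y \<equiv> (1 - e) * y0 + e / 2 * y1 + e / 2 * y2"
  shows "bellman p X Y + ((1 - e) * (x0 * y0) + e / 2 * (x1 * y1) + e / 2 * (x2 * y2) - X * Y)
    \<le> (1 - e) * bellman p x0 y0 + e / 2 * bellman p x1 y1 + e / 2 * bellman p x2 y2"
proof -
  let ?a = "\<lambda>i::nat. if i = 0 then 1 - e else e / 2"
  let ?x = "\<lambda>i::nat. if i = 0 then x0 else if i = 1 then x1 else x2"
  let ?y = "\<lambda>i::nat. if i = 0 then y0 else if i = 1 then y1 else y2"
  have "bellman p X Y + 1 * (\<Sum>i\<in>{0,1,2}. ?a i * ((?x i - X) * (?y i - Y)))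
     \<le> (\<Sum>i\<in>{0,1,2}. ?a i * bellman p (X + (?x i - X)) (Y + (?y i - Y)))"
    by (rule bellman_jensen[OF p]) (use e in \<open>auto simp: X_def Y_def field_simps\<close>)
  moreover have "(\<Sum>i\<in>{0,1,2::nat}. ?a i * ((?x i - X) * (?y i - Y))) =
     (1 - e) * (x0 * y0) + e / 2 * (x1 * y1) + e / 2 * (x2 * y2)
       - X * ((1 - e) * y0 + e / 2 * y1 + e / 2 * y2) - Y * ((1 - e) * x0 + e / 2 * x1 + e / 2 * x2) + X * Y"
    by (simp add: algebra_simps)
  then have "(\<Sum>i\<in>{0,1,2::nat}. ?a i * ((?x i - X) * (?y i - Y))) =
     (1 - e) * (x0 * y0) + e / 2 * (x1 * y1) + e / 2 * (x2 * y2) - X * Y"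
    unfolding X_def[symmetric] Y_def[symmetric] by simp
  ultimately show ?thesis by simp
qed

text \<open>A step of the walk is split in two: first one of the pairs \<open>{x + e1, x + e2}\<close>,
  \<open>{x - e1, x - e2}\<close> is chosen, then a point of this pair.  The two halves enter the
  transform with opposite signs.\<close>

lemma bellman_step:
  fixes f g :: "int \<times> int \<Rightarrow> real"
  assumes p: "2 \<le> p" and e: "0 \<le> e" "e \<le> 1"
  defines "\<Phi> \<equiv> \<lambda>x. bellman p (f x) (g x)"
  shows "bellman p (walk e f x) (walk e g x) + (walk e (\<lambda>x. f x * g x) x - walk e f x * walk e g x
      - e / 4 * (grad 1 f x * grad 1 g x) - e / 4 * (grad (-1) f x * grad (-1) g x)) \<le> walk e \<Phi> x"
proof -
  define a b a' b' where "a = x + (1, 0)" and "b = x + (0, 1)" and "a' = x + (-1, 0)" and "b' = x + (0, -1)"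
  have W: "walk e h x = (1 - e) * h x + e / 2 * ((h a + h b) / 2) + e / 2 * ((h a' + h b') / 2)" for h
    by (simp add: walk_def neg_laplacian_def a_def b_def a'_def b'_def field_simps)
  let ?f1 = "(f a + f b) / 2" and ?g1 = "(g a + g b) / 2" and ?f2 = "(f a' + f b') / 2" and ?g2 = "(g a' + g b') / 2"
  have 1: "bellman p ?f1 ?g1 - (f a - f b) * (g a - g b) / 4 \<le> (\<Phi> a + \<Phi> b) / 2"
    and 2: "bellman p ?f2 ?g2 - (f a' - f b') * (g a' - g b') / 4 \<le> (\<Phi> a' + \<Phi> b') / 2"
    unfolding \<Phi>_def by (rule bellman_jensen2[OF p])+
  have 3: "bellman p (walk e f x) (walk e g x) +
     ((1 - e) * (f x * g x) + e / 2 * (?f1 * ?g1) + e / 2 * (?f2 * ?g2) - walk e f x * walk e g x)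
     \<le> (1 - e) * \<Phi> x + e / 2 * bellman p ?f1 ?g1 + e / 2 * bellman p ?f2 ?g2"
    unfolding W \<Phi>_def by (rule bellman_jensen3[OF p e])
  have "e / 2 * bellman p ?f1 ?g1 \<le> e / 2 * ((\<Phi> a + \<Phi> b) / 2 + (f a - f b) * (g a - g b) / 4)"
    "e / 2 * bellman p ?f2 ?g2 \<le> e / 2 * ((\<Phi> a' + \<Phi> b') / 2 + (f a' - f b') * (g a' - g b') / 4)"
    using e by (intro mult_left_mono; use 1 2 in linarith)+
  with 3 have 4: "bellman p (walk e f x) (walk e g x) +
     ((1 - e) * (f x * g x) + e / 2 * (?f1 * ?g1) + e / 2 * (?f2 * ?g2) - walk e f x * walk e g x)
     \<le> (1 - e) * \<Phi> x + e / 2 * ((\<Phi> a + \<Phi> b) / 2 + (f a - f b) * (g a - g b) / 4)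
        + e / 2 * ((\<Phi> a' + \<Phi> b') / 2 + (f a' - f b') * (g a' - g b') / 4)" by linarith
  have G: "grad 1 h x = h a - h b" "grad (-1) h x = h a' - h b'" for h
    by (simp_all add: grad_def a_def b_def a'_def b'_def)
  \<comment> \<open>The mean of \<open>f * g\<close> over the step exceeds its mean over the pair
    averages by the covariance of the second half. Removing this twice leaves first half minus
    second half, and gives \<open>e / 4\<close> where the second half alone has
    \<open>e / 8\<close>.\<close>
  have 5: "walk e (\<lambda>x. f x * g x) x - e / 4 * (grad 1 f x * grad 1 g x) - e / 4 * (grad (-1) f x * grad (-1) g x)
    = (1 - e) * (f x * g x) + e / 2 * (?f1 * ?g1) + e / 2 * (?f2 * ?g2)
       - e / 2 * ((f a - f b) * (g a - g b) / 4) - e / 2 * ((f a' - f b') * (g a' - g b') / 4)"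
    unfolding W G by (simp add: field_simps)
  have 6: "walk e \<Phi> x = (1 - e) * \<Phi> x + e / 2 * ((\<Phi> a + \<Phi> b) / 2) + e / 2 * ((\<Phi> a' + \<Phi> b') / 2)"
    by (rule W)
  show ?thesis using 4 5 unfolding 6 by (simp only: distrib_left)
qed

lemma finsupp_walk: "finsupp f \<Longrightarrow> finsupp (walk e f)"
  unfolding walk_def by (intro finsupp_diff finsupp_cmult finsupp_laplacian)

lemma finsupp_grad: "finsupp f \<Longrightarrow> finsupp (grad s f)"
  unfolding grad_def by (intro finsupp_diff finsupp_shift)

section \<open>The Fourier side of the walk\<close>

definition walk_symbol :: "real \<Rightarrow> real \<times> real \<Rightarrow> real" where
  "walk_symbol e \<theta> = 1 - e / 4 * neg_laplacian_symbol \<theta>"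

lemma fourier_walk:
  assumes "finsupp f" shows "fourier (walk e f) \<theta> = of_real (walk_symbol e \<theta>) * fourier f \<theta>"
proof -
  note L = finsupp_laplacian(1)[OF assms]
  have "fourier (walk e f) \<theta> = fourier f \<theta> - of_real (e / 4) * (of_real (neg_laplacian_symbol \<theta>) * fourier f \<theta>)"
    unfolding walk_def [abs_def] fourier_diff[OF assms finsupp_cmult[OF L]] fourier_cmult[OF L]
      fourier_neg_laplacian[OF assms] ..
  then show ?thesis by (simp add: walk_symbol_def algebra_simps)
qed

lemma fourier_grad: "finsupp f \<Longrightarrow> fourier (grad s f) \<theta> = (cis (s * fst \<theta>) - cis (s * snd \<theta>)) * fourier f \<theta>"
  unfolding grad_def [abs_def]
  by (simp add: fourier_diff[OF finsupp_shift finsupp_shift] fourier_shift pairing_def algebra_simps)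

lemma total_walk: "finsupp f \<Longrightarrow> total (walk e f) = total f"
  by (simp add: total_fourier fourier_walk walk_symbol_def neg_laplacian_symbol_cos)

definition spectral :: "(int \<times> int \<Rightarrow> real) \<Rightarrow> (int \<times> int \<Rightarrow> real) \<Rightarrow> real \<times> real \<Rightarrow> real" where
  "spectral f g \<theta> = Re (fourier f \<theta> * cnj (fourier g \<theta>))"

lemma spectral_mult:
  assumes "\<And>\<theta>. fourier f' \<theta> = z \<theta> * fourier f \<theta>" "\<And>\<theta>. fourier g' \<theta> = z \<theta> * fourier g \<theta>"
  shows "spectral f' g' \<theta> = (cmod (z \<theta>))\<^sup>2 * spectral f g \<theta>"
proof -
  have "fourier f' \<theta> * cnj (fourier g' \<theta>) = (z \<theta> * cnj (z \<theta>)) * (fourier f \<theta> * cnj (fourier g \<theta>))"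
    by (simp add: assms)
  also have "z \<theta> * cnj (z \<theta>) = of_real ((cmod (z \<theta>))\<^sup>2)"
    by (simp add: complex_mult_cnj cmod_power2)
  finally show ?thesis by (simp add: spectral_def)
qed

lemma spectral_bounded:
  assumes "finsupp f" "finsupp g" shows "\<exists>K. \<forall>\<theta>. \<bar>spectral f g \<theta>\<bar> \<le> K"
proof -
  obtain A B where A: "\<And>\<theta>. cmod (fourier f \<theta>) \<le> A" and B: "\<And>\<theta>. cmod (fourier g \<theta>) \<le> B"
    using trig_poly_bounded[OF trig_poly_fourier] assms by metis
  have "\<bar>spectral f g \<theta>\<bar> \<le> A * B" for \<theta>
  proof -
    have "\<bar>spectral f g \<theta>\<bar> \<le> cmod (fourier f \<theta> * cnj (fourier g \<theta>))"
      unfolding spectral_def by (rule abs_Re_le_cmod)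
    also have "\<dots> \<le> A * B" unfolding norm_mult complex_mod_cnj
      using A B norm_ge_zero[of "fourier f \<theta>"] by (intro mult_mono) (auto intro: order_trans[OF norm_ge_zero])
    finally show ?thesis .
  qed
  then show ?thesis by blast
qed

lemma spectral_continuous: "finsupp f \<Longrightarrow> finsupp g \<Longrightarrow> continuous_on UNIV (spectral f g)"
  unfolding spectral_def [abs_def]
  by (intro continuous_intros trig_poly_continuous trig_poly_fourier)

lemma spectral_measurable: "finsupp f \<Longrightarrow> finsupp g \<Longrightarrow> spectral f g \<in> borel_measurable torus"
  by (intro continuous_torus spectral_continuous)

lemma total_spectral:
  "finsupp f \<Longrightarrow> finsupp g \<Longrightarrow> total (\<lambda>x. f x * g x) = (\<integral>\<theta>. spectral f g \<theta> \<partial>torus) / (4 * pi\<^sup>2)"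
  unfolding spectral_def by (rule total_parseval)

text \<open>The covariance of the whole step, \<open>1 - (walk_symbol e \<theta>)\<^sup>2\<close>,
  minus twice that of its second half, \<open>e / 4 * diag_symbol \<theta>\<close>.\<close>

definition step_symbol :: "real \<Rightarrow> real \<times> real \<Rightarrow> real" where
  "step_symbol e \<theta> = 1 - (walk_symbol e \<theta>)\<^sup>2 - e / 2 * diag_symbol \<theta>"

lemma integrable_continuous_spectral:
  assumes "finsupp f" "finsupp g" and m: "m \<in> borel_measurable torus" "\<And>\<theta>. \<bar>m \<theta>\<bar> \<le> K"
  shows "integrable torus (\<lambda>\<theta>. m \<theta> * spectral f g \<theta>)"
proof -
  obtain K' where K': "\<And>\<theta>. \<bar>spectral f g \<theta>\<bar> \<le> K'" using spectral_bounded[OF assms(1,2)] by blast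
  note [measurable] = spectral_measurable[OF assms(1,2)] m(1)
  have "0 \<le> K" using order_trans[OF abs_ge_zero m(2)] .
  show ?thesis
    by (rule torus.integrable_const_bound[where B="K * K'"])
       (use m(2) K' \<open>0 \<le> K\<close> in \<open>auto simp: abs_mult intro!: mult_mono\<close>)
qed

text \<open>The Laplacian symbol is at most 8, so \<open>e \<le> 1/4\<close> keeps the walk away
  from -1. For \<open>e > 0\<close> its symbol then has square 1 only where the Laplacian symbol
  vanishes.\<close>

lemma walk_symbol_bounds:
  assumes "0 \<le> e" "e \<le> 1/4" shows "1/2 \<le> walk_symbol e \<theta>" "walk_symbol e \<theta> \<le> 1"
proof -
  have "e * neg_laplacian_symbol \<theta> \<le> 1/4 * 8"
    using assms neg_laplacian_symbol_bounds[of \<theta>] by (intro mult_mono) auto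
  then show "1/2 \<le> walk_symbol e \<theta>" by (simp add: walk_symbol_def)
  show "walk_symbol e \<theta> \<le> 1" using assms neg_laplacian_symbol_bounds[of \<theta>] by (simp add: walk_symbol_def)
qed

lemma walk_symbol_measurable [measurable]: "walk_symbol e \<in> borel_measurable torus"
  unfolding walk_symbol_def [abs_def] by measurable

lemma step_symbol_measurable [measurable]: "step_symbol e \<in> borel_measurable torus"
  unfolding step_symbol_def [abs_def] by measurable

text \<open>5 is 1 + 4: the diagonal term is at most \<open>e\<close> times the Laplacian symbol,
  which is four times \<open>1 - walk_symbol e \<theta>\<close>. Being independent of
  \<open>e\<close>, the bound dominates both of the limits to come.\<close>

lemma step_symbol_bound:
  assumes e: "0 \<le> e" "e \<le> 1/4"
  shows "\<bar>step_symbol e \<theta>\<bar> \<le> 5 * (1 - (walk_symbol e \<theta>)\<^sup>2)"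
proof -
  let ?w = "walk_symbol e \<theta>" and ?s = "neg_laplacian_symbol \<theta>"
  have "1 - ?w\<^sup>2 = (1 - ?w) * (1 + ?w)" by (simp add: power2_eq_square algebra_simps)
  also have "\<dots> \<ge> (1 - ?w) * 1"
    using walk_symbol_bounds[OF e, of \<theta>] by (intro mult_left_mono) auto
  finally have "e / 4 * ?s \<le> 1 - ?w\<^sup>2" by (simp add: walk_symbol_def)
  moreover have "e / 2 * diag_symbol \<theta> \<le> e / 2 * (2 * ?s)" "0 \<le> e / 2 * diag_symbol \<theta>"
    using e diag_symbol_bounds[of \<theta>] by (intro mult_left_mono mult_nonneg_nonneg; simp)+
  moreover have "0 \<le> e * ?s" using e neg_laplacian_symbol_bounds(1)[of \<theta>] by simp
  ultimately show ?thesis unfolding step_symbol_def by (simp add: abs_le_iff)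
qed

lemma bellman_zero: "2 \<le> p \<Longrightarrow> bellman p 0 0 = 0"
  using bellman_nonneg[of p 0 0] bellman_le[of p "p / (p - 1)" 0 0] by (simp add: field_simps)

text \<open>The walk preserves totals, so summing the pointwise step over the lattice gives an
  energy inequality, and Parseval merges the covariance terms into one integral.\<close>

lemma total_bellman_step:
  assumes p: "2 \<le> p" and e: "0 \<le> e" "e \<le> 1/4" and f: "finsupp f" and g: "finsupp g"
  shows "total (\<lambda>x. bellman p (walk e f x) (walk e g x)) +
     (\<integral>\<theta>. step_symbol e \<theta> * spectral f g \<theta> \<partial>torus) / (4 * pi\<^sup>2) \<le> total (\<lambda>x. bellman p (f x) (g x))"
proof -
  let ?P = "walk e"
  let ?L = "\<lambda>x. ?P (\<lambda>x. f x * g x) x - ?P f x * ?P g x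
      - e / 4 * (grad 1 f x * grad 1 g x) - e / 4 * (grad (-1) f x * grad (-1) g x)"
  note fs = f g finsupp_walk[OF f, of e] finsupp_walk[OF g, of e]
  note L1 = finsupp_walk[OF finsupp_mult[OF f, of g], of e]
  note L2 = finsupp_mult[OF fs(3), of "?P g"]
  note L3 = finsupp_cmult[OF finsupp_mult[OF finsupp_grad[OF f, of 1], of "grad 1 g"], of "e/4"]
  note L4 = finsupp_cmult[OF finsupp_mult[OF finsupp_grad[OF f, of "-1"], of "grad (-1) g"], of "e/4"]
  note FL = finsupp_diff[OF finsupp_diff[OF finsupp_diff[OF L1 L2] L3] L4]
  note FB = finsupp_comp2[OF fs(1,2), of "bellman p", OF bellman_zero[OF p]]
  note FB' = finsupp_comp2[OF fs(3,4), of "bellman p", OF bellman_zero[OF p]]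
  have "total (\<lambda>x. bellman p (?P f x) (?P g x) + ?L x) \<le> total (?P (\<lambda>x. bellman p (f x) (g x)))"
    using e by (intro total_mono finsupp_add FB' FL finsupp_walk FB bellman_step p) auto
  then have "total (\<lambda>x. bellman p (?P f x) (?P g x)) + total ?L \<le> total (\<lambda>x. bellman p (f x) (g x))"
    unfolding total_walk[OF FB] total_add[OF FB' FL] .
  moreover have "total ?L = (\<integral>\<theta>. step_symbol e \<theta> * spectral f g \<theta> \<partial>torus) / (4 * pi\<^sup>2)"
  proof -
    have S1: "spectral (?P f) (?P g) \<theta> = (walk_symbol e \<theta>)\<^sup>2 * spectral f g \<theta>" for \<theta>
      using spectral_mult[of "?P f" "\<lambda>\<theta>. of_real (walk_symbol e \<theta>)" f "?P g" g \<theta>] fourier_walk f g by simp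
    have S2: "spectral (grad 1 f) (grad 1 g) \<theta> = diag_symbol \<theta> * spectral f g \<theta>" for \<theta>
      using spectral_mult[of "grad 1 f" "\<lambda>\<theta>. cis (fst \<theta>) - cis (snd \<theta>)" f "grad 1 g" g \<theta>]
      by (simp add: fourier_grad f g cmod_cis_diff diag_symbol_def)
    have S3: "spectral (grad (-1) f) (grad (-1) g) \<theta> = diag_symbol \<theta> * spectral f g \<theta>" for \<theta>
    proof -
      have "(cmod (cis (- fst \<theta>) - cis (- snd \<theta>)))\<^sup>2 = diag_symbol \<theta>"
        unfolding cmod_cis_diff diag_symbol_def by (simp add: cos_diff)
      then show ?thesis
        using spectral_mult[of "grad (-1) f" "\<lambda>\<theta>. cis (- fst \<theta>) - cis (- snd \<theta>)" f "grad (-1) g" g \<theta>]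
        by (simp add: fourier_grad f g)
    qed
    have I: "integrable torus (\<lambda>\<theta>. spectral f g \<theta>)"
      "integrable torus (\<lambda>\<theta>. (walk_symbol e \<theta>)\<^sup>2 * spectral f g \<theta>)"
      "integrable torus (\<lambda>\<theta>. diag_symbol \<theta> * spectral f g \<theta>)"
    proof -
      show "integrable torus (\<lambda>\<theta>. spectral f g \<theta>)"
        using integrable_continuous_spectral[OF f g, of "\<lambda>_. 1" 1] by simp
      show "integrable torus (\<lambda>\<theta>. (walk_symbol e \<theta>)\<^sup>2 * spectral f g \<theta>)"
        by (rule integrable_continuous_spectral[OF f g, where K=1])
           (use walk_symbol_bounds[OF e] in \<open>auto intro!: power_le_one intro: order_trans[of 0 "1/2"]\<close>)
      show "integrable torus (\<lambda>\<theta>. diag_symbol \<theta> * spectral f g \<theta>)"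
        by (rule integrable_continuous_spectral[OF f g, where K=16])
           (use diag_symbol_bounds neg_laplacian_symbol_bounds(2) in \<open>auto simp: abs_le_iff intro: order_trans\<close>, smt (verit))
    qed
    have "total ?L = total (\<lambda>x. f x * g x) - total (\<lambda>x. ?P f x * ?P g x)
       - e / 4 * total (\<lambda>x. grad 1 f x * grad 1 g x) - e / 4 * total (\<lambda>x. grad (-1) f x * grad (-1) g x)"
      unfolding total_diff[OF finsupp_diff[OF finsupp_diff[OF L1 L2] L3] L4]
        total_diff[OF finsupp_diff[OF L1 L2] L3] total_diff[OF L1 L2] total_walk[OF finsupp_mult[OF f]]
        total_cmult[OF finsupp_mult[OF finsupp_grad[OF f]]] ..
    also have "\<dots> = ((\<integral>\<theta>. spectral f g \<theta> \<partial>torus) - (\<integral>\<theta>. (walk_symbol e \<theta>)\<^sup>2 * spectral f g \<theta> \<partial>torus)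
        - e / 2 * (\<integral>\<theta>. diag_symbol \<theta> * spectral f g \<theta> \<partial>torus)) / (4 * pi\<^sup>2)"
      unfolding total_spectral[OF f g] total_spectral[OF fs(3,4)] total_spectral[OF finsupp_grad[OF f] finsupp_grad[OF g]]
        S1 S2 S3 by (simp add: diff_divide_distrib)
    also have "(\<integral>\<theta>. spectral f g \<theta> \<partial>torus) - (\<integral>\<theta>. (walk_symbol e \<theta>)\<^sup>2 * spectral f g \<theta> \<partial>torus)
        - e / 2 * (\<integral>\<theta>. diag_symbol \<theta> * spectral f g \<theta> \<partial>torus) = (\<integral>\<theta>. step_symbol e \<theta> * spectral f g \<theta> \<partial>torus)"
      using I unfolding step_symbol_def left_diff_distrib by (simp add: mult.assoc)
    finally show ?thesis .
  qed
  ultimately show ?thesis by simp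
qed

section \<open>Iteration of the step and its two limits\<close>

lemma finsupp_walk_iter: "finsupp f \<Longrightarrow> finsupp ((walk e ^^ k) f)"
  by (induction k) (auto intro: finsupp_walk)

lemma fourier_walk_iter:
  "finsupp f \<Longrightarrow> fourier ((walk e ^^ k) f) \<theta> = of_real (walk_symbol e \<theta> ^ k) * fourier f \<theta>"
  by (induction k) (simp_all add: fourier_walk[OF finsupp_walk_iter] mult.assoc)

lemma spectral_walk_iter:
  assumes "finsupp f" "finsupp g"
  shows "spectral ((walk e ^^ k) f) ((walk e ^^ k) g) \<theta> = (walk_symbol e \<theta>)\<^sup>2 ^ k * spectral f g \<theta>"
proof -
  have "(cmod (of_real (walk_symbol e \<theta> ^ k)))\<^sup>2 = (walk_symbol e \<theta>)\<^sup>2 ^ k"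
    unfolding norm_of_real power2_abs by (simp add: power_mult[symmetric] mult.commute)
  then show ?thesis
    using spectral_mult[OF fourier_walk_iter[OF assms(1)] fourier_walk_iter[OF assms(2)], where \<theta>=\<theta>] by (simp only:)
qed

text \<open>Telescoping of \<open>total_bellman_step\<close> along the iterates; the last total is
  dropped by \<open>bellman_nonneg\<close>.\<close>

lemma bellman_walk_sum:
  assumes p: "2 \<le> p" and e: "0 \<le> e" "e \<le> 1/4" and f: "finsupp f" and g: "finsupp g"
  shows "(\<integral>\<theta>. (\<Sum>k<N. (walk_symbol e \<theta>)\<^sup>2 ^ k) * step_symbol e \<theta> * spectral f g \<theta> \<partial>torus) / (4 * pi\<^sup>2)
    \<le> total (\<lambda>x. bellman p (f x) (g x))"
proof -
  let ?W = "\<lambda>k. walk e ^^ k"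
  let ?I = "\<lambda>k. (\<integral>\<theta>. step_symbol e \<theta> * ((walk_symbol e \<theta>)\<^sup>2 ^ k * spectral f g \<theta>) \<partial>torus) / (4 * pi\<^sup>2)"
  have "total (\<lambda>x. bellman p (?W N f x) (?W N g x)) + (\<Sum>k<N. ?I k) \<le> total (\<lambda>x. bellman p (f x) (g x))"
  proof (induction N)
    case (Suc N)
    have "total (\<lambda>x. bellman p (?W (Suc N) f x) (?W (Suc N) g x)) + ?I N \<le> total (\<lambda>x. bellman p (?W N f x) (?W N g x))"
      using total_bellman_step[OF p e finsupp_walk_iter[OF f, of N e] finsupp_walk_iter[OF g, of N e]]
      by (simp add: spectral_walk_iter f g)
    with Suc show ?case by simp
  qed simp
  moreover have "0 \<le> total (\<lambda>x. bellman p (?W N f x) (?W N g x))"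
    by (intro total_nonneg bellman_nonneg p)
  moreover have "(\<Sum>k<N. ?I k) = (\<integral>\<theta>. (\<Sum>k<N. (walk_symbol e \<theta>)\<^sup>2 ^ k) * step_symbol e \<theta> * spectral f g \<theta> \<partial>torus) / (4 * pi\<^sup>2)"
  proof -
    have w: "\<bar>walk_symbol e \<theta>\<bar> \<le> 1" for \<theta> using walk_symbol_bounds[OF e, of \<theta>] by simp
    have "integrable torus (\<lambda>\<theta>. (step_symbol e \<theta> * (walk_symbol e \<theta>)\<^sup>2 ^ k) * spectral f g \<theta>)" for k
    proof (rule integrable_continuous_spectral[OF f g, where K=5])
      fix \<theta>
      have "\<bar>step_symbol e \<theta>\<bar> \<le> 5"
        by (rule order_trans[OF step_symbol_bound[OF e]]) simp
      moreover have "(walk_symbol e \<theta>)\<^sup>2 \<le> 1" using w[of \<theta>] by (simp add: abs_square_le_1)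
      then have "\<bar>(walk_symbol e \<theta>)\<^sup>2 ^ k\<bar> \<le> 1" by (simp add: power_le_one)
      ultimately have "\<bar>step_symbol e \<theta>\<bar> * \<bar>(walk_symbol e \<theta>)\<^sup>2 ^ k\<bar> \<le> 5 * 1" by (intro mult_mono) auto
      then show "\<bar>step_symbol e \<theta> * (walk_symbol e \<theta>)\<^sup>2 ^ k\<bar> \<le> 5" by (simp add: abs_mult)
    qed measurable
    then have "(\<integral>\<theta>. (\<Sum>k<N. (step_symbol e \<theta> * (walk_symbol e \<theta>)\<^sup>2 ^ k) * spectral f g \<theta>) \<partial>torus) =
      (\<Sum>k<N. \<integral>\<theta>. (step_symbol e \<theta> * (walk_symbol e \<theta>)\<^sup>2 ^ k) * spectral f g \<theta> \<partial>torus)"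
      by (intro Bochner_Integration.integral_sum) auto
    then show ?thesis
      by (simp add: sum_divide_distrib[symmetric] sum_distrib_left sum_distrib_right mult_ac)
  qed
  ultimately show ?thesis by simp
qed

lemma bellman_limit_N:
  assumes p: "2 \<le> p" and e: "0 < e" "e \<le> 1/4" and f: "finsupp f" and g: "finsupp g"
  shows "(\<integral>\<theta>. step_symbol e \<theta> / (1 - (walk_symbol e \<theta>)\<^sup>2) * spectral f g \<theta> \<partial>torus) / (4 * pi\<^sup>2)
    \<le> total (\<lambda>x. bellman p (f x) (g x))"
proof (rule LIMSEQ_le_const2)
  have e': "0 \<le> e" using e by simp
  have w: "1/2 \<le> walk_symbol e \<theta>" "walk_symbol e \<theta> \<le> 1" for \<theta> using walk_symbol_bounds[OF e' e(2), of \<theta>] by simp_all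
  note [measurable] = spectral_measurable[OF f g]
  have "(\<lambda>N. \<integral>\<theta>. (\<Sum>k<N. (walk_symbol e \<theta>)\<^sup>2 ^ k) * step_symbol e \<theta> * spectral f g \<theta> \<partial>torus)
    \<longlonglongrightarrow> (\<integral>\<theta>. step_symbol e \<theta> / (1 - (walk_symbol e \<theta>)\<^sup>2) * spectral f g \<theta> \<partial>torus)"
  proof (rule integral_dominated_convergence[where w="\<lambda>\<theta>. 5 * \<bar>spectral f g \<theta>\<bar>"])
    show "(\<lambda>\<theta>. step_symbol e \<theta> / (1 - (walk_symbol e \<theta>)\<^sup>2) * spectral f g \<theta>) \<in> borel_measurable torus"
      by measurable
    show "(\<lambda>\<theta>. (\<Sum>k<N. (walk_symbol e \<theta>)\<^sup>2 ^ k) * step_symbol e \<theta> * spectral f g \<theta>) \<in> borel_measurable torus" for N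
      by measurable
    show "integrable torus (\<lambda>\<theta>. 5 * \<bar>spectral f g \<theta>\<bar>)"
      using integrable_continuous_spectral[OF f g, of "\<lambda>_. 1" 1] by simp
    show "AE \<theta> in torus. (\<lambda>N. (\<Sum>k<N. (walk_symbol e \<theta>)\<^sup>2 ^ k) * step_symbol e \<theta> * spectral f g \<theta>)
        \<longlonglongrightarrow> step_symbol e \<theta> / (1 - (walk_symbol e \<theta>)\<^sup>2) * spectral f g \<theta>"
      using AE_neg_laplacian_symbol
    proof eventually_elim
      case (elim \<theta>)
      then have "walk_symbol e \<theta> < 1" using e by (simp add: walk_symbol_def)
      then have "(walk_symbol e \<theta>)\<^sup>2 < 1" using w[of \<theta>] by (simp add: power_less_one_iff abs_square_less_1)
      then have "(\<lambda>k. (walk_symbol e \<theta>)\<^sup>2 ^ k) sums (1 / (1 - (walk_symbol e \<theta>)\<^sup>2))"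
        by (intro geometric_sums) simp
      then have "(\<lambda>N. (\<Sum>k<N. (walk_symbol e \<theta>)\<^sup>2 ^ k) * step_symbol e \<theta> * spectral f g \<theta>) \<longlonglongrightarrow>
        1 / (1 - (walk_symbol e \<theta>)\<^sup>2) * step_symbol e \<theta> * spectral f g \<theta>"
        unfolding sums_def by (intro tendsto_mult tendsto_const)
      then show ?case by simp
    qed
    show "AE \<theta> in torus. norm ((\<Sum>k<N. (walk_symbol e \<theta>)\<^sup>2 ^ k) * step_symbol e \<theta> * spectral f g \<theta>) \<le> 5 * \<bar>spectral f g \<theta>\<bar>" for N
    proof (rule AE_I2)
      fix \<theta>
      let ?q = "(walk_symbol e \<theta>)\<^sup>2"
      have q: "0 \<le> ?q" "?q \<le> 1" using w[of \<theta>] by (auto intro!: power_le_one)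
      have S: "0 \<le> (\<Sum>k<N. ?q ^ k)" using q by (intro sum_nonneg) auto
      have "(\<Sum>k<N. ?q ^ k) * \<bar>step_symbol e \<theta>\<bar> \<le> (\<Sum>k<N. ?q ^ k) * (5 * (1 - ?q))"
        by (intro mult_left_mono step_symbol_bound e' e S)
      \<comment> \<open>The factor \<open>1 - ?q\<close> from the step cancels the geometric sum, so
        the domination is uniform in \<open>N\<close> although the sum alone equals \<open>N\<close>
        at the origin.\<close>
      also have "\<dots> = 5 * (1 - ?q ^ N)"
        using one_diff_power_eq[of ?q N] by (simp add: mult_ac)
      also have "\<dots> \<le> 5" using q by simp
      finally have "(\<Sum>k<N. ?q ^ k) * \<bar>step_symbol e \<theta>\<bar> * \<bar>spectral f g \<theta>\<bar> \<le> 5 * \<bar>spectral f g \<theta>\<bar>"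
        by (intro mult_right_mono) auto
      then show "norm ((\<Sum>k<N. ?q ^ k) * step_symbol e \<theta> * spectral f g \<theta>) \<le> 5 * \<bar>spectral f g \<theta>\<bar>"
        using S by (simp add: abs_mult)
    qed
  qed
  then show "(\<lambda>N. (\<integral>\<theta>. (\<Sum>k<N. (walk_symbol e \<theta>)\<^sup>2 ^ k) * step_symbol e \<theta> * spectral f g \<theta> \<partial>torus) / (4 * pi\<^sup>2))
    \<longlonglongrightarrow> (\<integral>\<theta>. step_symbol e \<theta> / (1 - (walk_symbol e \<theta>)\<^sup>2) * spectral f g \<theta> \<partial>torus) / (4 * pi\<^sup>2)"
    by (rule tendsto_divide[OF _ tendsto_const]) simp
  show "\<exists>N. \<forall>n\<ge>N. (\<integral>\<theta>. (\<Sum>k<n. (walk_symbol e \<theta>)\<^sup>2 ^ k) * step_symbol e \<theta> * spectral f g \<theta> \<partial>torus) / (4 * pi\<^sup>2)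
    \<le> total (\<lambda>x. bellman p (f x) (g x))"
    using bellman_walk_sum[OF p e' e(2) f g] by blast
qed

lemma bellman_bound:
  assumes p: "2 \<le> p" and f: "finsupp f" and g: "finsupp g"
  shows "total (\<lambda>x. beurling_ahlfors_im f x * g x) \<le> total (\<lambda>x. bellman p (f x) (g x))"
proof -
  note [measurable] = spectral_measurable[OF f g]
  define e where "e = (\<lambda>n. 1 / (4 * real (Suc n)))"
  have e: "0 < e n" "e n \<le> 1/4" for n by (auto simp: e_def field_simps)
  have elim0: "e \<longlonglongrightarrow> 0"
  proof -
    have "(\<lambda>n. 1/4 * inverse (real (Suc n))) \<longlonglongrightarrow> 1/4 * 0"
      by (intro tendsto_intros LIMSEQ_inverse_real_of_nat)
    then show ?thesis by (simp add: e_def inverse_eq_divide)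
  qed
  have "(\<lambda>n. \<integral>\<theta>. step_symbol (e n) \<theta> / (1 - (walk_symbol (e n) \<theta>)\<^sup>2) * spectral f g \<theta> \<partial>torus)
    \<longlonglongrightarrow> (\<integral>\<theta>. ba_symbol \<theta> * spectral f g \<theta> \<partial>torus)"
  proof (rule integral_dominated_convergence[where w="\<lambda>\<theta>. 5 * \<bar>spectral f g \<theta>\<bar>"])
    show "(\<lambda>\<theta>. ba_symbol \<theta> * spectral f g \<theta>) \<in> borel_measurable torus"
      by measurable
    show "(\<lambda>\<theta>. step_symbol (e n) \<theta> / (1 - (walk_symbol (e n) \<theta>)\<^sup>2) * spectral f g \<theta>) \<in> borel_measurable torus" for n
      by measurable
    show "integrable torus (\<lambda>\<theta>. 5 * \<bar>spectral f g \<theta>\<bar>)"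
      using integrable_continuous_spectral[OF f g, of "\<lambda>_. 1" 1] by simp
    show "AE \<theta> in torus. (\<lambda>n. step_symbol (e n) \<theta> / (1 - (walk_symbol (e n) \<theta>)\<^sup>2) * spectral f g \<theta>)
        \<longlonglongrightarrow> ba_symbol \<theta> * spectral f g \<theta>"
      using AE_neg_laplacian_symbol
    proof eventually_elim
      case (elim \<theta>)
      let ?s = "neg_laplacian_symbol \<theta>" and ?d = "diag_symbol \<theta>"
      \<comment> \<open>\<open>1 - w^2\<close> is \<open>e / 2 * (s - e * s^2 / 8)\<close>; its last
        term is the only trace of discrete time and vanishes with \<open>e\<close>.\<close>
      have eq: "step_symbol (e n) \<theta> / (1 - (walk_symbol (e n) \<theta>)\<^sup>2) = 1 - ?d / (?s - e n * ?s\<^sup>2 / 8)" for n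
      proof -
        have w: "1 - (walk_symbol (e n) \<theta>)\<^sup>2 = e n / 2 * (?s - e n * ?s\<^sup>2 / 8)"
          by (simp add: walk_symbol_def power2_eq_square field_simps)
        have "walk_symbol (e n) \<theta> < 1" using elim e[of n] by (simp add: walk_symbol_def)
        then have "(walk_symbol (e n) \<theta>)\<^sup>2 < 1"
          using walk_symbol_bounds[of "e n" \<theta>] e[of n] by (simp add: power_less_one_iff abs_square_less_1)
        then have nz: "1 - (walk_symbol (e n) \<theta>)\<^sup>2 \<noteq> 0" by simp
        have "step_symbol (e n) \<theta> / (1 - (walk_symbol (e n) \<theta>)\<^sup>2) = 1 - (e n / 2 * ?d) / (1 - (walk_symbol (e n) \<theta>)\<^sup>2)"
          using nz by (simp add: step_symbol_def diff_divide_distrib)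
        also have "\<dots> = 1 - ?d / (?s - e n * ?s\<^sup>2 / 8)"
          unfolding w using e[of n] by simp
        finally show ?thesis .
      qed
      have "(\<lambda>n. 1 - ?d / (?s - e n * ?s\<^sup>2 / 8)) \<longlonglongrightarrow> 1 - ?d / (?s - 0 * ?s\<^sup>2 / 8)"
        using elim by (intro tendsto_intros elim0) auto
      then have "(\<lambda>n. (1 - ?d / (?s - e n * ?s\<^sup>2 / 8)) * spectral f g \<theta>) \<longlonglongrightarrow> (1 - ?d / (?s - 0 * ?s\<^sup>2 / 8)) * spectral f g \<theta>"
        by (intro tendsto_mult tendsto_const)
      then show ?case unfolding eq by (simp add: ba_symbol_def)
    qed
    show "AE \<theta> in torus. norm (step_symbol (e n) \<theta> / (1 - (walk_symbol (e n) \<theta>)\<^sup>2) * spectral f g \<theta>) \<le> 5 * \<bar>spectral f g \<theta>\<bar>" for n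
    proof (rule AE_I2)
      fix \<theta>
      let ?w = "1 - (walk_symbol (e n) \<theta>)\<^sup>2"
      have "\<bar>step_symbol (e n) \<theta>\<bar> \<le> 5 * ?w" using step_symbol_bound[of "e n" \<theta>] e[of n] by simp
      then have "\<bar>step_symbol (e n) \<theta> / ?w\<bar> \<le> 5"
        by (cases "?w = 0") (auto simp: abs_divide divide_le_eq)
      then show "norm (step_symbol (e n) \<theta> / ?w * spectral f g \<theta>) \<le> 5 * \<bar>spectral f g \<theta>\<bar>"
        unfolding real_norm_def abs_mult by (intro mult_right_mono) auto
    qed
  qed
  then have "(\<lambda>n. (\<integral>\<theta>. step_symbol (e n) \<theta> / (1 - (walk_symbol (e n) \<theta>)\<^sup>2) * spectral f g \<theta> \<partial>torus) / (4 * pi\<^sup>2))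
    \<longlonglongrightarrow> (\<integral>\<theta>. ba_symbol \<theta> * spectral f g \<theta> \<partial>torus) / (4 * pi\<^sup>2)"
    by (rule tendsto_divide[OF _ tendsto_const]) simp
  then have "(\<integral>\<theta>. ba_symbol \<theta> * spectral f g \<theta> \<partial>torus) / (4 * pi\<^sup>2) \<le> total (\<lambda>x. bellman p (f x) (g x))"
    by (rule LIMSEQ_le_const2) (use bellman_limit_N[OF p e f g] in blast)
  moreover have "(\<integral>\<theta>. ba_symbol \<theta> * spectral f g \<theta> \<partial>torus) / (4 * pi\<^sup>2) =
     (\<Sum>x | g x \<noteq> 0. beurling_ahlfors_im f x * g x)"
    unfolding beurling_ahlfors_im_fourier[OF f] spectral_def
    by (rule multiplier_form[OF f g _ ba_symbol_bound, symmetric]) measurable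
  moreover have "total (\<lambda>x. beurling_ahlfors_im f x * g x) = (\<Sum>x | g x \<noteq> 0. beurling_ahlfors_im f x * g x)"
    using g by (intro total_superset) auto
  ultimately show ?thesis by simp
qed

lemma dual_bound:
  assumes p: "2 \<le> p" "1 / p + 1 / q = 1" and f: "finsupp f" and g: "finsupp g"
  shows "total (\<lambda>x. beurling_ahlfors_im f x * g x) \<le>
    (p - 1) powr p * total (\<lambda>x. \<bar>f x\<bar> powr p) / p + total (\<lambda>x. \<bar>g x\<bar> powr q) / q"
proof -
  have ff: "finsupp (\<lambda>x. \<bar>f x\<bar> powr p)" and gg: "finsupp (\<lambda>x. \<bar>g x\<bar> powr q)"
    using f g by (auto elim: finite_subset[rotated])
  note F = finsupp_cmult[OF ff, of "(p - 1) powr p / p"] and G = finsupp_cmult[OF gg, of "1 / q"]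
  have "total (\<lambda>x. bellman p (f x) (g x)) \<le> total (\<lambda>x. (p - 1) powr p / p * \<bar>f x\<bar> powr p + 1 / q * \<bar>g x\<bar> powr q)"
  proof (rule total_mono[OF finsupp_comp2[OF f g, of "bellman p", OF bellman_zero[OF p(1)]] finsupp_add[OF F G]])
    fix x show "bellman p (f x) (g x) \<le> (p - 1) powr p / p * \<bar>f x\<bar> powr p + 1 / q * \<bar>g x\<bar> powr q"
      using bellman_le[OF p, of "f x" "g x"] p by (simp add: powr_mult)
  qed
  also have "\<dots> = (p - 1) powr p * total (\<lambda>x. \<bar>f x\<bar> powr p) / p + total (\<lambda>x. \<bar>g x\<bar> powr q) / q"
    unfolding total_add[OF F G] total_cmult[OF ff] total_cmult[OF gg] by simp
  finally show ?thesis using bellman_bound[OF p(1) f g] by simp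
qed

subsection \<open>The bound on finitely supported functions\<close>

lemma total_sym:
  assumes f: "finsupp f" and g: "finsupp g"
  shows "total (\<lambda>x. beurling_ahlfors_im f x * g x) = total (\<lambda>x. beurling_ahlfors_im g x * f x)"
proof -
  have *: "total (\<lambda>x. beurling_ahlfors_im f x * g x) = (\<Sum>x | g x \<noteq> 0. \<Sum>y | f y \<noteq> 0. f y * ba_kernel (x - y) * g x)"
    if "finsupp f" "finsupp g" for f g
  proof -
    have "total (\<lambda>x. beurling_ahlfors_im f x * g x) = (\<Sum>x | g x \<noteq> 0. beurling_ahlfors_im f x * g x)"
      using that by (intro total_superset) auto
    then show ?thesis by (simp add: beurling_ahlfors_im_kernel that sum_distrib_right)
  qed
  have "ba_kernel (x - y) = ba_kernel (y - x)" for x y using ba_kernel_minus[of "x - y"] by simp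
  then show ?thesis unfolding *[OF f g] *[OF g f]
    by (subst sum.swap) (simp add: mult_ac)
qed

lemma conjugate_exponent:
  fixes p :: real assumes "1 < p"
  defines "q \<equiv> p / (p - 1)"
  shows "1 < q" "1 / p + 1 / q = 1" "(p - 1) * q = p" "(q - 1) * p = q" "q - 1 = 1 / (p - 1)" "(q - 1) * (p - 1) = 1"
  using assms by (auto simp: q_def field_simps)

text \<open>The function at which Hoelder's inequality for \<open>h\<close> is an equality, cut off
  to \<open>S\<close> because the image of a finitely supported function need not be finitely
  supported.\<close>

definition duality_map :: "real \<Rightarrow> (int \<times> int) set \<Rightarrow> (int \<times> int \<Rightarrow> real) \<Rightarrow> int \<times> int \<Rightarrow> real" where
  "duality_map p S h x = (if x \<in> S then sgn (h x) * \<bar>h x\<bar> powr (p - 1) else 0)"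

lemma duality_map_properties:
  assumes p: "1 < p" and S: "finite S"
  shows "finsupp (duality_map p S h)"
    "total (\<lambda>x. h x * duality_map p S h x) = (\<Sum>x\<in>S. \<bar>h x\<bar> powr p)"
    "total (\<lambda>x. \<bar>duality_map p S h x\<bar> powr (p / (p - 1))) = (\<Sum>x\<in>S. \<bar>h x\<bar> powr p)"
proof -
  show "finsupp (duality_map p S h)"
    by (rule finite_subset[OF _ S]) (auto simp: duality_map_def)
  have "h x * (sgn (h x) * \<bar>h x\<bar> powr (p - 1)) = \<bar>h x\<bar> powr p" for x
  proof (cases "h x = 0")
    case False
    then have "\<bar>h x\<bar> powr p = \<bar>h x\<bar> * \<bar>h x\<bar> powr (p - 1)" using powr_add[of "\<bar>h x\<bar>" 1 "p - 1"] by simp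
    moreover have "h x * sgn (h x) = \<bar>h x\<bar>" by (simp add: abs_sgn)
    ultimately show ?thesis by (simp only: mult.assoc[symmetric])
  qed simp
  moreover have "total (\<lambda>x. h x * duality_map p S h x) = (\<Sum>x\<in>S. h x * duality_map p S h x)"
    by (intro total_superset S) (auto simp: duality_map_def)
  ultimately show "total (\<lambda>x. h x * duality_map p S h x) = (\<Sum>x\<in>S. \<bar>h x\<bar> powr p)"
    by (simp add: duality_map_def cong: sum.cong)
  have "\<bar>sgn (h x) * \<bar>h x\<bar> powr (p - 1)\<bar> powr (p / (p - 1)) = \<bar>h x\<bar> powr p" for x
    using p by (cases "h x = 0") (auto simp: abs_mult powr_powr abs_sgn_eq)
  moreover have "total (\<lambda>x. \<bar>duality_map p S h x\<bar> powr (p / (p - 1))) = (\<Sum>x\<in>S. \<bar>duality_map p S h x\<bar> powr (p / (p - 1)))"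
    by (intro total_superset S) (auto simp: duality_map_def)
  ultimately show "total (\<lambda>x. \<bar>duality_map p S h x\<bar> powr (p / (p - 1))) = (\<Sum>x\<in>S. \<bar>h x\<bar> powr p)"
    by (simp add: duality_map_def cong: sum.cong)
qed

lemma finsupp_mult': "finsupp g \<Longrightarrow> finsupp (\<lambda>x. f x * g x)"
  by (rule finite_subset[of _ "{x. g x \<noteq> 0}"]) auto

lemma finsupp_powr: "finsupp f \<Longrightarrow> finsupp (\<lambda>x. \<bar>f x\<bar> powr p)"
  by (rule finite_subset[of _ "{x. f x \<noteq> 0}"]) auto

text \<open>Testing with the duality map of the image makes the \<open>g\<close> term of
  \<open>dual_bound\<close> equal to \<open>1 / q\<close> times the left side. It can be absorbed,
  and the factors \<open>1 / p\<close> that remain on both sides cancel.\<close>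

lemma finite_bound_ge2:
  assumes p: "2 \<le> p" and f: "finsupp f" and S: "finite S"
  shows "(\<Sum>x\<in>S. \<bar>beurling_ahlfors_im f x\<bar> powr p) \<le> (p - 1) powr p * total (\<lambda>x. \<bar>f x\<bar> powr p)"
proof -
  have p1: "1 < p" using p by simp
  let ?T = "\<Sum>x\<in>S. \<bar>beurling_ahlfors_im f x\<bar> powr p" and ?F = "(p - 1) powr p * total (\<lambda>x. \<bar>f x\<bar> powr p)"
  note c = conjugate_exponent[OF p1]
  have "?T \<le> ?F / p + ?T / (p / (p - 1))"
    using dual_bound[OF p c(2) f duality_map_properties(1)[OF p1 S, of "beurling_ahlfors_im f"]]
    unfolding duality_map_properties(2,3)[OF p1 S] .
  also have "?T / (p / (p - 1)) = ?T * (1 / (p / (p - 1)))" by simp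
  also have "1 / (p / (p - 1)) = 1 - 1 / p" using c(2) by linarith
  finally have "?T / p \<le> ?F / p" by (simp add: algebra_simps)
  then show ?thesis using p by (simp add: divide_le_cancel)
qed

text \<open>Symmetry moves the operator to the test function, to which \<open>dual_bound\<close> for
  the conjugate exponent \<open>q \<ge> 2\<close> applies.\<close>

lemma finite_bound_le2:
  assumes p: "1 < p" "p \<le> 2" and f: "finsupp f" and S: "finite S"
  shows "(\<Sum>x\<in>S. \<bar>beurling_ahlfors_im f x\<bar> powr p) \<le> (1 / (p - 1)) powr p * total (\<lambda>x. \<bar>f x\<bar> powr p)"
proof -
  define q where "q = p / (p - 1)"
  note c = conjugate_exponent[OF p(1), folded q_def]
  have q: "2 \<le> q" using p by (simp add: q_def field_simps)
  let ?B = "beurling_ahlfors_im f"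
  let ?T = "\<Sum>x\<in>S. \<bar>?B x\<bar> powr p" and ?F = "total (\<lambda>x. \<bar>f x\<bar> powr p)"
  \<comment> \<open>Solves \<open>(q - 1) powr q * s powr q = s\<close>, so that the term with the
    test function can again be absorbed.\<close>
  define s where "s = (q - 1) powr (- p)"
  have s: "0 < s" using c(1) by (simp add: s_def)
  let ?h = "duality_map p S ?B"
  note h = duality_map_properties[OF p(1) S, of ?B, folded q_def]
  let ?g = "\<lambda>x. s * ?h x"
  have g: "finsupp ?g" by (intro finsupp_cmult h)
  have "s * ?T = total (\<lambda>x. s * (?B x * ?h x))"
    unfolding h(2)[symmetric] by (rule total_cmult[symmetric, OF finsupp_mult'[OF h(1)]])
  also have "\<dots> = total (\<lambda>x. beurling_ahlfors_im ?g x * f x)"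
    unfolding total_sym[OF g f] by (simp add: mult_ac)
  also have "\<dots> \<le> (q - 1) powr q * total (\<lambda>x. \<bar>?g x\<bar> powr q) / q + ?F / p"
    using c(2) by (intro dual_bound q g f) simp
  also have "total (\<lambda>x. \<bar>?g x\<bar> powr q) = s powr q * ?T"
    using s total_cmult[OF finsupp_powr[OF h(1), of q], of "s powr q"]
    unfolding h(3) by (simp add: abs_mult powr_mult)
  also have "(q - 1) powr q * (s powr q * ?T) = s * ?T"
  proof -
    have "q + - (p * q) = - p" using c(3) by (simp add: algebra_simps)
    then have "(q - 1) powr q * s powr q = s"
      unfolding s_def powr_powr using powr_add[of "q - 1" q "- (p * q)"] by simp
    then show ?thesis by (simp add: mult.assoc[symmetric])
  qed
  also have "s * ?T / q = s * ?T - s * ?T / p"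
  proof -
    have "1 / q = 1 - 1 / p" using c(2) by simp
    then have "s * ?T * (1 / q) = s * ?T * (1 - 1 / p)" by simp
    then show ?thesis by (simp add: right_diff_distrib)
  qed
  finally have "s * ?T / p \<le> ?F / p" by linarith
  then have "s * ?T \<le> ?F" using p by (simp add: divide_le_cancel)
  moreover have "s * (q - 1) powr p = 1" using c(1) unfolding s_def by (simp flip: powr_add)
  ultimately have "?T \<le> (q - 1) powr p * ?F"
  proof -
    have "(q - 1) powr p * (s * ?T) = s * (q - 1) powr p * ?T" by (simp only: mult_ac)
    then have "?T = (q - 1) powr p * (s * ?T)" unfolding \<open>s * (q - 1) powr p = 1\<close> by simp
    also have "\<dots> \<le> (q - 1) powr p * ?F" using \<open>s * ?T \<le> ?F\<close> by (intro mult_left_mono) auto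
    finally show ?thesis .
  qed
  then show ?thesis using c(5) by simp
qed

definition sharp_const :: "real \<Rightarrow> real" where
  "sharp_const p = max (p - 1) (1 / (p - 1))"

lemma sharp_const_pos: "1 < p \<Longrightarrow> 0 < sharp_const p"
  by (auto simp: sharp_const_def less_max_iff_disj)

lemma finite_bound:
  assumes p: "1 < p" and f: "finsupp f" and S: "finite S"
  shows "(\<Sum>x\<in>S. \<bar>beurling_ahlfors_im f x\<bar> powr p) \<le> sharp_const p powr p * total (\<lambda>x. \<bar>f x\<bar> powr p)"
proof (cases "2 \<le> p")
  case True
  show ?thesis
    by (rule order_trans[OF finite_bound_ge2[OF True f S]])
       (use p in \<open>auto intro!: mult_right_mono powr_mono2 total_nonneg simp: sharp_const_def\<close>)
next
  case False
  then have "p \<le> 2" by simp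
  show ?thesis
    by (rule order_trans[OF finite_bound_le2[OF p \<open>p \<le> 2\<close> f S]])
       (use p in \<open>auto intro!: mult_right_mono powr_mono2 total_nonneg simp: sharp_const_def\<close>)
qed

subsection \<open>Extension to \<open>\<ell>\<^sup>p\<close>\<close>

lemma lp_iff: "f \<in> lp p \<longleftrightarrow> (\<lambda>x. \<bar>f x\<bar> powr p) summable_on UNIV"
  by (simp add: lp_def)

lemma lp_bounded:
  assumes "\<And>S. finite S \<Longrightarrow> (\<Sum>x\<in>S. \<bar>f x\<bar> powr p) \<le> M"
  shows "f \<in> lp p" "(\<Sum>\<^sub>\<infinity>x. \<bar>f x\<bar> powr p) \<le> M"
proof -
  show *: "f \<in> lp p" unfolding lp_iff
    by (rule nonneg_bdd_above_summable_on) (auto intro!: bdd_aboveI2[of _ _ M] assms)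
  show "(\<Sum>\<^sub>\<infinity>x. \<bar>f x\<bar> powr p) \<le> M"
    using * unfolding lp_iff by (rule infsum_le_finite_sums) (use assms in auto)
qed

lemma finite_sum_le_lp:
  "f \<in> lp p \<Longrightarrow> finite S \<Longrightarrow> (\<Sum>x\<in>S. \<bar>f x\<bar> powr p) \<le> (\<Sum>\<^sub>\<infinity>x. \<bar>f x\<bar> powr p)"
  unfolding lp_iff by (rule finite_sum_le_infsum) auto

lemma infsum_finsupp: "finsupp f \<Longrightarrow> (\<Sum>\<^sub>\<infinity>x. f x) = total f" "finsupp f \<Longrightarrow> f summable_on UNIV"
proof -
  assume f: "finsupp f"
  show "f summable_on UNIV"
    using summable_on_finite[OF f, of f] by (rule summable_on_cong_neutral[THEN iffD1, rotated -1]) auto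
  have "(\<Sum>\<^sub>\<infinity>x. f x) = (\<Sum>\<^sub>\<infinity>x\<in>{x. f x \<noteq> 0}. f x)"
    by (rule infsum_cong_neutral) auto
  then show "(\<Sum>\<^sub>\<infinity>x. f x) = total f" using f by (simp add: total_def)
qed

lemma finsupp_lp: "finsupp f \<Longrightarrow> f \<in> lp p"
  unfolding lp_iff by (intro infsum_finsupp(2) finsupp_powr)

lemma lp_norm_nonneg: "0 \<le> lp_norm p f"
  by (simp add: lp_norm_def)

lemma lp_norm_powr: "1 < p \<Longrightarrow> lp_norm p f powr p = (\<Sum>\<^sub>\<infinity>x. \<bar>f x\<bar> powr p)"
  by (simp add: lp_norm_def powr_powr infsum_nonneg)

lemma lp_norm_le_iff:
  assumes p: "1 < p" and "0 \<le> C"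
  shows "lp_norm p f \<le> C * lp_norm p g \<longleftrightarrow> (\<Sum>\<^sub>\<infinity>x. \<bar>f x\<bar> powr p) \<le> C powr p * (\<Sum>\<^sub>\<infinity>x. \<bar>g x\<bar> powr p)"
proof -
  have "lp_norm p f \<le> C * lp_norm p g \<longleftrightarrow> lp_norm p f powr p \<le> (C * lp_norm p g) powr p"
  proof
    show "lp_norm p f powr p \<le> (C * lp_norm p g) powr p" if "lp_norm p f \<le> C * lp_norm p g"
      using that p lp_norm_nonneg[of p f] by (intro powr_mono2) auto
    show "lp_norm p f \<le> C * lp_norm p g" if "lp_norm p f powr p \<le> (C * lp_norm p g) powr p"
    proof (rule ccontr)
      assume "\<not> ?thesis"
      then have "(C * lp_norm p g) powr p < lp_norm p f powr p"
        using p \<open>0 \<le> C\<close> lp_norm_nonneg[of p g] by (intro powr_less_mono2) auto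
      with that show False by simp
    qed
  qed
  then show ?thesis using assms lp_norm_nonneg[of p g] by (simp add: powr_mult lp_norm_powr)
qed

lemma abs_le_lp_norm:
  assumes p: "1 < p" and "f \<in> lp p" shows "\<bar>f x\<bar> \<le> lp_norm p f"
proof -
  have "\<bar>f x\<bar> powr p \<le> (\<Sum>\<^sub>\<infinity>x. \<bar>f x\<bar> powr p)" using finite_sum_le_lp[OF assms(2), of "{x}"] by simp
  then have "(\<bar>f x\<bar> powr p) powr (1 / p) \<le> lp_norm p f"
    unfolding lp_norm_def using p by (intro powr_mono2) auto
  then show ?thesis using p by (simp add: powr_powr)
qed

lemma lp_add:
  assumes p: "1 < p" and f: "f \<in> lp p" and g: "g \<in> lp p" shows "(\<lambda>x. f x + g x) \<in> lp p"
proof -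
  have "\<bar>f x + g x\<bar> powr p \<le> 2 powr p * (\<bar>f x\<bar> powr p + \<bar>g x\<bar> powr p)" for x
  proof -
    have "\<bar>f x + g x\<bar> powr p \<le> (2 * max \<bar>f x\<bar> \<bar>g x\<bar>) powr p"
      using p by (intro powr_mono2) auto
    also have "\<dots> = 2 powr p * max \<bar>f x\<bar> \<bar>g x\<bar> powr p" by (simp add: powr_mult)
    also have "\<dots> \<le> 2 powr p * (\<bar>f x\<bar> powr p + \<bar>g x\<bar> powr p)"
      by (intro mult_left_mono) (auto simp: max_def)
    finally show ?thesis .
  qed
  moreover have "(\<lambda>x. 2 powr p * (\<bar>f x\<bar> powr p + \<bar>g x\<bar> powr p)) summable_on UNIV"
    using f g unfolding lp_iff by (intro summable_on_cmult_right summable_on_add)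
  ultimately show ?thesis unfolding lp_iff
    by - (rule summable_on_comparison_test, assumption, auto)
qed

lemma lp_cmult: "f \<in> lp p \<Longrightarrow> (\<lambda>x. c * f x) \<in> lp p"
  unfolding lp_iff by (simp add: abs_mult powr_mult summable_on_cmult_right)

text \<open>The kernel is the image of a point mass, so its summability is an instance of the bound
  on finitely supported functions and takes no decay estimate.\<close>

lemma ba_kernel_lq:
  assumes q: "1 < q" shows "ba_kernel \<in> lp q"
proof -
  define d :: "int \<times> int \<Rightarrow> real" where "d = (\<lambda>y. if y = 0 then 1 else 0)"
  have supp: "{y. d y \<noteq> 0} = {0}" by (auto simp: d_def)
  then have d: "finsupp d" by simp
  have "beurling_ahlfors_im d = ba_kernel"
    by (intro ext) (simp add: beurling_ahlfors_im_kernel[OF d] supp, simp add: d_def)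
  then show ?thesis using lp_bounded(1)[OF finite_bound[OF q d]] by simp
qed

lemma kernel_summable:
  assumes p: "1 < p" and f: "f \<in> lp p"
  shows "(\<lambda>y. f y * ba_kernel (x - y)) summable_on UNIV"
proof -
  define q where "q = p / (p - 1)"
  note c = conjugate_exponent[OF p, folded q_def]
  have "(\<lambda>y. \<bar>ba_kernel y\<bar> powr q) summable_on UNIV" using ba_kernel_lq[OF c(1)] by (simp add: lp_iff)
  then have "(\<lambda>y. \<bar>ba_kernel (x - y)\<bar> powr q) summable_on UNIV"
    by (rule summable_on_reindex_bij_betw[THEN iffD2, of "\<lambda>y. x - y" UNIV UNIV "\<lambda>y. \<bar>ba_kernel y\<bar> powr q", rotated])
       (rule bij_betw_byWitness[where f'="\<lambda>y. x - y"]; simp)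
  then have s: "(\<lambda>y. \<bar>f y\<bar> powr p / p + \<bar>ba_kernel (x - y)\<bar> powr q / q) summable_on UNIV"
    using f unfolding lp_iff divide_inverse by (intro summable_on_add summable_on_cmult_left)
  have "(\<lambda>y. \<bar>f y * ba_kernel (x - y)\<bar>) summable_on UNIV"
  proof (rule summable_on_comparison_test[OF s])
    fix y show "\<bar>f y * ba_kernel (x - y)\<bar> \<le> \<bar>f y\<bar> powr p / p + \<bar>ba_kernel (x - y)\<bar> powr q / q"
      unfolding abs_mult using p c by (intro Youngs_inequality) auto
  qed auto
  then show ?thesis by - (rule abs_summable_summable, simp)
qed

text \<open>Convolution with the kernel, which converges on \<open>lp p\<close> because the kernel
  is summable with the conjugate exponent. The value 0 elsewhere is the one prescribed by
  \<open>is_lp_extension\<close>.\<close>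

definition ba_extension :: "real \<Rightarrow> (int \<times> int \<Rightarrow> real) \<Rightarrow> int \<times> int \<Rightarrow> real" where
  "ba_extension p f x = (if f \<in> lp p then \<Sum>\<^sub>\<infinity>y. f y * ba_kernel (x - y) else 0)"

lemma ba_extension_finsupp:
  assumes f: "finsupp f" shows "ba_extension p f = beurling_ahlfors_im f"
proof
  fix x
  have "(\<Sum>\<^sub>\<infinity>y. f y * ba_kernel (x - y)) = (\<Sum>y | f y \<noteq> 0. f y * ba_kernel (x - y))"
    using infsum_finsupp(1)[OF finsupp_mult[OF f]] total_superset[OF f, of "\<lambda>y. f y * ba_kernel (x - y)"] by auto
  then show "ba_extension p f x = beurling_ahlfors_im f x"
    by (simp add: ba_extension_def finsupp_lp f beurling_ahlfors_im_kernel)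
qed

text \<open>The images of the finite truncations of \<open>f\<close> converge pointwise, so on a
  fixed finite \<open>S\<close> the bound for finitely supported functions passes to the
  limit.\<close>

lemma ba_extension_finite_bound:
  assumes p: "1 < p" and f: "f \<in> lp p" and S: "finite S"
  shows "(\<Sum>x\<in>S. \<bar>ba_extension p f x\<bar> powr p) \<le> sharp_const p powr p * (\<Sum>\<^sub>\<infinity>x. \<bar>f x\<bar> powr p)"
proof (rule tendsto_upperbound)
  let ?c = "\<lambda>A y. if y \<in> A then f y else 0"
  show "((\<lambda>A. \<Sum>x\<in>S. \<bar>\<Sum>y\<in>A. f y * ba_kernel (x - y)\<bar> powr p) \<longlongrightarrow> (\<Sum>x\<in>S. \<bar>ba_extension p f x\<bar> powr p)) (finite_subsets_at_top UNIV)"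
    using f p infsum_tendsto[OF kernel_summable[OF p f]]
    by (intro tendsto_sum tendsto_powr' tendsto_rabs tendsto_const) (auto simp: ba_extension_def)
  show "\<forall>\<^sub>F A in finite_subsets_at_top UNIV. (\<Sum>x\<in>S. \<bar>\<Sum>y\<in>A. f y * ba_kernel (x - y)\<bar> powr p)
      \<le> sharp_const p powr p * (\<Sum>\<^sub>\<infinity>x. \<bar>f x\<bar> powr p)"
  proof (rule finite_subsets_eventually[of "{}"])
    fix A :: "(int \<times> int) set" assume A: "finite A"
    have fs: "finsupp (?c A)" by (rule finite_subset[OF _ A]) auto
    have "beurling_ahlfors_im (?c A) x = (\<Sum>y\<in>A. f y * ba_kernel (x - y))" for x
      unfolding beurling_ahlfors_im_kernel[OF fs]
      by (rule sum.mono_neutral_cong_left[OF A]) auto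
    then have "(\<Sum>x\<in>S. \<bar>\<Sum>y\<in>A. f y * ba_kernel (x - y)\<bar> powr p) \<le> sharp_const p powr p * total (\<lambda>x. \<bar>?c A x\<bar> powr p)"
      using finite_bound[OF p fs S] by simp
    also have "total (\<lambda>x. \<bar>?c A x\<bar> powr p) = (\<Sum>x\<in>A. \<bar>?c A x\<bar> powr p)"
      by (rule total_superset[OF A]) auto
    also have "\<dots> = (\<Sum>x\<in>A. \<bar>f x\<bar> powr p)" by simp
    also have "\<dots> \<le> (\<Sum>\<^sub>\<infinity>x. \<bar>f x\<bar> powr p)" by (rule finite_sum_le_lp[OF f A])
    finally show "(\<Sum>x\<in>S. \<bar>\<Sum>y\<in>A. f y * ba_kernel (x - y)\<bar> powr p) \<le> sharp_const p powr p * (\<Sum>\<^sub>\<infinity>x. \<bar>f x\<bar> powr p)"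
      by (simp add: mult_left_mono)
  qed simp
qed simp

lemma ba_extension_bound:
  assumes p: "1 < p" and f: "f \<in> lp p"
  shows "ba_extension p f \<in> lp p" "lp_norm p (ba_extension p f) \<le> sharp_const p * lp_norm p f"
  using lp_bounded[OF ba_extension_finite_bound[OF p f]] sharp_const_pos[OF p]
  by (auto simp: lp_norm_le_iff[OF p])

lemma ba_extension_bounded_linear:
  assumes p: "1 < p" shows "bounded_linear_lp p (ba_extension p)"
  unfolding bounded_linear_lp_def
proof (intro conjI ballI allI)
  fix f g assume fg: "f \<in> lp p" "g \<in> lp p"
  show "ba_extension p (\<lambda>x. f x + g x) = (\<lambda>x. ba_extension p f x + ba_extension p g x)"
  proof
    fix x
    show "ba_extension p (\<lambda>x. f x + g x) x = ba_extension p f x + ba_extension p g x"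
      unfolding ba_extension_def if_P[OF lp_add[OF p fg]] if_P[OF fg(1)] if_P[OF fg(2)] distrib_right
      by (rule infsum_add[OF kernel_summable[OF p fg(1)] kernel_summable[OF p fg(2)]])
  qed
next
  fix c f assume f: "f \<in> lp p"
  show "ba_extension p (\<lambda>x. c * f x) = (\<lambda>x. c * ba_extension p f x)"
  proof
    fix x
    show "ba_extension p (\<lambda>x. c * f x) x = c * ba_extension p f x"
      unfolding ba_extension_def if_P[OF lp_cmult[OF f]] if_P[OF f] mult.assoc
      by (rule infsum_cmult_right[OF kernel_summable[OF p f]])
  qed
next
  show "\<exists>C. \<forall>f\<in>lp p. lp_norm p (ba_extension p f) \<le> C * lp_norm p f"
    using ba_extension_bound(2)[OF p] by blast
qed (rule ba_extension_bound(1)[OF p])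

lemma is_lp_extension_ba: "1 < p \<Longrightarrow> is_lp_extension p beurling_ahlfors_im (ba_extension p)"
  unfolding is_lp_extension_def
  by (intro conjI allI impI ba_extension_bounded_linear ba_extension_finsupp)
     (simp_all add: ba_extension_def fun_eq_iff)

section \<open>Uniqueness of the bounded extension\<close>

lemma lp_tail_small:
  assumes p: "1 < p" and f: "f \<in> lp p" and "0 < e"
  shows "\<exists>A. finite A \<and> lp_norm p (\<lambda>x. if x \<in> A then 0 else f x) < e \<and> (\<lambda>x. if x \<in> A then 0 else f x) \<in> lp p"
proof -
  let ?h = "\<lambda>x. \<bar>f x\<bar> powr p"
  have s: "?h summable_on UNIV" using f by (simp add: lp_iff)
  have "0 < e powr p" using \<open>0 < e\<close> by simp
  from tendstoD[OF infsum_tendsto[OF s] this] obtain A where A: "finite A" "dist (sum ?h A) (infsum ?h UNIV) < e powr p"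
    unfolding eventually_finite_subsets_at_top by blast
  have eq: "\<bar>if x \<in> A then 0 else f x\<bar> powr p = (if x \<in> - A then ?h x else 0)" for x by auto
  have sA: "?h summable_on - A" using s by (rule summable_on_subset_banach) auto
  have mem: "(\<lambda>x. if x \<in> A then 0 else f x) \<in> lp p"
    unfolding lp_iff eq
    by (rule summable_on_cong_neutral[THEN iffD1, OF _ _ _ sA]) auto
  have "(\<Sum>\<^sub>\<infinity>x. \<bar>if x \<in> A then 0 else f x\<bar> powr p) = infsum ?h (- A)"
    unfolding eq by (rule infsum_cong_neutral) auto
  also have "\<dots> = infsum ?h UNIV - sum ?h A"
    using infsum_Diff[OF s, of A] A(1) by (simp add: Compl_eq_Diff_UNIV)
  also have "\<dots> < e powr p" using A(2) by (simp add: dist_real_def)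
  finally have "(\<Sum>\<^sub>\<infinity>x. \<bar>if x \<in> A then 0 else f x\<bar> powr p) powr (1 / p) < (e powr p) powr (1 / p)"
    using p by (intro powr_less_mono2) (auto intro: infsum_nonneg)
  then have "lp_norm p (\<lambda>x. if x \<in> A then 0 else f x) < e"
    using p \<open>0 < e\<close> by (simp add: lp_norm_def powr_powr)
  then show ?thesis using A(1) mem by blast
qed

text \<open>The two extensions agree on a finite part of \<open>f\<close>, and the tail is small in
  norm. Values at a point are bounded by the norm, so a pointwise comparison replaces the triangle
  inequality in \<open>lp p\<close>.\<close>

lemma lp_extension_unique:
  assumes p: "1 < p" and T: "is_lp_extension p B T" and T': "is_lp_extension p B T'"
  shows "T = T'"
proof (intro ext)
  fix f x
  show "T f x = T' f x"
  proof (cases "f \<in> lp p")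
    case False then show ?thesis using T T' by (simp add: is_lp_extension_def)
  next
    case True
    obtain C where C: "\<And>f. f \<in> lp p \<Longrightarrow> lp_norm p (T f) \<le> C * lp_norm p f"
      using T unfolding is_lp_extension_def bounded_linear_lp_def by blast
    obtain C' where C': "\<And>f. f \<in> lp p \<Longrightarrow> lp_norm p (T' f) \<le> C' * lp_norm p f"
      using T' unfolding is_lp_extension_def bounded_linear_lp_def by blast
    have "\<bar>T f x - T' f x\<bar> \<le> e" if e: "0 < e" for e
    proof -
      define d where "d = e / (\<bar>C\<bar> + \<bar>C'\<bar> + 1)"
      have d: "0 < d" using e by (simp add: d_def)
      obtain A where A: "finite A" "lp_norm p (\<lambda>x. if x \<in> A then 0 else f x) < d" "(\<lambda>x. if x \<in> A then 0 else f x) \<in> lp p"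
        using lp_tail_small[OF p True d] by blast
      let ?h = "\<lambda>x. if x \<in> A then 0 else f x" and ?g = "\<lambda>x. if x \<in> A then f x else 0"
      have fs: "finsupp ?g" by (rule finite_subset[OF _ A(1)]) auto
      have split: "(\<lambda>x. ?g x + ?h x) = f" by auto
      have lin: "T f = (\<lambda>x. T ?g x + T ?h x)" "T' f = (\<lambda>x. T' ?g x + T' ?h x)"
        using T[unfolded is_lp_extension_def bounded_linear_lp_def, THEN conjunct1, THEN conjunct2, THEN conjunct1,
            rule_format, OF finsupp_lp[OF fs] A(3)]
          T'[unfolded is_lp_extension_def bounded_linear_lp_def, THEN conjunct1, THEN conjunct2, THEN conjunct1,
            rule_format, OF finsupp_lp[OF fs] A(3)]
        unfolding split by this+
      have eq: "T ?g = T' ?g" using T T' fs unfolding is_lp_extension_def by simp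
      have mem: "T ?h \<in> lp p" "T' ?h \<in> lp p"
        using T T' A(3) unfolding is_lp_extension_def bounded_linear_lp_def by blast+
      have "\<bar>T f x - T' f x\<bar> = \<bar>T ?h x - T' ?h x\<bar>" by (simp add: lin eq)
      also have "\<dots> \<le> lp_norm p (T ?h) + lp_norm p (T' ?h)"
        using abs_le_lp_norm[OF p mem(1), of x] abs_le_lp_norm[OF p mem(2), of x] by linarith
      also have "\<dots> \<le> (C + C') * lp_norm p ?h" using C[OF A(3)] C'[OF A(3)] by (simp add: distrib_right)
      also have "\<dots> \<le> (\<bar>C\<bar> + \<bar>C'\<bar> + 1) * d"
        using A(2) lp_norm_nonneg[of p ?h] by (intro mult_mono) auto
      also have "\<dots> = e" by (simp add: d_def add_nonneg_pos)
      finally show ?thesis .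
    qed
    then have "\<bar>T f x - T' f x\<bar> \<le> 0" by (rule field_le_epsilon) simp
    then show ?thesis by simp
  qed
qed

lemma lp_extension_eq:
  assumes "1 < p" shows "lp_extension p beurling_ahlfors_im = ba_extension p"
  unfolding lp_extension_def
proof (rule the_equality)
  show "is_lp_extension p beurling_ahlfors_im (ba_extension p)" by (rule is_lp_extension_ba[OF assms])
  then show "T = ba_extension p" if "is_lp_extension p beurling_ahlfors_im T" for T
    by (rule lp_extension_unique[OF assms that])
qed

subsection \<open>Periodic functions on the integers\<close>

definition periodic1 :: "int \<Rightarrow> (int \<Rightarrow> real) \<Rightarrow> bool" where
  "periodic1 L h \<longleftrightarrow> 0 < L \<and> (\<forall>k. h (k + L) = h k)"

lemma periodic1_mult: "periodic1 L h \<Longrightarrow> h (k + m * L) = h k"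
proof (induction m rule: int_induct[of _ 0])
  case base then show ?case by simp
next
  case (step1 i)
  then have "h (k + i * L + L) = h k" by (simp add: periodic1_def)
  then show ?case by (simp add: algebra_simps)
next
  case (step2 i)
  then have "h (k + (i - 1) * L + L) = h (k + (i - 1) * L)" by (simp add: periodic1_def)
  then show ?case using step2 by (simp add: algebra_simps)
qed

lemma periodic1_mod: "periodic1 L h \<Longrightarrow> h (k mod L) = h k"
  using periodic1_mult[of L h "k mod L" "k div L"] by (simp add: mod_mult_div_eq mult.commute add.commute)

lemma periodic1_shift: "periodic1 L h \<Longrightarrow> periodic1 L (\<lambda>k. h (k + a))"
  unfolding periodic1_def by (metis add.assoc add.commute)

lemma sum_int_Suc:
  fixes h :: "int \<Rightarrow> real"
  assumes "a \<le> b" shows "sum h {a..<b + 1} = sum h {a..<b} + h b"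
proof -
  have "{a..<b + 1} = insert b {a..<b}" using assms by auto
  then show ?thesis by simp
qed

lemma sum_int_split:
  fixes h :: "int \<Rightarrow> real"
  assumes "a \<le> b" "b \<le> c" shows "sum h {a..<c} = sum h {a..<b} + sum h {b..<c}"
proof -
  have "{a..<c} = {a..<b} \<union> {b..<c}" using assms by auto
  then show ?thesis by (simp add: sum.union_disjoint)
qed

lemma sum_periodic1_shift:
  assumes "periodic1 L h" shows "sum h {a..<a + L} = sum h {0..<L}"
proof -
  have L: "0 < L" using assms by (simp add: periodic1_def)
  have step: "sum h {a + 1..<a + 1 + L} = sum h {a..<a + L}" for a
  proof -
    have "sum h {a..<a + L + 1} = sum h {a..<a + L} + h (a + L)" using L by (intro sum_int_Suc) simp
    moreover have "sum h {a..<a + L + 1} = sum h {a..<a + 1} + sum h {a + 1..<a + L + 1}"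
      using L by (intro sum_int_split) auto
    moreover have "{a..<a + 1} = {a}" by auto
    moreover have "h (a + L) = h a" using assms by (simp add: periodic1_def)
    ultimately show ?thesis by (simp add: algebra_simps)
  qed
  show ?thesis
  proof (induction a rule: int_induct[of _ 0])
    case (step1 i) then show ?case using step[of i] by simp
  next
    case (step2 i) then show ?case using step[of "i - 1"] by simp
  qed simp
qed

lemma sum_periodic1_blocks:
  assumes "periodic1 M h" shows "sum h {a..<a + int n * M} = real n * sum h {0..<M}"
proof (induction n)
  case (Suc n)
  have M: "0 < M" using assms by (simp add: periodic1_def)
  have "sum h {a..<a + int (Suc n) * M} = sum h {a..<a + int n * M} + sum h {a + int n * M..<(a + int n * M) + M}"
    using M by (subst sum_int_split[of a "a + int n * M"]) (auto simp: algebra_simps)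
  then show ?case unfolding sum_periodic1_shift[OF assms] Suc.IH by (simp add: algebra_simps)
qed simp

text \<open>Partial sums within one period; the vanishing sum over the period closes the seam at
  \<open>k mod L = L - 1\<close>.\<close>

lemma periodic1_antidifference:
  assumes Y: "periodic1 L Y" and zero: "sum Y {0..<L} = 0"
  shows "\<exists>G. periodic1 L G \<and> (\<forall>k. G (k + 1) - G k = Y k)"
proof (intro exI conjI allI)
  let ?G = "\<lambda>k. sum Y {0..<k mod L}"
  have L: "0 < L" using Y by (simp add: periodic1_def)
  show "periodic1 L ?G" using L by (simp add: periodic1_def)
  fix k
  have r: "0 \<le> k mod L" "k mod L < L" using L by auto
  have m: "(k + 1) mod L = (k mod L + 1) mod L" by (simp add: mod_simps)
  have S: "sum Y {0..<k mod L + 1} = sum Y {0..<k mod L} + Y k"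
    using r sum_int_Suc[of 0 "k mod L" Y] periodic1_mod[OF Y] by simp
  show "?G (k + 1) - ?G k = Y k"
  proof (cases "k mod L + 1 < L")
    case True then show ?thesis using r S m by simp
  next
    case False
    then have "k mod L + 1 = L" using r by simp
    then show ?thesis using S zero m by simp
  qed
qed

lemma periodic1_second_antidifference:
  assumes Y: "periodic1 L Y" and zero: "sum Y {0..<L} = 0"
  shows "\<exists>H. periodic1 L H \<and> (\<forall>k. H (k + 1) - 2 * H k + H (k - 1) = Y k)"
proof -
  have L: "0 < L" using Y by (simp add: periodic1_def)
  obtain G where G: "periodic1 L G" "\<And>k. G (k + 1) - G k = Y k"
    using periodic1_antidifference[OF assms] by blast
  \<comment> \<open>The mean of the first antidifference has to go before a second periodic
    summation is possible, and it drops out of the second difference.\<close>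
  define c where "c = sum G {0..<L} / real_of_int L"
  have "periodic1 L (\<lambda>k. G k - c)" using G(1) by (simp add: periodic1_def)
  moreover have "sum (\<lambda>k. G k - c) {0..<L} = 0" using L by (simp add: sum_subtractf c_def)
  ultimately obtain H where H: "periodic1 L H" "\<And>k. H (k + 1) - H k = G k - c"
    using periodic1_antidifference by blast
  \<comment> \<open>Two forward differences form a second difference centred at
    \<open>k + 1\<close>; shifting \<open>H\<close> by one recentres it.\<close>
  have "H (k + 1 + 1) - 2 * H (k + 1) + H (k - 1 + 1) = Y k" for k
    using H(2)[of "k + 1"] H(2)[of k] G(2)[of k] by simp
  then show ?thesis using periodic1_shift[OF H(1), of 1] by blast
qed

subsection \<open>A slowly varying indicator function\<close>

definition trapezoid :: "real \<Rightarrow> real \<Rightarrow> real \<Rightarrow> real" where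
  "trapezoid T R r = max 0 (min 1 (min (r / T) ((R - r) / T)))"

lemma trapezoid_range: "0 \<le> trapezoid T R r" "trapezoid T R r \<le> 1"
  by (auto simp: trapezoid_def)

lemma trapezoid_lipschitz:
  assumes "0 < T" shows "\<bar>trapezoid T R (r + 1) - trapezoid T R r\<bar> \<le> 1 / T"
proof -
  have "(r + 1) / T = r / T + 1 / T" "(R - (r + 1)) / T = (R - r) / T - 1 / T" "0 < 1 / T"
    using assms by (auto simp: add_divide_distrib diff_divide_distrib)
  then show ?thesis unfolding trapezoid_def by linarith
qed

lemma trapezoid_one: "0 < T \<Longrightarrow> T \<le> r \<Longrightarrow> r \<le> R - T \<Longrightarrow> trapezoid T R r = 1"
  by (auto simp: trapezoid_def min_def max_def field_simps)

lemma trapezoid_zero: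
  assumes "0 < T" "R \<le> r \<or> r \<le> 0" shows "trapezoid T R r = 0"
proof -
  have "min (r / T) ((R - r) / T) \<le> 0" using assms by (auto simp: min_le_iff_disj divide_le_0_iff)
  then show ?thesis unfolding trapezoid_def by linarith
qed

text \<open>Each period carries one bump, supported in \<open>{0..<R}\<close>, with ramps of length
  \<open>T\<close>. The long ramps keep the errors of the product rule of order
  \<open>1 / T\<close>.\<close>

definition slow_indicator :: "int \<Rightarrow> int \<Rightarrow> int \<Rightarrow> int \<Rightarrow> real" where
  "slow_indicator T R L k = trapezoid (of_int T) (of_int R) (of_int (k mod L))"

lemma slow_indicator_properties:
  assumes "0 < T" "2 * T \<le> R" "R \<le> L"
  shows "periodic1 L (slow_indicator T R L)"
    "0 \<le> slow_indicator T R L k" "slow_indicator T R L k \<le> 1"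
    "\<bar>slow_indicator T R L (k + 1) - slow_indicator T R L k\<bar> \<le> 1 / of_int T"
    "\<And>r. T \<le> r \<Longrightarrow> r < R - T \<Longrightarrow> slow_indicator T R L r = 1"
    "\<And>r. R \<le> r \<Longrightarrow> r < L \<Longrightarrow> slow_indicator T R L r = 0"
proof -
  have L: "0 < L" using assms by simp
  show "periodic1 L (slow_indicator T R L)" using L by (simp add: periodic1_def slow_indicator_def)
  show "0 \<le> slow_indicator T R L k" "slow_indicator T R L k \<le> 1"
    by (simp_all add: slow_indicator_def trapezoid_range)
  show "slow_indicator T R L r = 1" if "T \<le> r" "r < R - T" for r
    using that assms by (auto simp: slow_indicator_def intro!: trapezoid_one simp flip: of_int_diff)
  show "slow_indicator T R L r = 0" if "R \<le> r" "r < L" for r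
    using that assms by (auto simp: slow_indicator_def intro!: trapezoid_zero)
  have r: "0 \<le> k mod L" "k mod L < L" using L by auto
  have m: "(k + 1) mod L = (k mod L + 1) mod L" by (simp add: mod_simps)
  have T: "0 < real_of_int T" using assms by simp
  show "\<bar>slow_indicator T R L (k + 1) - slow_indicator T R L k\<bar> \<le> 1 / of_int T"
  proof (cases "k mod L + 1 < L")
    case True
    then have "(k + 1) mod L = k mod L + 1" using m r by simp
    then show ?thesis using trapezoid_lipschitz[OF T, of "of_int R" "of_int (k mod L)"]
      by (simp add: slow_indicator_def)
  next
    case False
    \<comment> \<open>At the seam the wrapped value, at 0, and the unwrapped one, at
      \<open>L\<close>, both vanish because the bump ends at \<open>R \<le> L\<close>. So the
      estimate for \<open>trapezoid\<close> applies across it.\<close>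
    then have e: "k mod L + 1 = L" using r by simp
    then have "slow_indicator T R L (k + 1) = 0"
      using m T by (simp add: slow_indicator_def trapezoid_zero)
    moreover have "trapezoid (of_int T) (of_int R) (of_int (k mod L) + 1) = 0"
      using T assms e by (intro trapezoid_zero) linarith+
    ultimately show ?thesis using trapezoid_lipschitz[OF T, of "of_int R" "of_int (k mod L)"]
      by (simp add: slow_indicator_def)
  qed
qed

lemma slow_indicator_mean:
  assumes "0 < T" "2 * T \<le> R" "R \<le> L"
  shows "of_int (R - 2 * T) \<le> sum (slow_indicator T R L) {0..<L}" "sum (slow_indicator T R L) {0..<L} \<le> of_int R"
proof -
  note X = slow_indicator_properties[OF assms]
  have "sum (slow_indicator T R L) {0..<L} = sum (slow_indicator T R L) {0..<T} + (sum (slow_indicator T R L) {T..<R - T}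
     + (sum (slow_indicator T R L) {R - T..<R} + sum (slow_indicator T R L) {R..<L}))"
    using assms by (subst sum_int_split[of 0 T], simp, simp, subst sum_int_split[of T "R - T"], simp, simp,
        subst sum_int_split[of "R - T" R], simp_all)
  moreover have "sum (slow_indicator T R L) {T..<R - T} = of_int (R - 2 * T)"
    using X(5) assms by simp
  moreover have "sum (slow_indicator T R L) {R..<L} = 0"
    using X(6) by simp
  moreover have "sum (slow_indicator T R L) {0..<T} \<le> of_int T" "sum (slow_indicator T R L) {R - T..<R} \<le> of_int T"
    using sum_bounded_above[of "{0..<T}" "slow_indicator T R L" 1] X(3)
      sum_bounded_above[of "{R - T..<R}" "slow_indicator T R L" 1] assms by auto
  moreover have "0 \<le> sum (slow_indicator T R L) {0..<T}" "0 \<le> sum (slow_indicator T R L) {R - T..<R}"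
    by (intro sum_nonneg X(2))+
  ultimately show "of_int (R - 2 * T) \<le> sum (slow_indicator T R L) {0..<L}" "sum (slow_indicator T R L) {0..<L} \<le> of_int R"
    by simp_all
qed

subsection \<open>Periodic functions on the lattice\<close>

definition periodic2 :: "int \<Rightarrow> (int \<times> int \<Rightarrow> real) \<Rightarrow> bool" where
  "periodic2 M v \<longleftrightarrow> 0 < M \<and> (\<forall>x. v (x + (M, 0)) = v x \<and> v (x + (0, M)) = v x)"

definition cell :: "int \<Rightarrow> (int \<times> int) set" where
  "cell M = {0..<M} \<times> {0..<M}"

definition average :: "int \<Rightarrow> (int \<times> int \<Rightarrow> real) \<Rightarrow> real" where
  "average M F = sum F (cell M) / (of_int M)\<^sup>2"

lemma periodic2_row: "periodic2 M v \<Longrightarrow> periodic1 M (\<lambda>i. v (i + a, j))"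
proof -
  assume v: "periodic2 M v"
  have "v (k + M + a, j) = v (k + a, j)" for k
  proof -
    have "v ((k + a, j) + (M, 0)) = v (k + a, j)" using v unfolding periodic2_def by blast
    then show ?thesis by (simp add: add_ac)
  qed
  then show ?thesis using v by (simp add: periodic1_def periodic2_def)
qed

lemma periodic2_column: "periodic2 M v \<Longrightarrow> periodic1 M (\<lambda>j. v (i, j + a))"
proof -
  assume v: "periodic2 M v"
  have "v (i, k + M + a) = v (i, k + a)" for k
  proof -
    have "v ((i, k + a) + (0, M)) = v (i, k + a)" using v unfolding periodic2_def by blast
    then show ?thesis by (simp add: add_ac)
  qed
  then show ?thesis using v by (simp add: periodic1_def periodic2_def)
qed

lemma periodic2I:
  assumes "0 < M" "\<And>i j. v (i + M, j) = v (i, j)" "\<And>i j. v (i, j + M) = v (i, j)"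
  shows "periodic2 M v"
  using assms by (auto simp: periodic2_def)

lemma periodic2_comp2: "periodic2 M v \<Longrightarrow> periodic2 M w \<Longrightarrow> periodic2 M (\<lambda>x. \<Phi> (v x) (w x))"
  by (simp add: periodic2_def)

lemma periodic2_multiple:
  assumes v: "periodic2 M v" and n: "0 < n" shows "periodic2 (n * M) v"
proof (rule periodic2I)
  show "0 < n * M" using assms by (simp add: periodic2_def)
  fix i j
  show "v (i + n * M, j) = v (i, j)" using periodic1_mult[OF periodic2_row[OF v, of 0 j], of i n] by simp
  show "v (i, j + n * M) = v (i, j)" using periodic1_mult[OF periodic2_column[OF v, of i 0], of j n] by simp
qed

lemma sum_cell: "sum F (cell M) = (\<Sum>j\<in>{0..<M}. \<Sum>i\<in>{0..<M}. F (i, j))"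
  unfolding cell_def by (subst sum.swap) (simp add: sum.cartesian_product)

lemma periodic2_row_sum: "periodic2 M v \<Longrightarrow> periodic1 M (\<lambda>j. \<Sum>i\<in>{0..<M}. v (i, j))"
proof -
  assume v: "periodic2 M v"
  have "v (i, j + M) = v (i, j)" for i j
    using periodic2_column[OF v, of i 0] by (simp add: periodic1_def)
  then show ?thesis using v by (simp add: periodic1_def periodic2_def)
qed

lemma sum_cell_multiple:
  assumes v: "periodic2 M v" shows "sum v (cell (int n * M)) = (real n)\<^sup>2 * sum v (cell M)"
proof -
  have "(\<Sum>i\<in>{0..<int n * M}. v (i, j)) = real n * (\<Sum>i\<in>{0..<M}. v (i, j))" for j
    using sum_periodic1_blocks[OF periodic2_row[OF v, of 0 j], of 0 n] by simp
  then have "sum v (cell (int n * M)) = real n * (\<Sum>j\<in>{0..<int n * M}. \<Sum>i\<in>{0..<M}. v (i, j))"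
    unfolding sum_cell by (simp add: sum_distrib_left)
  also have "(\<Sum>j\<in>{0..<int n * M}. \<Sum>i\<in>{0..<M}. v (i, j)) = real n * sum v (cell M)"
    using sum_periodic1_blocks[OF periodic2_row_sum[OF v], of 0 n] unfolding sum_cell by simp
  finally show ?thesis by (simp add: power2_eq_square)
qed

lemma average_multiple:
  assumes v: "periodic2 M v" and n: "0 < n" shows "average (int n * M) v = average M v"
  unfolding average_def sum_cell_multiple[OF v] using n by (simp add: power_mult_distrib)

lemma periodic2_bounded:
  assumes v: "periodic2 M v" shows "\<exists>B. \<forall>x. \<bar>v x\<bar> \<le> B"
proof -
  have M: "0 < M" using v by (simp add: periodic2_def)
  have fin: "finite ((\<lambda>x. \<bar>v x\<bar>) ` cell M)" by (simp add: cell_def)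
  have "\<bar>v (i, j)\<bar> \<le> Max ((\<lambda>x. \<bar>v x\<bar>) ` cell M)" for i j
  proof -
    have "v (i mod M, j mod M) = v (i, j)"
      using periodic1_mod[OF periodic2_row[OF v, of 0 "j mod M"], of i] periodic1_mod[OF periodic2_column[OF v, of i 0], of j]
      by simp
    moreover have "(i mod M, j mod M) \<in> cell M" using M by (simp add: cell_def)
    ultimately show ?thesis using fin by (metis (no_types, lifting) Max_ge image_eqI)
  qed
  then show ?thesis by (metis surj_pair)
qed

subsection \<open>The two second order operators\<close>

text \<open>Equals minus the sum of
  \<open>\<partial>\<^sub>1\<^sup>+ \<partial>\<^sub>2\<^sup>-\<close> and
  \<open>\<partial>\<^sub>1\<^sup>- \<partial>\<^sub>2\<^sup>+\<close>, the discrete form of -2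
  times the mixed second derivative. For finitely supported \<open>v\<close> it is the image of
  \<open>neg_laplacian v\<close> under the operator.\<close>

definition mixed :: "(int \<times> int \<Rightarrow> real) \<Rightarrow> int \<times> int \<Rightarrow> real" where
  "mixed v x = neg_laplacian v x + diag_laplacian v x"

lemma periodic2_operators:
  assumes "periodic2 M v" shows "periodic2 M (neg_laplacian v)" "periodic2 M (mixed v)"
proof -
  have s: "v (x + (M, 0) + a) = v (x + a)" "v (x + (0, M) + a) = v (x + a)" for x a
    using assms unfolding periodic2_def by (metis add.assoc add.commute)+
  have s0: "v (x + (M, 0)) = v x" "v (x + (0, M)) = v x" for x
    using assms unfolding periodic2_def by blast+
  have M: "0 < M" using assms by (simp add: periodic2_def)
  show "periodic2 M (neg_laplacian v)" "periodic2 M (mixed v)"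
    using M unfolding periodic2_def mixed_def neg_laplacian_def diag_laplacian_def s s0 by auto
qed

text \<open>Discrete product rule: a factor that varies little between neighbours commutes with both
  operators up to \<open>\<delta> * B\<close> for each neighbour in the stencil, of which there are
  4 and 6.\<close>

lemma laplacian_product_error:
  assumes B: "\<And>x. \<bar>v x\<bar> \<le> B" and X: "\<And>x a b. \<bar>a\<bar> \<le> 1 \<Longrightarrow> \<bar>b\<bar> \<le> 1 \<Longrightarrow> \<bar>X (x + (a, b)) - X x\<bar> \<le> \<delta>"
  shows "\<bar>neg_laplacian (\<lambda>x. X x * v x) x - X x * neg_laplacian v x\<bar> \<le> 4 * (\<delta> * B)"
    "\<bar>mixed (\<lambda>x. X x * v x) x - X x * mixed v x\<bar> \<le> 6 * (\<delta> * B)"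
proof -
  let ?d = "\<lambda>a b. (X (x + (a, b)) - X x) * v (x + (a, b))"
  have d: "\<bar>?d a b\<bar> \<le> \<delta> * B" if "\<bar>a\<bar> \<le> 1" "\<bar>b\<bar> \<le> 1" for a b
    unfolding abs_mult using X[OF that, of x] B by (intro mult_mono) (auto intro: order_trans[OF abs_ge_zero])
  have 1: "neg_laplacian (\<lambda>x. X x * v x) x - X x * neg_laplacian v x = - (?d 1 0 + ?d (-1) 0 + ?d 0 1 + ?d 0 (-1))"
    by (simp add: neg_laplacian_def algebra_simps)
  have 2: "mixed (\<lambda>x. X x * v x) x - X x * mixed v x = - (?d 1 0 + ?d (-1) 0 + ?d 0 1 + ?d 0 (-1)) + ?d 1 (-1) + ?d (-1) 1"
    by (simp add: mixed_def neg_laplacian_def diag_laplacian_def algebra_simps)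
  have ds: "\<bar>?d 1 0\<bar> \<le> \<delta> * B" "\<bar>?d (-1) 0\<bar> \<le> \<delta> * B" "\<bar>?d 0 1\<bar> \<le> \<delta> * B" "\<bar>?d 0 (-1)\<bar> \<le> \<delta> * B"
    "\<bar>?d 1 (-1)\<bar> \<le> \<delta> * B" "\<bar>?d (-1) 1\<bar> \<le> \<delta> * B"
    by (rule d; simp)+
  have four: "\<bar>- (a + b + c + d)\<bar> \<le> 4 * e"
    if "\<bar>a\<bar> \<le> e" "\<bar>b\<bar> \<le> e" "\<bar>c\<bar> \<le> e" "\<bar>d\<bar> \<le> e" for a b c d e :: real
    using that by (intro abs_leI) (simp_all add: abs_le_iff)
  have six: "\<bar>- (a + b + c + d) + f + g\<bar> \<le> 6 * e"
    if "\<bar>a\<bar> \<le> e" "\<bar>b\<bar> \<le> e" "\<bar>c\<bar> \<le> e" "\<bar>d\<bar> \<le> e" "\<bar>f\<bar> \<le> e" "\<bar>g\<bar> \<le> e" for a b c d e f g :: real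
    using that by (intro abs_leI) (simp_all add: abs_le_iff)
  show "\<bar>neg_laplacian (\<lambda>x. X x * v x) x - X x * neg_laplacian v x\<bar> \<le> 4 * (\<delta> * B)"
    unfolding 1 by (rule four[OF ds(1-4)])
  show "\<bar>mixed (\<lambda>x. X x * v x) x - X x * mixed v x\<bar> \<le> 6 * (\<delta> * B)"
    unfolding 2 by (rule six[OF ds])
qed

lemma operators_add:
  "neg_laplacian (\<lambda>x. f x + g x) x = neg_laplacian f x + neg_laplacian g x"
  "mixed (\<lambda>x. f x + g x) x = mixed f x + mixed g x"
  "neg_laplacian (\<lambda>x. c * f x) x = c * neg_laplacian f x"
  "mixed (\<lambda>x. c * f x) x = c * mixed f x"
  by (simp_all add: mixed_def neg_laplacian_def diag_laplacian_def algebra_simps)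

lemma operators_bounded:
  assumes B: "\<And>x. \<bar>v x\<bar> \<le> B"
  shows "\<bar>neg_laplacian v x\<bar> \<le> 8 * B" "\<bar>mixed v x\<bar> \<le> 12 * B"
proof -
  have b: "v y \<le> B" "- v y \<le> B" for y using B[of y] by (simp_all add: abs_le_iff)
  note bs = b[of x] b[of "x + (1,0)"] b[of "x + (-1,0)"] b[of "x + (0,1)"] b[of "x + (0,-1)"] b[of "x + (1,-1)"] b[of "x + (-1,1)"]
  show "\<bar>neg_laplacian v x\<bar> \<le> 8 * B" "\<bar>mixed v x\<bar> \<le> 12 * B"
    unfolding mixed_def neg_laplacian_def diag_laplacian_def
    by (rule abs_leI; use bs in linarith)+
qed

text \<open>For \<open>s = 1\<close> the wave is constant in the direction of the diagonal
  difference, so both operators agree. For \<open>s = -1\<close> that difference has step 2 and is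
  about four times the second difference of the profile, which reverses the sign. The factor
  \<open>- (1/2)\<close> offsets the two coordinate directions and the sign of the
  Laplacian.\<close>

lemma operators_plane_wave:
  fixes H Y :: "int \<Rightarrow> real"
  assumes H: "\<And>k. H (k + 1) - 2 * H k + H (k - 1) = Y k" and Y: "\<And>k. \<bar>Y (k + 1) - Y k\<bar> \<le> \<delta>"
    and s: "s = 1 \<or> s = -1"
  defines "u \<equiv> \<lambda>x. - (1/2) * H (fst x + s * snd x)"
  shows "neg_laplacian u x = Y (fst x + s * snd x)"
    "\<bar>mixed u x - of_int s * Y (fst x + s * snd x)\<bar> \<le> \<delta>"
proof -
  define k where "k = fst x + s * snd x"
  have u: "u (x + (a, b)) = - (1/2) * H (k + (a + s * b))" for a b
    by (simp add: u_def k_def algebra_simps)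
  have ux: "u x = - (1/2) * H k" by (simp add: u_def k_def)
  have h: "H (k + 1) + H (k - 1) = 2 * H k + Y k" using H[of k] by simp
  show 1: "neg_laplacian u x = Y (fst x + s * snd x)"
    unfolding neg_laplacian_def u ux k_def[symmetric] using s h by auto
  show "\<bar>mixed u x - of_int s * Y (fst x + s * snd x)\<bar> \<le> \<delta>"
  proof (cases "s = 1")
    case True
    then have "diag_laplacian u x = 0" unfolding diag_laplacian_def u ux by simp
    then show ?thesis using 1 True Y[of 0] by (simp add: mixed_def)
  next
    case False
    then have s': "s = -1" using s by simp
    have "diag_laplacian u x = - (1/2) * (H (k + 2) + H (k - 2) - 2 * H k)"
      unfolding diag_laplacian_def u ux using s' by (simp add: field_simps)
    moreover have "H (k + 2) + H (k - 2) - 2 * H k = Y (k + 1) + 2 * Y k + Y (k - 1)"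
      using H[of "k + 1"] H[of k] H[of "k - 1"] by (simp add: algebra_simps)
    moreover have "neg_laplacian u x = Y k" using 1 by (simp only: k_def)
    ultimately have "mixed u x - of_int s * Y k = - (1/2) * ((Y (k + 1) - Y k) - (Y (k - 1 + 1) - Y (k - 1)))"
      using s' by (simp add: mixed_def algebra_simps)
    then show ?thesis unfolding k_def[symmetric] using Y[of k] Y[of "k - 1"] by simp
  qed
qed

subsection \<open>Lamination\<close>

definition defect :: "real \<Rightarrow> real \<Rightarrow> real \<Rightarrow> real \<Rightarrow> real" where
  "defect S p a b = \<bar>b\<bar> powr p - S powr p * \<bar>a\<bar> powr p"

text \<open>The base point \<open>(a, b)\<close> is added by hand, since both operators annihilate
  means: no periodic \<open>v\<close> could produce it.\<close>

definition mean_defect :: "real \<Rightarrow> real \<Rightarrow> real \<Rightarrow> real \<Rightarrow> int \<Rightarrow> (int \<times> int \<Rightarrow> real) \<Rightarrow> real" where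
  "mean_defect S p a b M v = average M (\<lambda>x. defect S p (a + neg_laplacian v x) (b + mixed v x))"

lemma defect_continuous:
  assumes "0 < p" shows "continuous_on UNIV (\<lambda>z. defect S p (fst z) (snd z))"
  unfolding defect_def using assms by (intro continuous_intros continuous_on_powr') auto

lemma defect_uniform:
  assumes "0 < p" "0 < e"
  shows "\<exists>d>0. \<forall>a b a' b'. \<bar>a\<bar> \<le> R \<longrightarrow> \<bar>b\<bar> \<le> R \<longrightarrow> \<bar>a'\<bar> \<le> R \<longrightarrow> \<bar>b'\<bar> \<le> R \<longrightarrow>
    \<bar>a - a'\<bar> < d \<longrightarrow> \<bar>b - b'\<bar> < d \<longrightarrow> \<bar>defect S p a b - defect S p a' b'\<bar> < e"
proof -
  let ?f = "\<lambda>z. defect S p (fst z) (snd z)"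
  have "uniformly_continuous_on ({-R..R} \<times> {-R..R}) ?f"
    by (intro compact_uniformly_continuous continuous_on_subset[OF defect_continuous[OF assms(1)]] compact_Times) auto
  then obtain d where d: "0 < d" and u: "\<And>z z'. z \<in> {-R..R} \<times> {-R..R} \<Longrightarrow> z' \<in> {-R..R} \<times> {-R..R} \<Longrightarrow>
    dist z' z < d \<Longrightarrow> dist (?f z') (?f z) < e"
    unfolding uniformly_continuous_on_def using assms(2) by metis
  have "\<bar>defect S p a b - defect S p a' b'\<bar> < e" if "\<bar>a\<bar> \<le> R" "\<bar>b\<bar> \<le> R" "\<bar>a'\<bar> \<le> R" "\<bar>b'\<bar> \<le> R"
    "\<bar>a - a'\<bar> < d / 2" "\<bar>b - b'\<bar> < d / 2" for a b a' b'
  proof -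
    have "dist (a, b) (a', b') \<le> \<bar>a - a'\<bar> + \<bar>b - b'\<bar>"
      by (simp add: dist_Pair_Pair dist_real_def sqrt_sum_squares_le_sum_abs)
    also have "\<dots> < d" using that by simp
    finally show ?thesis using u[of "(a', b')" "(a, b)"] that by (auto simp: dist_real_def abs_le_iff)
  qed
  then show ?thesis using d by (intro exI[of _ "d / 2"]) auto
qed

lemma defect_bounded:
  assumes "0 < p" shows "\<exists>K\<ge>0. \<forall>a b. \<bar>a\<bar> \<le> R \<longrightarrow> \<bar>b\<bar> \<le> R \<longrightarrow> \<bar>defect S p a b\<bar> \<le> K"
proof (intro exI conjI allI impI)
  let ?K = "\<bar>R\<bar> powr p + S powr p * \<bar>R\<bar> powr p"
  show "0 \<le> ?K" by simp
  fix a b assume ab: "\<bar>a\<bar> \<le> R" "\<bar>b\<bar> \<le> R"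
  then have 1: "\<bar>a\<bar> powr p \<le> \<bar>R\<bar> powr p" "\<bar>b\<bar> powr p \<le> \<bar>R\<bar> powr p"
    using assms by (auto intro!: powr_mono2)
  have "S powr p * \<bar>a\<bar> powr p \<le> S powr p * \<bar>R\<bar> powr p" by (intro mult_left_mono 1) auto
  moreover have "0 \<le> S powr p * \<bar>a\<bar> powr p" "0 \<le> \<bar>b\<bar> powr p" by simp_all
  ultimately show "\<bar>defect S p a b\<bar> \<le> ?K" unfolding defect_def using 1 by (simp only: abs_le_iff) linarith
qed

text \<open>One row of the laminate. Plateau, ramps and complement have lengths that are multiples
  of \<open>M\<close>, so the periodic comparison functions sum exactly by blocks; only the two
  ramps are estimated crudely, by \<open>K\<close>.\<close>

lemma trapezoid_sum:
  fixes M :: int and t b n :: nat and e K :: real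
  assumes h0: "periodic1 M h0" and h1: "periodic1 M h1" and tbn: "2 * t \<le> b" "b \<le> n"
    and e: "0 \<le> e" and K: "\<And>r. - K \<le> g r"
    and g0: "\<And>r. int t * M \<le> r \<Longrightarrow> r < int b * M - int t * M \<Longrightarrow> h0 r - e \<le> g r"
    and g1: "\<And>r. int b * M \<le> r \<Longrightarrow> r < int n * M \<Longrightarrow> h1 r - e \<le> g r"
  shows "real (b - 2 * t) * sum h0 {0..<M} + real (n - b) * sum h1 {0..<M} - e * (real n * of_int M) - 2 * (real t * of_int M) * K
    \<le> sum g {0..<int n * M}"
proof -
  let ?T = "int t * M" and ?R = "int b * M" and ?L = "int n * M"
  have M: "0 < M" using h0 by (simp add: periodic1_def)
  have "int (2 * t) * M \<le> int b * M" "int b * M \<le> int n * M"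
    using M tbn by (auto intro!: mult_right_mono simp del: of_nat_mult)
  then have le: "0 \<le> ?T" "?T \<le> ?R - ?T" "?R - ?T \<le> ?R" "?R \<le> ?L" "0 \<le> ?R" using M by (auto simp: algebra_simps)
  have split: "sum g {0..<?L} = sum g {0..<?T} + (sum g {?T..<?R - ?T} + (sum g {?R - ?T..<?R} + sum g {?R..<?L}))"
  proof -
    have "sum g {0..<?L} = sum g {0..<?T} + sum g {?T..<?L}" by (rule sum_int_split) (use le in linarith)+
    moreover have "sum g {?T..<?L} = sum g {?T..<?R - ?T} + sum g {?R - ?T..<?L}"
      by (rule sum_int_split) (use le in linarith)+
    moreover have "sum g {?R - ?T..<?L} = sum g {?R - ?T..<?R} + sum g {?R..<?L}"
      by (rule sum_int_split) (use le in linarith)+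
    ultimately show ?thesis by linarith
  qed
  have ramp: "- K * (real t * of_int M) \<le> sum g {0..<?T}" "- K * (real t * of_int M) \<le> sum g {?R - ?T..<?R}"
    using sum_bounded_below[of "{0..<?T}" "- K" g] sum_bounded_below[of "{?R - ?T..<?R}" "- K" g] K M
    by (auto simp: mult_ac)
  have len0: "?R - ?T = ?T + int (b - 2 * t) * M" using tbn by (simp add: of_nat_diff algebra_simps)
  have len1: "?L = ?R + int (n - b) * M" using tbn by (simp add: of_nat_diff algebra_simps)
  have c0: "(\<Sum>r\<in>{?T..<?R - ?T}. h0 r - e) = real (b - 2 * t) * sum h0 {0..<M} - e * (real (b - 2 * t) * of_int M)"
    unfolding len0 using sum_periodic1_blocks[OF h0, of ?T "b - 2 * t"] M
    by (simp add: sum_subtractf)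
  have c1: "(\<Sum>r\<in>{?R..<?L}. h1 r - e) = real (n - b) * sum h1 {0..<M} - e * (real (n - b) * of_int M)"
    unfolding len1 using sum_periodic1_blocks[OF h1, of ?R "n - b"] M
    by (simp add: sum_subtractf)
  have s0: "(\<Sum>r\<in>{?T..<?R - ?T}. h0 r - e) \<le> sum g {?T..<?R - ?T}" by (intro sum_mono g0) auto
  have s1: "(\<Sum>r\<in>{?R..<?L}. h1 r - e) \<le> sum g {?R..<?L}" by (intro sum_mono g1) auto
  have "real (b - 2 * t) + real (n - b) \<le> real n" using tbn by linarith
  then have "e * of_int M * (real (b - 2 * t) + real (n - b)) \<le> e * of_int M * real n"
    using e M by (intro mult_left_mono) auto
  then have "e * (real (b - 2 * t) * of_int M) + e * (real (n - b) * of_int M) \<le> e * (real n * of_int M)"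
    by (simp add: algebra_simps)
  then show ?thesis unfolding split using ramp s0 s1 unfolding c0 c1 by (simp add: algebra_simps)
qed

lemma periodic2_comp_line:
  assumes f: "periodic1 L f" shows "periodic2 L (\<lambda>x. f (fst x + s * snd x))"
proof (rule periodic2I)
  show "0 < L" using f by (simp add: periodic1_def)
  fix i j
  show "f (fst (i + L, j) + s * snd (i + L, j)) = f (fst (i, j) + s * snd (i, j))"
    using periodic1_mult[OF f, of "i + s * j" 1] by (simp add: algebra_simps)
  show "f (fst (i, j + L) + s * snd (i, j + L)) = f (fst (i, j) + s * snd (i, j))"
    using periodic1_mult[OF f, of "i + s * j" s] by (simp add: algebra_simps)
qed

text \<open>The laminate: a plane wave whose second difference is a slow indicator, carrying
  \<open>v0\<close> where the indicator is 1 and \<open>v1\<close> where it is 0.\<close>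

lemma laminate_operators:
  fixes X H :: "int \<Rightarrow> real"
  assumes X: "\<And>k. 0 \<le> X k" "\<And>k. X k \<le> 1" "\<And>k. \<bar>X (k + 1) - X k\<bar> \<le> \<eta>"
    and H: "\<And>k. H (k + 1) - 2 * H k + H (k - 1) = w * (X k - \<mu>)"
    and B: "\<And>x. \<bar>v0 x\<bar> \<le> B" "\<And>x. \<bar>v1 x\<bar> \<le> B" and s: "s = 1 \<or> s = -1"
  defines "k \<equiv> \<lambda>x. fst x + s * snd x"
  defines "v \<equiv> \<lambda>x. - (1/2) * H (k x) + (X (k x) * v0 x + (1 - X (k x)) * v1 x)"
  shows "\<bar>neg_laplacian v x - (w * (X (k x) - \<mu>) + X (k x) * neg_laplacian v0 x + (1 - X (k x)) * neg_laplacian v1 x)\<bar>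
      \<le> (24 * B + \<bar>w\<bar>) * \<eta>"
    "\<bar>mixed v x - (of_int s * (w * (X (k x) - \<mu>)) + X (k x) * mixed v0 x + (1 - X (k x)) * mixed v1 x)\<bar>
      \<le> (24 * B + \<bar>w\<bar>) * \<eta>"
proof -
  have B0: "0 \<le> B" using order_trans[OF abs_ge_zero B(1)] .
  have \<eta>: "0 \<le> \<eta>" using order_trans[OF abs_ge_zero X(3)] .
  have X2: "\<bar>X (m + d) - X m\<bar> \<le> 2 * \<eta>" if "\<bar>d\<bar> \<le> 2" for m d
  proof -
    consider "d = 0" | "d = 1" | "d = -1" | "d = 2" | "d = -2" using \<open>\<bar>d\<bar> \<le> 2\<close> by linarith
    then show ?thesis
    proof cases
      case 1 then show ?thesis using \<eta> by simp
    next
      case 2 then show ?thesis using X(3)[of m] \<eta> by simp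
    next
      case 3 then show ?thesis using X(3)[of "m - 1"] \<eta> by simp
    next
      case 4 then show ?thesis using X(3)[of m] X(3)[of "m + 1"] by (simp add: add.assoc)
    next
      case 5 then show ?thesis using X(3)[of "m - 1"] X(3)[of "m - 2"] by simp
    qed
  qed
  have kd: "k (y + (a, b)) = k y + (a + s * b)" for y a b by (simp add: k_def algebra_simps)
  have Xk: "\<bar>X (k (y + (a, b))) - X (k y)\<bar> \<le> 2 * \<eta>" if "\<bar>a\<bar> \<le> 1" "\<bar>b\<bar> \<le> 1" for y a b
    unfolding kd using s that by (intro X2) auto
  then have Xk': "\<bar>(1 - X (k (y + (a, b)))) - (1 - X (k y))\<bar> \<le> 2 * \<eta>" if "\<bar>a\<bar> \<le> 1" "\<bar>b\<bar> \<le> 1" for y a b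
    using Xk[OF that, of y] by linarith
  have Y: "\<bar>w * (X (m + 1) - \<mu>) - w * (X m - \<mu>)\<bar> \<le> \<bar>w\<bar> * \<eta>" for m
  proof -
    have "w * (X (m + 1) - \<mu>) - w * (X m - \<mu>) = w * (X (m + 1) - X m)" by (simp add: algebra_simps)
    then show ?thesis using X(3)[of m] by (simp add: abs_mult mult_left_mono)
  qed
  have kx: "fst y + s * snd y = k y" for y by (simp add: k_def)
  note W = operators_plane_wave[of H "\<lambda>k. w * (X k - \<mu>)", OF H Y s, unfolded kx]
  have P0: "\<bar>neg_laplacian (\<lambda>x. X (k x) * v0 x) x - X (k x) * neg_laplacian v0 x\<bar> \<le> 4 * (2 * \<eta> * B)"
    "\<bar>mixed (\<lambda>x. X (k x) * v0 x) x - X (k x) * mixed v0 x\<bar> \<le> 6 * (2 * \<eta> * B)"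
    by (rule laplacian_product_error[OF B(1) Xk]; assumption)+
  have P1: "\<bar>neg_laplacian (\<lambda>x. (1 - X (k x)) * v1 x) x - (1 - X (k x)) * neg_laplacian v1 x\<bar> \<le> 4 * (2 * \<eta> * B)"
    "\<bar>mixed (\<lambda>x. (1 - X (k x)) * v1 x) x - (1 - X (k x)) * mixed v1 x\<bar> \<le> 6 * (2 * \<eta> * B)"
    by (rule laplacian_product_error[OF B(2) Xk']; assumption)+
  have e: "0 \<le> B * \<eta>" "0 \<le> \<bar>w\<bar> * \<eta>" using B0 \<eta> by auto
  have e': "(24 * B + \<bar>w\<bar>) * \<eta> = 24 * (B * \<eta>) + \<bar>w\<bar> * \<eta>" "4 * (2 * \<eta> * B) = 8 * (B * \<eta>)" "6 * (2 * \<eta> * B) = 12 * (B * \<eta>)"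
    by (simp_all add: algebra_simps)
  show "\<bar>neg_laplacian v x - (w * (X (k x) - \<mu>) + X (k x) * neg_laplacian v0 x + (1 - X (k x)) * neg_laplacian v1 x)\<bar>
      \<le> (24 * B + \<bar>w\<bar>) * \<eta>"
    unfolding v_def operators_add(1) W(1) e' using P0(1)[unfolded e'] P1(1)[unfolded e'] e by linarith
  show "\<bar>mixed v x - (of_int s * (w * (X (k x) - \<mu>)) + X (k x) * mixed v0 x + (1 - X (k x)) * mixed v1 x)\<bar>
      \<le> (24 * B + \<bar>w\<bar>) * \<eta>"
    unfolding v_def operators_add(2) e' using W(2)[of x] P0(2)[unfolded e'] P1(2)[unfolded e'] by linarith
qed

lemma sum_row_shift: "periodic1 L h \<Longrightarrow> sum h {0..<L} = (\<Sum>r\<in>{0..<L}. h (r + a))"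
proof -
  assume h: "periodic1 L h"
  have "(\<Sum>r\<in>{0..<L}. h (r + a)) = sum h {a..<a + L}"
    by (rule sum.reindex_bij_witness[of _ "\<lambda>r. r - a" "\<lambda>r. r + a"]) auto
  then show ?thesis using sum_periodic1_shift[OF h] by simp
qed

text \<open>A horizontal row of length \<open>int n * M\<close> runs through exactly one period of
  the stripe coordinate \<open>fst x + s * snd x\<close>, so the average is assembled from row
  estimates.\<close>

lemma laminate_average:
  fixes M :: int and t b n :: nat and e K :: real
  assumes G: "periodic2 (int n * M) G" and P0: "periodic2 M P0" and P1: "periodic2 M P1"
    and tbn: "2 * t \<le> b" "b \<le> n" "0 < n" and e: "0 \<le> e" and K: "\<And>x. - K \<le> G x"
    and g0: "\<And>x. int t * M \<le> fst x + s * snd x \<Longrightarrow> fst x + s * snd x < int b * M - int t * M \<Longrightarrow> P0 x - e \<le> G x"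
    and g1: "\<And>x. int b * M \<le> fst x + s * snd x \<Longrightarrow> fst x + s * snd x < int n * M \<Longrightarrow> P1 x - e \<le> G x"
  shows "real (b - 2 * t) / n * average M P0 + real (n - b) / n * average M P1 - e - 2 * t * K / n \<le> average (int n * M) G"
proof -
  let ?L = "int n * M"
  have M: "0 < M" using P0 by (simp add: periodic2_def)
  define A :: "(int \<times> int \<Rightarrow> real) \<Rightarrow> int \<Rightarrow> real" where "A = (\<lambda>P j. \<Sum>i\<in>{0..<M}. P (i, j))"
  define c where "c = e * (real n * of_int M) + 2 * (real t * of_int M) * K"
  have row: "real (b - 2 * t) * A P0 j + real (n - b) * A P1 j - c \<le> (\<Sum>i\<in>{0..<?L}. G (i, j))" for j
  proof -
    \<comment> \<open>The shift by \<open>- s * j\<close> makes \<open>r\<close> the stripe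
      coordinate; by periodicity it does not change the row sum.\<close>
    have eq: "r + (- s * j) + s * j = r" for r by simp
    have per: "periodic1 M (\<lambda>r. P (r + (- s * j), j))" if "periodic2 M P" for P
      by (rule periodic2_row[OF that])
    have A: "A P j = sum (\<lambda>r. P (r + (- s * j), j)) {0..<M}" if "periodic2 M P" for P
      unfolding A_def using sum_row_shift[OF periodic2_row[OF that, of 0 j], of "- s * j"] by simp
    have "real (b - 2 * t) * A P0 j + real (n - b) * A P1 j - e * (real n * of_int M) - 2 * (real t * of_int M) * K
       \<le> sum (\<lambda>r. G (r + (- s * j), j)) {0..<?L}"
      unfolding A[OF P0] A[OF P1]
    proof (rule trapezoid_sum[OF per[OF P0] per[OF P1] tbn(1,2) e])
      show "- K \<le> G (r + - s * j, j)" for r by (rule K)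
      show "P0 (r + - s * j, j) - e \<le> G (r + - s * j, j)" if "int t * M \<le> r" "r < int b * M - int t * M" for r
        by (rule g0) (use that in simp_all)
      show "P1 (r + - s * j, j) - e \<le> G (r + - s * j, j)" if "int b * M \<le> r" "r < int n * M" for r
        by (rule g1) (use that in simp_all)
    qed
    also have "\<dots> = (\<Sum>i\<in>{0..<?L}. G (i, j))"
      using sum_row_shift[OF periodic2_row[OF G, of 0 j], of "- s * j"] by simp
    finally show ?thesis by (simp add: c_def)
  qed
  have SA: "(\<Sum>j\<in>{0..<?L}. A P j) = real n * sum P (cell M)" if "periodic2 M P" for P
    using sum_periodic1_blocks[OF periodic2_row_sum[OF that], of 0 n] unfolding A_def sum_cell by simp
  have "(\<Sum>j\<in>{0..<?L}. real (b - 2 * t) * A P0 j + real (n - b) * A P1 j - c) \<le> sum G (cell ?L)"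
    unfolding sum_cell by (intro sum_mono row)
  also have "(\<Sum>j\<in>{0..<?L}. real (b - 2 * t) * A P0 j + real (n - b) * A P1 j - c) =
     real (b - 2 * t) * (real n * sum P0 (cell M)) + real (n - b) * (real n * sum P1 (cell M)) - real n * of_int M * c"
    using M SA[OF P0] SA[OF P1] by (simp add: sum_subtractf sum.distrib sum_distrib_left[symmetric])
  finally have le: "real (b - 2 * t) * (real n * sum P0 (cell M)) + real (n - b) * (real n * sum P1 (cell M)) - real n * of_int M * c
     \<le> sum G (cell ?L)" .
  define m where "m = real_of_int M"
  define N where "N = real n"
  have mN: "0 < m" "0 < N" using M tbn by (auto simp: m_def N_def)
  have "real (b - 2 * t) / n * average M P0 + real (n - b) / n * average M P1 - e - 2 * t * K / n =
    (real (b - 2 * t) * (N * sum P0 (cell M)) + real (n - b) * (N * sum P1 (cell M)) - N * m * c) / (N * m)\<^sup>2"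
    unfolding average_def c_def m_def[symmetric] N_def[symmetric] using mN by (simp add: field_simps power2_eq_square)
  also have "\<dots> \<le> sum G (cell ?L) / (N * m)\<^sup>2"
    using le by (intro divide_right_mono) (auto simp: N_def m_def)
  finally show ?thesis by (simp add: average_def N_def m_def)
qed

lemma mult_in_unit_abs: "0 \<le> (x::real) \<Longrightarrow> x \<le> 1 \<Longrightarrow> \<bar>x * y\<bar> \<le> \<bar>y\<bar>"
  by (simp add: abs_mult mult_left_le_one_le)

lemma abs_add_le: "\<bar>x\<bar> \<le> a \<Longrightarrow> \<bar>y\<bar> \<le> b \<Longrightarrow> \<bar>x + y\<bar> \<le> a + (b::real)"
  by (rule order_trans[OF abs_triangle_ineq add_mono])

lemma abs_add_less: "\<bar>x\<bar> \<le> a \<Longrightarrow> a < d / 2 \<Longrightarrow> \<bar>y\<bar> < d / 2 \<Longrightarrow> \<bar>x + y\<bar> < (d::real)"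
  by linarith

lemma abs_le_of_diff3:
  "\<bar>u - (x + y + z)\<bar> \<le> t \<Longrightarrow> \<bar>x\<bar> \<le> a \<Longrightarrow> \<bar>y\<bar> \<le> b \<Longrightarrow> \<bar>z\<bar> \<le> c \<Longrightarrow> \<bar>u\<bar> \<le> t + a + b + (c::real)"
  by linarith

lemma laminate_arith:
  "P - Q = A + B + C \<Longrightarrow> A \<le> a \<Longrightarrow> B \<le> b \<Longrightarrow> C \<le> c \<Longrightarrow> a + c + b + k \<le> e / 4 \<Longrightarrow> 0 < e \<Longrightarrow>
    P - e \<le> Q - e / 4 - (k::real)"
  by linarith

text \<open>With \<open>w = a0 - a1\<close> the plane wave adds \<open>w * (X - \<mu>)\<close> to
  \<open>a\<close> and about \<open>s\<close> times that to \<open>b\<close>. As the mean \<mu> of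
  \<open>X\<close> is close to \<open>l\<close>, this moves the base point to nearly
  \<open>(a0, b0)\<close> where \<open>X = 1\<close> and to nearly \<open>(a1, b1)\<close> where
  \<open>X = 0\<close>; there \<open>v0\<close> and \<open>v1\<close> take over.\<close>

lemma lamination:
  fixes M :: int
  assumes p: "0 < p" and v: "periodic2 M v0" "periodic2 M v1" and s: "s = 1 \<or> s = -1"
    and dir: "b0 - b1 = of_int s * (a0 - a1)" and l: "0 < l" "l < 1" and e: "0 < e"
  shows "\<exists>L v. periodic2 L v \<and>
    l * mean_defect S p a0 b0 M v0 + (1 - l) * mean_defect S p a1 b1 M v1 - e
      \<le> mean_defect S p (l * a0 + (1 - l) * a1) (l * b0 + (1 - l) * b1) L v"
proof -
  define w where "w = a0 - a1"
  define J0 where "J0 = mean_defect S p a0 b0 M v0"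
  define J1 where "J1 = mean_defect S p a1 b1 M v1"
  have M: "0 < M" using v by (simp add: periodic2_def)
  obtain B0 B1 where "\<And>x. \<bar>v0 x\<bar> \<le> B0" "\<And>x. \<bar>v1 x\<bar> \<le> B1" using periodic2_bounded v by metis
  then have B: "\<bar>v0 x\<bar> \<le> max B0 B1" "\<bar>v1 x\<bar> \<le> max B0 B1" for x by (meson le_max_iff_disj)+
  define B where "B = max B0 B1"
  note B = B[folded B_def]
  have B0: "0 \<le> B" using order_trans[OF abs_ge_zero B(1)] .
  \<comment> \<open>The error constant of \<open>laminate_operators\<close>. The radius
    \<open>R\<close> below bounds every argument at which \<open>defect\<close> is compared.\<close>
  define \<tau> where "\<tau> = 24 * B + \<bar>w\<bar>"
  have \<tau>: "0 \<le> \<tau>" using B0 by (simp add: \<tau>_def)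
  define \<rho> where "\<rho> = \<bar>a0\<bar> + \<bar>a1\<bar> + \<bar>b0\<bar> + \<bar>b1\<bar>"
  define R where "R = \<rho> + \<bar>w\<bar> + 24 * B + \<tau>"
  have \<rho>: "\<bar>a0\<bar> \<le> \<rho>" "\<bar>b0\<bar> \<le> \<rho>" "\<bar>a1\<bar> \<le> \<rho>" "\<bar>b1\<bar> \<le> \<rho>" "\<bar>a0\<bar> + \<bar>a1\<bar> \<le> \<rho>" "\<bar>b0\<bar> + \<bar>b1\<bar> \<le> \<rho>"
    by (simp_all add: \<rho>_def)
  have R12: "\<rho> + 12 * B \<le> R" "\<rho> + 8 * B \<le> R" "\<rho> + (\<tau> + \<bar>w\<bar> + 8 * B + 8 * B) \<le> R" "\<rho> + (\<tau> + \<bar>w\<bar> + 12 * B + 12 * B) \<le> R"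
    using B0 \<tau> by (simp_all add: R_def)
  have e4: "0 < e / 4" using e by simp
  obtain d where d: "0 < d" and uni: "\<And>a b a' b'. \<bar>a\<bar> \<le> R \<Longrightarrow> \<bar>b\<bar> \<le> R \<Longrightarrow> \<bar>a'\<bar> \<le> R \<Longrightarrow> \<bar>b'\<bar> \<le> R \<Longrightarrow>
    \<bar>a - a'\<bar> < d \<Longrightarrow> \<bar>b - b'\<bar> < d \<Longrightarrow> \<bar>defect S p a b - defect S p a' b'\<bar> < e / 4"
    using defect_uniform[OF p e4, of R] by blast
  obtain K where K: "0 \<le> K" and Kb: "\<And>a b. \<bar>a\<bar> \<le> R \<Longrightarrow> \<bar>b\<bar> \<le> R \<Longrightarrow> \<bar>defect S p a b\<bar> \<le> K"
    using defect_bounded[OF p, of R] by blast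
  \<comment> \<open>Ramps have length \<open>t * M\<close>. First \<open>t\<close> is fixed by the
    modulus of continuity, then \<open>n\<close> is taken so large that the ramps fill a small part
    of the period.\<close>
  obtain t :: nat where t: "max 1 (2 * \<tau> / d) < real t" using reals_Archimedean2 by blast
  have t1: "1 \<le> t" "0 < real t" using t by auto
  have td: "\<tau> / real t < d / 2" using t d t1 by (simp add: field_simps)
  \<comment> \<open>\<open>n\<close> above \<open>c1\<close> brings the mean of the indicator close
    enough to \<open>l\<close>, above \<open>c2\<close> leaves room for both ramps in the bump, and
    above \<open>c3\<close> keeps ramp and rounding losses within \<open>e / 4\<close>.\<close>
  define c1 where "c1 = \<bar>w\<bar> * (2 * real t + 1) * 2 / d"
  define c2 where "c2 = (2 * real t + 1) / l"
  define c3 where "c3 = ((2 * real t + 1) * \<bar>J0\<bar> + \<bar>J1\<bar> + 2 * real t * K) * 4 / e"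
  obtain n :: nat where n: "max (max 1 c1) (max c2 c3) < real n" using reals_Archimedean2 by blast
  have n0: "0 < real n" "0 < n" using n by auto
  define b where "b = nat \<lfloor>l * real n\<rfloor>"
  have bf: "real b \<le> l * real n" "l * real n < real b + 1"
    using l n0 unfolding b_def by (simp_all add: of_nat_nat floor_less_iff)
  have ln: "2 * real t + 1 < l * real n" using n l by (simp add: c2_def field_simps)
  have b2t: "2 * t \<le> b" using ln bf by linarith
  have "l * real n \<le> 1 * real n" using l by (intro mult_right_mono) auto
  then have bn: "b \<le> n" using bf by linarith
  define T where "T = int t * M"
  define Rr where "Rr = int b * M"
  define L where "L = int n * M"
  have "int (2 * t) * M \<le> int b * M" "int b * M \<le> int n * M"
    using M b2t bn by (auto intro!: mult_right_mono simp del: of_nat_mult)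
  then have TR: "0 < T" "2 * T \<le> Rr" "Rr \<le> L" using M t1 by (auto simp: T_def Rr_def L_def)
  define X where "X = slow_indicator T Rr L"
  note X = slow_indicator_properties[OF TR, folded X_def]
  \<comment> \<open>The exact mean rather than \<open>l\<close>: only a profile with zero sum over
    the period has a periodic second antidifference.\<close>
  define \<mu> where "\<mu> = sum X {0..<L} / of_int L"
  have Lpos: "0 < L" using TR by simp
  have mu: "\<bar>l - \<mu>\<bar> \<le> (2 * real t + 1) / real n"
  proof -
    have r: "real_of_int L = real n * of_int M" "real_of_int Rr = real b * of_int M" "real_of_int (Rr - 2 * T) = (real b - 2 * real t) * of_int M"
      by (simp_all add: L_def Rr_def T_def algebra_simps)
    have "\<mu> \<le> real b * of_int M / (real n * of_int M)" "(real b - 2 * real t) * of_int M / (real n * of_int M) \<le> \<mu>"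
      unfolding \<mu>_def r(1)[symmetric] unfolding r(2,3)[symmetric]
      using slow_indicator_mean[OF TR, folded X_def] Lpos by (intro divide_right_mono; simp)+
    then have m: "\<mu> \<le> real b / real n" "(real b - 2 * real t) / real n \<le> \<mu>" using M by simp_all
    have "l \<le> (real b + 1) / real n" "real b / real n \<le> l" using bf n0 by (simp_all add: field_simps)
    then show ?thesis using m n0 t1 by (simp add: abs_le_iff add_divide_distrib diff_divide_distrib)
  qed
  have mud: "\<bar>w\<bar> * \<bar>l - \<mu>\<bar> < d / 2"
  proof -
    have "\<bar>w\<bar> * \<bar>l - \<mu>\<bar> \<le> \<bar>w\<bar> * ((2 * real t + 1) / real n)" by (intro mult_left_mono mu) simp
    also have "\<dots> < d / 2" using n n0 d by (simp add: c1_def field_simps)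
    finally show ?thesis .
  qed
  have mu01: "0 \<le> \<mu>" "\<mu> \<le> 1"
  proof -
    show "0 \<le> \<mu>" unfolding \<mu>_def using Lpos by (intro divide_nonneg_pos sum_nonneg X) auto
    have "sum X {0..<L} \<le> of_int L" using slow_indicator_mean(2)[OF TR, folded X_def] TR by linarith
    then show "\<mu> \<le> 1" unfolding \<mu>_def using Lpos by simp
  qed
  have pY: "periodic1 L (\<lambda>k. w * (X k - \<mu>))" using X(1) by (simp add: periodic1_def)
  have "sum (\<lambda>k. w * (X k - \<mu>)) {0..<L} = 0"
    using Lpos by (simp add: sum_distrib_left[symmetric] sum_subtractf \<mu>_def)
  then obtain H where H: "periodic1 L H" "\<And>k. H (k + 1) - 2 * H k + H (k - 1) = w * (X k - \<mu>)"
    using periodic1_second_antidifference[OF pY] by blast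
  define k where "k = (\<lambda>x::int\<times>int. fst x + s * snd x)"
  define v where "v = (\<lambda>x. - (1/2) * H (k x) + (X (k x) * v0 x + (1 - X (k x)) * v1 x))"
  have kp: "periodic2 L (\<lambda>x. H (k x))" "periodic2 L (\<lambda>x. X (k x))"
    unfolding k_def by (intro periodic2_comp_line H X)+
  have vL: "periodic2 L v0" "periodic2 L v1" unfolding L_def using n0 v by (auto intro!: periodic2_multiple)
  have pv: "periodic2 L v"
    using kp vL unfolding periodic2_def v_def by simp
  have \<eta>: "1 / real_of_int T \<le> 1 / real t"
  proof -
    have "real t * 1 \<le> real t * real_of_int M" using M t1 by (intro mult_left_mono) auto
    then show ?thesis using t1 by (simp add: T_def frac_le)
  qed
  have lam: "\<bar>neg_laplacian v x - (w * (X (k x) - \<mu>) + X (k x) * neg_laplacian v0 x + (1 - X (k x)) * neg_laplacian v1 x)\<bar> \<le> \<tau> / real t"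
    "\<bar>mixed v x - (of_int s * (w * (X (k x) - \<mu>)) + X (k x) * mixed v0 x + (1 - X (k x)) * mixed v1 x)\<bar> \<le> \<tau> / real t" for x
  proof -
    have "\<tau> * (1 / of_int T) \<le> \<tau> * (1 / real t)" by (intro mult_left_mono \<eta> \<tau>)
    then have le: "(24 * B + \<bar>w\<bar>) * (1 / of_int T) \<le> \<tau> / real t" by (simp add: \<tau>_def)
    have lo: "\<bar>neg_laplacian v x - (w * (X (k x) - \<mu>) + X (k x) * neg_laplacian v0 x + (1 - X (k x)) * neg_laplacian v1 x)\<bar>
      \<le> (24 * B + \<bar>w\<bar>) * (1 / of_int T)"
     "\<bar>mixed v x - (of_int s * (w * (X (k x) - \<mu>)) + X (k x) * mixed v0 x + (1 - X (k x)) * mixed v1 x)\<bar>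
      \<le> (24 * B + \<bar>w\<bar>) * (1 / of_int T)"
      unfolding v_def k_def by (rule laminate_operators[OF X(2,3,4) H(2) B s])+
    show "\<bar>neg_laplacian v x - (w * (X (k x) - \<mu>) + X (k x) * neg_laplacian v0 x + (1 - X (k x)) * neg_laplacian v1 x)\<bar> \<le> \<tau> / real t"
      "\<bar>mixed v x - (of_int s * (w * (X (k x) - \<mu>)) + X (k x) * mixed v0 x + (1 - X (k x)) * mixed v1 x)\<bar> \<le> \<tau> / real t"
      by (rule order_trans[OF lo(1) le], rule order_trans[OF lo(2) le])
  qed
  define a where "a = l * a0 + (1 - l) * a1"
  define c where "c = l * b0 + (1 - l) * b1"
  have a: "a = a1 + w * l" "a = a0 + w * l - w" by (simp_all add: a_def w_def algebra_simps)
  have sdir: "b0 = b1 + of_int s * w" using dir by (simp add: w_def)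
  have c: "c = b1 + of_int s * (w * l)" "c = b0 + of_int s * (w * l - w)" unfolding c_def sdir by (simp_all add: algebra_simps)
  have abs_s: "\<bar>of_int s * y\<bar> = \<bar>y\<bar>" for y :: real using s by auto
  have wl: "\<bar>w * l - w * \<mu>\<bar> < d / 2" using mud by (simp add: abs_mult[symmetric] right_diff_distrib)
  have al: "\<bar>a\<bar> \<le> \<rho>" "\<bar>c\<bar> \<le> \<rho>"
    unfolding a_def c_def using l
    by (intro order_trans[OF abs_add_le[OF mult_in_unit_abs mult_in_unit_abs] \<rho>(5)]
        order_trans[OF abs_add_le[OF mult_in_unit_abs mult_in_unit_abs] \<rho>(6)]; simp)+
  note ob0 = operators_bounded[OF B(1)] and ob1 = operators_bounded[OF B(2)]
  have \<tau>t: "\<tau> / real t \<le> \<tau>" using mult_left_mono[of 1 "real t" \<tau>] \<tau> t1 by (simp add: divide_le_eq)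
  define G where "G = (\<lambda>x. defect S p (a + neg_laplacian v x) (c + mixed v x))"
  define P0 where "P0 = (\<lambda>x. defect S p (a0 + neg_laplacian v0 x) (b0 + mixed v0 x))"
  define P1 where "P1 = (\<lambda>x. defect S p (a1 + neg_laplacian v1 x) (b1 + mixed v1 x))"
  have in0: "\<bar>a0 + neg_laplacian v0 x\<bar> \<le> R" "\<bar>b0 + mixed v0 x\<bar> \<le> R" for x
    by (rule order_trans[OF abs_add_le[OF \<rho>(1) ob0(1)] R12(2)], rule order_trans[OF abs_add_le[OF \<rho>(2) ob0(2)] R12(1)])
  have in1: "\<bar>a1 + neg_laplacian v1 x\<bar> \<le> R" "\<bar>b1 + mixed v1 x\<bar> \<le> R" for x
    by (rule order_trans[OF abs_add_le[OF \<rho>(3) ob1(1)] R12(2)], rule order_trans[OF abs_add_le[OF \<rho>(4) ob1(2)] R12(1)])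
  have inG: "\<bar>a + neg_laplacian v x\<bar> \<le> R" "\<bar>c + mixed v x\<bar> \<le> R" for x
  proof -
    have Xx: "0 \<le> X (k x)" "X (k x) \<le> 1" "0 \<le> 1 - X (k x)" "1 - X (k x) \<le> 1" using X(2,3) by auto
    have "\<bar>X (k x) - \<mu>\<bar> \<le> 1" using Xx mu01 by linarith
    then have wX: "\<bar>w * (X (k x) - \<mu>)\<bar> \<le> \<bar>w\<bar>" by (simp add: abs_mult mult_left_le)
    have swX: "\<bar>of_int s * (w * (X (k x) - \<mu>))\<bar> \<le> \<bar>w\<bar>" using wX unfolding abs_s .
    have m: "\<bar>X (k x) * neg_laplacian v0 x\<bar> \<le> 8 * B" "\<bar>(1 - X (k x)) * neg_laplacian v1 x\<bar> \<le> 8 * B"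
      "\<bar>X (k x) * mixed v0 x\<bar> \<le> 12 * B" "\<bar>(1 - X (k x)) * mixed v1 x\<bar> \<le> 12 * B"
      by (rule order_trans[OF mult_in_unit_abs[OF Xx(1,2)] ob0(1)], rule order_trans[OF mult_in_unit_abs[OF Xx(3,4)] ob1(1)],
          rule order_trans[OF mult_in_unit_abs[OF Xx(1,2)] ob0(2)], rule order_trans[OF mult_in_unit_abs[OF Xx(3,4)] ob1(2)])
    show "\<bar>a + neg_laplacian v x\<bar> \<le> R"
      by (rule order_trans[OF abs_add_le[OF al(1) abs_le_of_diff3[OF order_trans[OF lam(1) \<tau>t] wX m(1,2)]] R12(3)])
    show "\<bar>c + mixed v x\<bar> \<le> R"
      by (rule order_trans[OF abs_add_le[OF al(2) abs_le_of_diff3[OF order_trans[OF lam(2) \<tau>t] swX m(3,4)]] R12(4)])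
  qed
  have "real (b - 2 * t) / n * average M P0 + real (n - b) / n * average M P1 - e / 4 - 2 * t * K / n \<le> average (int n * M) G"
  proof (rule laminate_average[where s=s])
    show "periodic2 (int n * M) G" unfolding G_def L_def[symmetric]
      by (intro periodic2_comp2[of L "neg_laplacian v" "mixed v" "\<lambda>u z. defect S p (a + u) (c + z)"] periodic2_operators pv)
    show "periodic2 M P0" unfolding P0_def
      by (intro periodic2_comp2[of M "neg_laplacian v0" "mixed v0" "\<lambda>u z. defect S p (a0 + u) (b0 + z)"] periodic2_operators v)
    show "periodic2 M P1" unfolding P1_def
      by (intro periodic2_comp2[of M "neg_laplacian v1" "mixed v1" "\<lambda>u z. defect S p (a1 + u) (b1 + z)"] periodic2_operators v)
    show "- K \<le> G x" for x using Kb[OF inG, of x x] by (simp add: G_def abs_le_iff)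
    show "P0 x - e / 4 \<le> G x" if "int t * M \<le> fst x + s * snd x" "fst x + s * snd x < int b * M - int t * M" for x
    proof -
      have Xk: "X (k x) = 1" using that X(5)[of "k x"] by (simp add: k_def T_def Rr_def)
      have eq: "(a + neg_laplacian v x) - (a0 + neg_laplacian v0 x) =
          (neg_laplacian v x - (w * (X (k x) - \<mu>) + X (k x) * neg_laplacian v0 x + (1 - X (k x)) * neg_laplacian v1 x)) + (w * l - w * \<mu>)"
        "(c + mixed v x) - (b0 + mixed v0 x) =
          (mixed v x - (of_int s * (w * (X (k x) - \<mu>)) + X (k x) * mixed v0 x + (1 - X (k x)) * mixed v1 x)) + of_int s * (w * l - w * \<mu>)"
        unfolding a(2) c(2) Xk by (simp_all add: algebra_simps)
      have "\<bar>(a + neg_laplacian v x) - (a0 + neg_laplacian v0 x)\<bar> < d"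
        unfolding eq by (rule abs_add_less[OF lam(1) td wl])
      moreover have "\<bar>(c + mixed v x) - (b0 + mixed v0 x)\<bar> < d"
        unfolding eq by (rule abs_add_less[OF lam(2) td]) (unfold abs_s, rule wl)
      ultimately show ?thesis
        using uni[OF inG in0, of x x x x] unfolding G_def P0_def abs_less_iff by linarith
    qed
    show "P1 x - e / 4 \<le> G x" if "int b * M \<le> fst x + s * snd x" "fst x + s * snd x < int n * M" for x
    proof -
      have Xk: "X (k x) = 0" using that X(6)[of "k x"] by (simp add: k_def L_def Rr_def)
      have eq: "(a + neg_laplacian v x) - (a1 + neg_laplacian v1 x) =
          (neg_laplacian v x - (w * (X (k x) - \<mu>) + X (k x) * neg_laplacian v0 x + (1 - X (k x)) * neg_laplacian v1 x)) + (w * l - w * \<mu>)"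
        "(c + mixed v x) - (b1 + mixed v1 x) =
          (mixed v x - (of_int s * (w * (X (k x) - \<mu>)) + X (k x) * mixed v0 x + (1 - X (k x)) * mixed v1 x)) + of_int s * (w * l - w * \<mu>)"
        unfolding a(1) c(1) Xk by (simp_all add: algebra_simps)
      have "\<bar>(a + neg_laplacian v x) - (a1 + neg_laplacian v1 x)\<bar> < d"
        unfolding eq by (rule abs_add_less[OF lam(1) td wl])
      moreover have "\<bar>(c + mixed v x) - (b1 + mixed v1 x)\<bar> < d"
        unfolding eq by (rule abs_add_less[OF lam(2) td]) (unfold abs_s, rule wl)
      ultimately show ?thesis
        using uni[OF inG in1, of x x x x] unfolding G_def P1_def abs_less_iff by linarith
    qed
  qed (use b2t bn n0 e in auto)
  then have main: "real (b - 2 * t) / n * J0 + real (n - b) / n * J1 - e / 4 - 2 * t * K / n \<le> mean_defect S p a c L v"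
    unfolding J0_def J1_def mean_defect_def P0_def P1_def G_def L_def .
  have "l * J0 + (1 - l) * J1 - e \<le> real (b - 2 * t) / n * J0 + real (n - b) / n * J1 - e / 4 - 2 * t * K / n"
  proof -
    define N where "N = real n"
    define \<beta> where "\<beta> = real b / N"
    have N: "0 < N" using n0 by (simp add: N_def)
    have "\<beta> \<le> l" "l \<le> (real b + 1) / N" using bf N by (simp_all add: \<beta>_def N_def[symmetric] field_simps)
    then have \<beta>: "\<beta> \<le> l" "l - \<beta> \<le> 1 / N" by (simp_all add: \<beta>_def add_divide_distrib)
    have r: "real (b - 2 * t) / n = \<beta> - 2 * real t / N" "real (n - b) / n = 1 - \<beta>"
      using b2t bn N by (simp_all add: \<beta>_def N_def of_nat_diff field_simps)
    have 1: "(l - \<beta>) * J0 \<le> 1 / N * \<bar>J0\<bar>"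
    proof -
      have "(l - \<beta>) * J0 \<le> (l - \<beta>) * \<bar>J0\<bar>" using \<beta> by (intro mult_left_mono) auto
      also have "\<dots> \<le> 1 / N * \<bar>J0\<bar>" using \<beta> by (intro mult_right_mono) auto
      finally show ?thesis .
    qed
    have 2: "(\<beta> - l) * J1 \<le> 1 / N * \<bar>J1\<bar>"
    proof -
      have "(\<beta> - l) * J1 \<le> \<bar>(\<beta> - l) * J1\<bar>" by simp
      also have "\<dots> = (l - \<beta>) * \<bar>J1\<bar>" using \<beta> by (simp add: abs_mult)
      also have "\<dots> \<le> 1 / N * \<bar>J1\<bar>" using \<beta> by (intro mult_right_mono) auto
      finally show ?thesis .
    qed
    have 3: "2 * real t / N * J0 \<le> 2 * real t / N * \<bar>J0\<bar>" using N by (intro mult_left_mono) auto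
    have 4: "1 / N * \<bar>J0\<bar> + 2 * real t / N * \<bar>J0\<bar> + 1 / N * \<bar>J1\<bar> + 2 * real t * K / N \<le> e / 4"
    proof -
      have "((2 * real t + 1) * \<bar>J0\<bar> + \<bar>J1\<bar> + 2 * real t * K) * 4 < N * e"
        using n e unfolding c3_def N_def by (simp add: pos_divide_less_eq)
      then show ?thesis using N by (simp add: field_simps)
    qed
    have eq: "2 * t * K / n = 2 * real t * K / N" by (simp add: N_def)
    have "(l * J0 + (1 - l) * J1) - ((\<beta> - 2 * real t / N) * J0 + (1 - \<beta>) * J1) =
        (l - \<beta>) * J0 + (\<beta> - l) * J1 + 2 * real t / N * J0"
      by (simp add: algebra_simps)
    then show ?thesis unfolding r eq by (rule laminate_arith[OF _ 1 2 3 4 e])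
  qed
  then show ?thesis using main pv unfolding a_def c_def J0_def J1_def by (intro exI[of _ L] exI[of _ v]) auto
qed

subsection \<open>Truncation of periodic functions\<close>

lemma card_square: "real (card ({a..<b} \<times> {a..<b::int})) = (real_of_int (b - a))\<^sup>2" if "a \<le> b"
  using that by (simp add: card_cartesian_product power2_eq_square)

text \<open>A block of \<open>K\<close> by \<open>K\<close> periods is cut out and extended by 0,
  which makes it admissible in \<open>H\<close>. Only sites near the boundary notice; their number
  is of order \<open>K\<close> against \<open>K\<^sup>2\<close> in the block, so their share tends
  to 0.\<close>

lemma mean_defect_zero_nonpos:
  fixes S p :: real
  assumes p: "1 < p" and S: "0 \<le> S"
    and H: "\<And>u A. finsupp u \<Longrightarrow> finite A \<Longrightarrow>
      (\<Sum>x\<in>A. \<bar>mixed u x\<bar> powr p) \<le> S powr p * total (\<lambda>x. \<bar>neg_laplacian u x\<bar> powr p)"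
    and v: "periodic2 M v"
  shows "mean_defect S p 0 0 M v \<le> 0"
proof -
  have M: "0 < M" using v by (simp add: periodic2_def)
  obtain B where B: "\<And>x. \<bar>v x\<bar> \<le> B" using periodic2_bounded[OF v] by blast
  have B0: "0 \<le> B" using order_trans[OF abs_ge_zero B] .
  define c where "c = (12 * B) powr p"
  have c: "0 \<le> c" by (simp add: c_def)
  define l where "l = (\<lambda>x. \<bar>neg_laplacian v x\<bar> powr p)"
  define m where "m = (\<lambda>x. \<bar>mixed v x\<bar> powr p)"
  have pl: "periodic2 M l" "periodic2 M m"
    using periodic2_operators[OF v] unfolding l_def m_def periodic2_def by simp_all
  define D where "D = real_of_int M * (8 * S powr p + 4) * c"
  have key: "sum m (cell M) - S powr p * sum l (cell M) \<le> D / real K" if K: "2 \<le> K" for K :: nat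
  proof -
    define N where "N = int K * M"
    have N: "2 \<le> N" using mult_mono[of 2 "int K" 1 M] K M by (simp add: N_def)
    define u where "u = (\<lambda>x. if x \<in> cell N then v x else 0)"
    \<comment> \<open>\<open>I\<close> holds the sites whose stencil stays in the cell,
      \<open>Q\<close> all those whose stencil may meet it. They differ by
      \<open>(N + 2)\<^sup>2 - (N - 2)\<^sup>2 = 8 * N\<close> sites.\<close>
    define I where "I = {1..<N - 1} \<times> {1..<N - 1}"
    define Q where "Q = {-1..<N + 1} \<times> {-1..<N + 1}"
    have fin: "finite I" "finite Q" "finite (cell N)" by (simp_all add: I_def Q_def cell_def)
    have sub: "I \<subseteq> cell N" "cell N \<subseteq> Q" "I \<subseteq> Q" by (auto simp: I_def Q_def cell_def)
    have cards: "real (card I) = (real_of_int N - 2)\<^sup>2" "real (card Q) = (real_of_int N + 2)\<^sup>2" "real (card (cell N)) = (real_of_int N)\<^sup>2"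
      using N card_square[of 1 "N - 1"] card_square[of "-1" "N + 1"] card_square[of 0 N] by (simp_all add: I_def Q_def cell_def)
    have cd: "real (card (Q - I)) = 8 * real_of_int N" "real (card (cell N - I)) \<le> 4 * real_of_int N"
      using sub fin cards card_mono[OF fin(2) sub(3)] card_mono[OF fin(3) sub(1)]
      by (simp_all add: card_Diff_subset of_nat_diff power2_eq_square algebra_simps)
    have fu: "finsupp u" by (rule finite_subset[OF _ fin(3)]) (auto simp: u_def)
    have ub: "\<bar>u x\<bar> \<le> B" for x using B B0 by (simp add: u_def)
    have u_in: "u (x + (a, b)) = v (x + (a, b))" "u x = v x" if "x \<in> I" "\<bar>a\<bar> \<le> 1" "\<bar>b\<bar> \<le> 1" for x :: "int \<times> int" and a b
    proof -
      have "x + (a, b) \<in> cell N" "x \<in> cell N" using that by (cases x; force simp: I_def cell_def)+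
      then show "u (x + (a, b)) = v (x + (a, b))" "u x = v x" by (simp_all add: u_def)
    qed
    have u_out: "u (x + (a, b)) = 0" "u x = 0" if "x \<notin> Q" "\<bar>a\<bar> \<le> 1" "\<bar>b\<bar> \<le> 1" for x :: "int \<times> int" and a b
    proof -
      have "x + (a, b) \<notin> cell N" "x \<notin> cell N" using that by (cases x; force simp: Q_def cell_def)+
      then show "u (x + (a, b)) = 0" "u x = 0" by (simp_all add: u_def)
    qed
    have inner: "neg_laplacian u x = neg_laplacian v x" "mixed u x = mixed v x" if "x \<in> I" for x
      unfolding mixed_def neg_laplacian_def diag_laplacian_def by (simp_all add: u_in(1)[OF that] u_in(2)[OF that, of 0 0])
    have outer: "neg_laplacian u x = 0" if "x \<notin> Q" for x
      unfolding neg_laplacian_def by (simp add: u_out(1)[OF that] u_out(2)[OF that, of 0 0])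
    have lu: "\<bar>neg_laplacian u x\<bar> powr p \<le> c" for x
      unfolding c_def using operators_bounded(1)[of u B x, OF ub] B0 p by (intro powr_mono2) auto
    have mv: "m x \<le> c" for x
      unfolding m_def c_def using operators_bounded(2)[of v B x, OF B] B0 p by (intro powr_mono2) auto
    have "sum m (cell N) = sum m I + sum m (cell N - I)"
      using sum.subset_diff[OF sub(1) fin(3), of m] by simp
    also have "sum m (cell N - I) \<le> real (card (cell N - I)) * c"
      by (rule sum_bounded_above[OF mv])
    also have "\<dots> \<le> 4 * real_of_int N * c" using cd c by (intro mult_right_mono) auto
    also have "sum m I = (\<Sum>x\<in>I. \<bar>mixed u x\<bar> powr p)"
      by (intro sum.cong refl) (simp add: m_def inner)
    also have "\<dots> \<le> S powr p * total (\<lambda>x. \<bar>neg_laplacian u x\<bar> powr p)" by (rule H[OF fu fin(1)])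
    also have "total (\<lambda>x. \<bar>neg_laplacian u x\<bar> powr p) = (\<Sum>x\<in>Q. \<bar>neg_laplacian u x\<bar> powr p)"
      using outer by (intro total_superset fin) auto
    also have "\<dots> = (\<Sum>x\<in>I. \<bar>neg_laplacian u x\<bar> powr p) + (\<Sum>x\<in>Q - I. \<bar>neg_laplacian u x\<bar> powr p)"
      using sum.subset_diff[OF sub(3) fin(2), of "\<lambda>x. \<bar>neg_laplacian u x\<bar> powr p"] by simp
    also have "(\<Sum>x\<in>I. \<bar>neg_laplacian u x\<bar> powr p) = sum l I"
      by (intro sum.cong refl) (simp add: l_def inner)
    finally have 1: "sum m (cell N) \<le> S powr p * (sum l I + (\<Sum>x\<in>Q - I. \<bar>neg_laplacian u x\<bar> powr p)) + 4 * real_of_int N * c"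
      by simp
    have "sum l I \<le> sum l (cell N)" by (rule sum_mono2[OF fin(3) sub(1)]) (simp add: l_def)
    moreover have "(\<Sum>x\<in>Q - I. \<bar>neg_laplacian u x\<bar> powr p) \<le> 8 * real_of_int N * c"
      using sum_bounded_above[of "Q - I" "\<lambda>x. \<bar>neg_laplacian u x\<bar> powr p" c] lu cd by simp
    ultimately have "S powr p * (sum l I + (\<Sum>x\<in>Q - I. \<bar>neg_laplacian u x\<bar> powr p)) \<le> S powr p * (sum l (cell N) + 8 * real_of_int N * c)"
      by (intro mult_left_mono) auto
    with 1 have "sum m (cell N) - S powr p * sum l (cell N) \<le> real K * D"
      by (simp add: D_def N_def algebra_simps)
    moreover have "sum m (cell N) - S powr p * sum l (cell N) = (real K)\<^sup>2 * (sum m (cell M) - S powr p * sum l (cell M))"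
      unfolding N_def sum_cell_multiple[OF pl(1)] sum_cell_multiple[OF pl(2)] by (simp add: algebra_simps)
    ultimately have "real K * (real K * (sum m (cell M) - S powr p * sum l (cell M))) \<le> real K * D"
      by (simp add: power2_eq_square mult.assoc)
    then have "real K * (sum m (cell M) - S powr p * sum l (cell M)) \<le> D" using K by simp
    then show ?thesis using K by (simp add: pos_le_divide_eq mult.commute)
  qed
  have "(\<lambda>K. D / real K) \<longlonglongrightarrow> 0" by (rule lim_const_over_n)
  then have "sum m (cell M) - S powr p * sum l (cell M) \<le> 0"
    by (rule LIMSEQ_le_const) (use key in blast)
  moreover have "mean_defect S p 0 0 M v = (sum m (cell M) - S powr p * sum l (cell M)) / (of_int M)\<^sup>2"
    by (simp add: mean_defect_def average_def defect_def m_def l_def sum_subtractf sum_distrib_left)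
  ultimately show ?thesis by (simp add: divide_nonpos_nonneg)
qed

subsection \<open>The lower bound\<close>

text \<open>Burkholder's staircase along the axis \<open>a = 0\<close>, leaving it only towards the rays
  \<open>b = (p - 1) \<bar>a\<bar>\<close>.  By homogeneity two of its steps suffice.\<close>

definition laminate_values :: "real \<Rightarrow> real \<Rightarrow> real \<Rightarrow> real \<Rightarrow> real set" where
  "laminate_values S p a b = {mean_defect S p a b M v | M v. periodic2 M v}"

lemma defect_in_values: "defect S p a b \<in> laminate_values S p a b"
proof -
  have "mean_defect S p a b 1 (\<lambda>_. 0) = defect S p a b"
    by (simp add: mean_defect_def average_def cell_def neg_laplacian_def mixed_def diag_laplacian_def)
  moreover have "periodic2 1 (\<lambda>_. 0)" by (simp add: periodic2_def)
  ultimately show ?thesis unfolding laminate_values_def by force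
qed

lemma mean_defect_multiple:
  assumes v: "periodic2 M v" and n: "0 < n"
  shows "mean_defect S p a b (int n * M) v = mean_defect S p a b M v"
  unfolding mean_defect_def
  by (rule average_multiple[OF periodic2_comp2[OF periodic2_operators[OF v], of "\<lambda>u z. defect S p (a + u) (b + z)"] n])

text \<open>\<open>lamination\<close> wants a common period. The product of the two periods is one,
  and passing to it leaves the means unchanged.\<close>

lemma values_lamination:
  assumes p: "0 < p" and s: "s = 1 \<or> s = -1" and dir: "b0 - b1 = of_int s * (a0 - a1)" and l: "0 < l" "l < 1" and e: "0 < e"
    and m0: "m0 \<in> laminate_values S p a0 b0" and m1: "m1 \<in> laminate_values S p a1 b1"
    and ab: "a = l * a0 + (1 - l) * a1" "b = l * b0 + (1 - l) * b1"
  shows "\<exists>m\<in>laminate_values S p a b. l * m0 + (1 - l) * m1 - e \<le> m"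
proof -
  obtain M0 v0 M1 v1 where v: "periodic2 M0 v0" "periodic2 M1 v1" and m: "m0 = mean_defect S p a0 b0 M0 v0" "m1 = mean_defect S p a1 b1 M1 v1"
    using m0 m1 unfolding laminate_values_def by blast
  have M: "0 < M0" "0 < M1" using v by (simp_all add: periodic2_def)
  define M where "M = M1 * M0"
  have "periodic2 (M1 * M0) v0" "periodic2 (M0 * M1) v1" using periodic2_multiple v M by blast+
  then have pv: "periodic2 M v0" "periodic2 M v1" by (simp_all add: M_def mult.commute)
  have "mean_defect S p a0 b0 M v0 = m0" "mean_defect S p a1 b1 M v1 = m1"
    using mean_defect_multiple[OF v(1), of "nat M1" S p a0 b0] mean_defect_multiple[OF v(2), of "nat M0" S p a1 b1] M
    by (simp_all add: M_def m mult.commute)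
  then show ?thesis using lamination[OF p pv s dir l e, of S] unfolding ab laminate_values_def by auto
qed

lemma values_scale:
  assumes c: "0 < c" and m: "m \<in> laminate_values S p a b"
  shows "c powr p * m \<in> laminate_values S p (c * a) (c * b)"
proof -
  obtain M v where v: "periodic2 M v" "m = mean_defect S p a b M v" using m unfolding laminate_values_def by blast
  have d: "defect S p (c * x) (c * y) = c powr p * defect S p x y" for x y
    using c by (simp add: defect_def abs_mult powr_mult algebra_simps)
  have "mean_defect S p (c * a) (c * b) M (\<lambda>x. c * v x) = c powr p * m"
    unfolding v(2) mean_defect_def average_def operators_add(3,4) distrib_left[symmetric] d
    by (simp add: sum_distrib_left)
  moreover have "periodic2 M (\<lambda>x. c * v x)" using v(1) by (simp add: periodic2_def)
  ultimately show ?thesis unfolding laminate_values_def by (metis (mono_tags, lifting) mem_Collect_eq)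
qed

text \<open>Finiteness spreads along zigzag directions: \<open>(a, b)\<close> is the midpoint of two
  points, and \<open>(a1, b1)\<close> attains at least its own \<open>defect\<close>, so large
  values at \<open>(a0, b0)\<close> would force large values at the midpoint.\<close>

lemma values_bounded:
  assumes p: "0 < p" and s: "s = 1 \<or> s = -1" and dir: "b0 - b1 = of_int s * (a0 - a1)"
    and ab: "a = 1/2 * a0 + (1 - 1/2) * a1" "b = 1/2 * b0 + (1 - 1/2) * b1"
    and K: "\<And>m. m \<in> laminate_values S p a b \<Longrightarrow> m \<le> K" and m: "m \<in> laminate_values S p a0 b0"
  shows "m \<le> 2 * K + 2 - defect S p a1 b1"
proof -
  obtain m' where "m' \<in> laminate_values S p a b" "1/2 * m + (1 - 1/2) * defect S p a1 b1 - 1 \<le> m'"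
    using values_lamination[OF p s dir _ _ zero_less_one m defect_in_values ab] by auto
  with K[of m'] show ?thesis by simp
qed

lemma bernoulli_powr:
  fixes p d :: real assumes "2 \<le> p" "0 \<le> d"
  shows "1 + 2 * (p - 1) * d \<le> (1 + 2 * d) powr (p - 1)"
proof -
  have "(1 + 2 * (p - 1) * d) powr (1 / (p - 1)) * 1 powr (1 - 1 / (p - 1)) \<le> 1 / (p - 1) * (1 + 2 * (p - 1) * d) + (1 - 1 / (p - 1)) * 1"
    using assms by (intro Youngs_inequality_0) (auto simp: add_pos_nonneg)
  also have "1 / (p - 1) * (1 + 2 * (p - 1) * d) = 1 / (p - 1) + 2 * d"
    using assms by (simp add: field_simps)
  also have "1 / (p - 1) + 2 * d + (1 - 1 / (p - 1)) * 1 = 1 + 2 * d" by simp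
  finally have "((1 + 2 * (p - 1) * d) powr (1 / (p - 1))) powr (p - 1) \<le> (1 + 2 * d) powr (p - 1)"
    using assms by (intro powr_mono2) auto
  then show ?thesis using assms by (simp add: powr_powr add_nonneg_nonneg)
qed

text \<open>If \<open>S < p - 1\<close>, the defect is positive on the rays where the staircase
  exits. Two splittings lead from \<open>(0, 1)\<close> to \<open>(0, 1 + 2 * d)\<close> and, by
  homogeneity, compare the supremum \<sigma> at \<open>(0, 1)\<close> with itself. The first order
  terms in \<sigma> cancel, while the exits gain an amount of order \<open>d\<close>: a
  contradiction for small \<open>d\<close>.\<close>

lemma lower_bound_ge2:
  fixes S p :: real
  assumes p: "2 \<le> p" and S: "0 \<le> S"
    and H: "\<And>u A. finsupp u \<Longrightarrow> finite A \<Longrightarrow>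
      (\<Sum>x\<in>A. \<bar>mixed u x\<bar> powr p) \<le> S powr p * total (\<lambda>x. \<bar>neg_laplacian u x\<bar> powr p)"
  shows "p - 1 \<le> S"
proof (rule ccontr)
  assume "\<not> p - 1 \<le> S"
  then have Sp: "S < p - 1" by simp
  let ?V = "laminate_values S p"
  \<comment> \<open>The defect where the ray \<open>b = (p - 1) * a\<close> meets the line
    \<open>a + b = 1\<close> through \<open>(0, 1)\<close>.\<close>
  define \<nu> where "\<nu> = defect S p (1 / p) ((p - 1) / p)"
  have \<nu>: "0 < \<nu>"
  proof -
    have "S powr p < (p - 1) powr p" using Sp S p by (intro powr_less_mono2) auto
    then have "S powr p * (1 / p) powr p < (p - 1) powr p * (1 / p) powr p" using p by simp
    then show ?thesis using p by (simp add: \<nu>_def defect_def powr_divide)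
  qed
  have p0: "0 < p" "1 < p" using p by simp_all
  have b0: "m \<le> 0" if "m \<in> ?V 0 0" for m
    using that mean_defect_zero_nonpos[OF p0(2) S H] unfolding laminate_values_def by blast
  \<comment> \<open>Finiteness at \<open>(0, 1)\<close> is reached from \<open>(0, 0)\<close>
    through \<open>(1/2, 1/2)\<close>, along (1, 1) and then along (-1, 1).\<close>
  have b1: "m \<le> 2 * 0 + 2 - defect S p (-1/2) (-1/2)" if "m \<in> ?V (1/2) (1/2)" for m
    by (rule values_bounded[OF p0(1), of 1 "1/2" "-1/2" "1/2" "-1/2" 0 0]) (use that b0 in auto)
  obtain K where K: "\<And>m. m \<in> ?V 0 1 \<Longrightarrow> m \<le> K"
  proof
    show "m \<le> 2 * (2 * 0 + 2 - defect S p (-1/2) (-1/2)) + 2 - defect S p 1 0" if "m \<in> ?V 0 1" for m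
      by (rule values_bounded[OF p0(1), of "-1" 1 0 0 1 "1/2" "1/2"]) (use that b1 in auto)
  qed
  have bdd: "bdd_above (?V 0 1)" using K by (meson bdd_aboveI)
  define \<sigma> where "\<sigma> = Sup (?V 0 1)"
  have upper: "m \<le> \<sigma>" if "m \<in> ?V 0 1" for m unfolding \<sigma>_def by (rule cSup_upper[OF that bdd])
  have "1 \<le> \<sigma>" using upper[OF defect_in_values] by (simp add: defect_def)
  \<comment> \<open>The first bound keeps the weights below 1 and \<open>1 + (2 - p) * d\<close>
    positive; the second makes the second order term in \<sigma> at most half of the gain.\<close>
  define d where "d = min (1 / (2 * p)) (\<nu> / (2 * p * \<sigma>))"
  have d: "0 < d" "d \<le> 1 / (2 * p)" "d \<le> \<nu> / (2 * p * \<sigma>)" using p \<nu> \<open>1 \<le> \<sigma>\<close> by (auto simp: d_def)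
  have dp: "p * d \<le> 1/2" using d(2) p by (simp add: field_simps)
  let ?t = "1 + 2 * d"
  let ?Y = "?t powr (p - 1)"
  \<comment> \<open>Weights of the exits: \<open>(0, 1)\<close> splits into
    \<open>(d, 1 + d)\<close> and \<open>(- 1/p, (p - 1)/p)\<close>, and \<open>(d, 1 + d)\<close>
    into \<open>(0, ?t)\<close> and \<open>?t\<close> times \<open>(1/p, (p - 1)/p)\<close>.\<close>
  define \<pi>1 where "\<pi>1 = p * d / (1 + p * d)"
  define \<pi>2 where "\<pi>2 = p * d / ?t"
  have pd: "0 < p * d" using p d by simp
  have \<pi>: "0 < \<pi>1" "\<pi>1 < 1" "0 < \<pi>2" "\<pi>2 < 1" using d pd dp by (auto simp: \<pi>1_def \<pi>2_def divide_less_eq add_pos_pos)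
  have tp: "?t powr p = ?t * ?Y" using d powr_add[of ?t "p - 1" 1] by simp
  have step: "(1 - \<pi>1) * ((1 - \<pi>2) * (?t powr p * m) + \<pi>2 * (?t powr p * \<nu>)) + \<pi>1 * \<nu> \<le> \<sigma>" if m: "m \<in> ?V 0 1" for m
  proof (rule field_le_epsilon)
    fix e :: real assume "0 < e"
    then have e2: "0 < e / 2" by simp
    have t: "0 < ?t" using d by simp
    have v: "?t powr p * \<nu> \<in> ?V (?t * (1 / p)) (?t * ((p - 1) / p))"
      unfolding \<nu>_def by (rule values_scale[OF t defect_in_values])
    have m': "?t powr p * m \<in> ?V 0 ?t" using values_scale[OF t m] by simp
    have \<pi>2t: "\<pi>2 * ?t = p * d" using t by (simp add: \<pi>2_def)
    have "\<exists>m2\<in>?V d (1 + d). (1 - \<pi>2) * (?t powr p * m) + (1 - (1 - \<pi>2)) * (?t powr p * \<nu>) - e / 2 \<le> m2"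
    proof (rule values_lamination[OF p0(1), of "-1", OF _ _ _ _ e2 m' v])
      show "?t - ?t * ((p - 1) / p) = of_int (-1) * (0 - ?t * (1 / p))" using p by (simp add: field_simps)
      have "(1 - (1 - \<pi>2)) * (?t * (1 / p)) = (\<pi>2 * ?t) * (1 / p)" by simp
      then show "d = (1 - \<pi>2) * 0 + (1 - (1 - \<pi>2)) * (?t * (1 / p))" unfolding \<pi>2t using p by simp
      have "(1 - \<pi>2) * ?t + (1 - (1 - \<pi>2)) * (?t * ((p - 1) / p)) = ?t - (\<pi>2 * ?t) * (1 - (p - 1) / p)" by (simp add: algebra_simps)
      also have "1 - (p - 1) / p = 1 / p" using p by (simp add: field_simps)
      finally show "1 + d = (1 - \<pi>2) * ?t + (1 - (1 - \<pi>2)) * (?t * ((p - 1) / p))" unfolding \<pi>2t using p by simp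
    qed (use \<pi> in auto)
    then obtain m2 where m2: "m2 \<in> ?V d (1 + d)" "(1 - \<pi>2) * (?t powr p * m) + \<pi>2 * (?t powr p * \<nu>) - e / 2 \<le> m2" by auto
    have v': "\<nu> \<in> ?V (- (1 / p)) ((p - 1) / p)"
    proof -
      have "\<nu> = defect S p (- (1 / p)) ((p - 1) / p)" by (simp add: \<nu>_def defect_def)
      then show ?thesis using defect_in_values[of S p "- (1 / p)" "(p - 1) / p"] by simp
    qed
    have \<pi>1d: "(1 - \<pi>1) * d = \<pi>1 * (1 / p)" using pd p by (simp add: \<pi>1_def field_simps)
    have "\<exists>m1\<in>?V 0 1. (1 - \<pi>1) * m2 + (1 - (1 - \<pi>1)) * \<nu> - e / 2 \<le> m1"
    proof (rule values_lamination[OF p0(1), of 1, OF _ _ _ _ e2 m2(1) v'])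
      show "1 + d - (p - 1) / p = of_int 1 * (d - - (1 / p))" using p by (simp add: field_simps)
      show "0 = (1 - \<pi>1) * d + (1 - (1 - \<pi>1)) * - (1 / p)" unfolding \<pi>1d by simp
      have q: "(p - 1) / p = 1 - 1 / p" using p by (simp add: field_simps)
      have "(1 - \<pi>1) * (1 + d) + (1 - (1 - \<pi>1)) * (1 - 1 / p) = 1 + (1 - \<pi>1) * d - \<pi>1 * (1 / p)" by (simp add: algebra_simps)
      then show "1 = (1 - \<pi>1) * (1 + d) + (1 - (1 - \<pi>1)) * ((p - 1) / p)" unfolding q \<pi>1d by simp
    qed (use \<pi> in auto)
    then obtain m1 where m1: "m1 \<in> ?V 0 1" "(1 - \<pi>1) * m2 + \<pi>1 * \<nu> - e / 2 \<le> m1" by auto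
    have "(1 - \<pi>1) * ((1 - \<pi>2) * (?t powr p * m) + \<pi>2 * (?t powr p * \<nu>) - e / 2) \<le> (1 - \<pi>1) * m2"
      using \<pi> m2(2) by (intro mult_left_mono) auto
    moreover have "(1 - \<pi>1) * (e / 2) \<le> e / 2" using \<pi> \<open>0 < e\<close> by (intro mult_left_le_one_le) auto
    ultimately show "(1 - \<pi>1) * ((1 - \<pi>2) * (?t powr p * m) + \<pi>2 * (?t powr p * \<nu>)) + \<pi>1 * \<nu> \<le> \<sigma> + e"
      using m1(2) upper[OF m1(1)] unfolding right_diff_distrib by linarith
  qed
  have c1: "(1 + p * d) * (1 - \<pi>1) = 1" "(1 + p * d) * \<pi>1 = p * d" using pd by (simp_all add: \<pi>1_def field_simps)
  have "\<pi>2 * ?t = p * d" using d by (simp add: \<pi>2_def)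
  then have c2: "(1 - \<pi>2) * ?t = 1 + (2 - p) * d" "\<pi>2 * ?t = p * d" by (simp_all only: left_diff_distrib) simp
  define k where "k = (1 + (2 - p) * d) * ?Y"
  have dp2: "0 < 1 + (2 - p) * d" using dp d by (simp add: algebra_simps)
  have Y1: "1 + 2 * (p - 1) * d \<le> ?Y" using bernoulli_powr[OF p] d by simp
  have k: "0 < k" unfolding k_def using dp2 d by simp
  have alg: "q * ((1 - a) * ((1 - b) * (t * Y * m) + b * (t * Y * n)) + a * n) =
      (q * (1 - a)) * (((1 - b) * t) * (Y * m) + (b * t) * (Y * n)) + (q * a) * n" for q a b t Y m n :: real
    by (simp add: algebra_simps)
  have "k * m + p * d * (?Y * \<nu>) + p * d * \<nu> \<le> (1 + p * d) * \<sigma>" if "m \<in> ?V 0 1" for m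
  proof -
    have "(1 + p * d) * ((1 - \<pi>1) * ((1 - \<pi>2) * (?t powr p * m) + \<pi>2 * (?t powr p * \<nu>)) + \<pi>1 * \<nu>) \<le> (1 + p * d) * \<sigma>"
      using step[OF that] pd by (intro mult_left_mono) auto
    also have "(1 + p * d) * ((1 - \<pi>1) * ((1 - \<pi>2) * (?t powr p * m) + \<pi>2 * (?t powr p * \<nu>)) + \<pi>1 * \<nu>) =
      ((1 + p * d) * (1 - \<pi>1)) * (((1 - \<pi>2) * ?t) * (?Y * m) + (\<pi>2 * ?t) * (?Y * \<nu>)) + ((1 + p * d) * \<pi>1) * \<nu>"
      unfolding tp by (rule alg)
    finally show ?thesis unfolding c1 c2 k_def by (simp add: mult_ac)
  qed
  then have "m * k \<le> (1 + p * d) * \<sigma> - p * d * (?Y * \<nu>) - p * d * \<nu>" if "m \<in> ?V 0 1" for m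
    using that by (fastforce simp: mult.commute[of m k])
  then have "m \<le> ((1 + p * d) * \<sigma> - p * d * (?Y * \<nu>) - p * d * \<nu>) / k" if "m \<in> ?V 0 1" for m
    using that k by (simp only: pos_le_divide_eq)
  then have "\<sigma> \<le> ((1 + p * d) * \<sigma> - p * d * (?Y * \<nu>) - p * d * \<nu>) / k"
    unfolding \<sigma>_def using defect_in_values[of S p 0 1] by (intro cSup_least) auto
  then have main: "k * \<sigma> + p * d * (?Y * \<nu>) + p * d * \<nu> \<le> (1 + p * d) * \<sigma>"
    using k by (simp add: pos_le_divide_eq algebra_simps)
  have "(1 + (2 - p) * d) * (1 + 2 * (p - 1) * d) * \<sigma> \<le> k * \<sigma>"
    unfolding k_def using Y1 dp2 \<open>1 \<le> \<sigma>\<close> by (intro mult_right_mono mult_left_mono) auto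
  moreover have "p * d * \<nu> \<le> p * d * (?Y * \<nu>)"
  proof -
    have "1 \<le> ?Y" using Y1 p d mult_nonneg_nonneg[of "p - 1" d] by linarith
    then have "1 * \<nu> \<le> ?Y * \<nu>" using \<nu> by (intro mult_right_mono) auto
    then have "p * d * (1 * \<nu>) \<le> p * d * (?Y * \<nu>)" using pd by (intro mult_left_mono) auto
    then show ?thesis by simp
  qed
  ultimately have "(1 + (2 - p) * d) * (1 + 2 * (p - 1) * d) * \<sigma> + 2 * (p * d * \<nu>) \<le> (1 + p * d) * \<sigma>" using main by linarith
  \<comment> \<open>\<open>(2 - p) * d\<close> and \<open>2 * (p - 1) * d\<close> add up to
    \<open>p * d\<close>, the coefficient on the other side: this is the cancellation to first
    order.\<close>
  moreover have "(1 + (2 - p) * d) * (1 + 2 * (p - 1) * d) * \<sigma> = (1 + p * d) * \<sigma> - 2 * d * ((p - 1) * (p - 2) * d * \<sigma>)"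
    by (simp add: algebra_simps power2_eq_square)
  ultimately have "2 * d * (p * \<nu>) \<le> 2 * d * ((p - 1) * (p - 2) * d * \<sigma>)" by (simp add: mult_ac)
  then have "p * \<nu> \<le> (p - 1) * (p - 2) * d * \<sigma>" using d by simp
  also have "\<dots> = ((p - 1) * (p - 2)) * (d * \<sigma>)" by simp
  also have "\<dots> \<le> (p * p) * (d * \<sigma>)"
    using p d \<open>1 \<le> \<sigma>\<close> by (intro mult_right_mono mult_mono) auto
  also have "\<dots> \<le> (p * p) * (\<nu> / (2 * p))"
    using d(3) p \<open>1 \<le> \<sigma>\<close> by (intro mult_left_mono) (auto simp: field_simps)
  also have "\<dots> = p * \<nu> / 2" using p by simp
  finally show False using p \<nu> by simp
qed

subsection \<open>The norm\<close>

text \<open>Below 2 the same \<open>S\<close> bounds the operator for the conjugate exponent, by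
  symmetry and duality, and the case above 2 applies there with
  \<open>q - 1 = 1 / (p - 1)\<close>.\<close>

lemma sharp_const_le:
  fixes S p :: real
  assumes p: "1 < p" and S: "0 < S"
    and H: "\<And>f A. finsupp f \<Longrightarrow> finite A \<Longrightarrow>
      (\<Sum>x\<in>A. \<bar>beurling_ahlfors_im f x\<bar> powr p) \<le> S powr p * total (\<lambda>x. \<bar>f x\<bar> powr p)"
  shows "sharp_const p \<le> S"
proof -
  have ge2: "r - 1 \<le> S" if r: "2 \<le> r" and Hr: "\<And>f A. finsupp f \<Longrightarrow> finite A \<Longrightarrow>
      (\<Sum>x\<in>A. \<bar>beurling_ahlfors_im f x\<bar> powr r) \<le> S powr r * total (\<lambda>x. \<bar>f x\<bar> powr r)" for r
  proof (rule lower_bound_ge2[OF r])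
    fix u A assume u: "finsupp u" and A: "finite (A :: (int \<times> int) set)"
    have "beurling_ahlfors_im (neg_laplacian u) = mixed u"
      by (simp add: beurling_ahlfors_im_neg_laplacian[OF u] mixed_def [abs_def])
    then show "(\<Sum>x\<in>A. \<bar>mixed u x\<bar> powr r) \<le> S powr r * total (\<lambda>x. \<bar>neg_laplacian u x\<bar> powr r)"
      using Hr[OF finsupp_laplacian(1)[OF u] A] by simp
  qed (use S in simp)
  show ?thesis
  proof (cases "2 \<le> p")
    case True
    have "1 / (p - 1) \<le> p - 1"
    proof -
      have "1 * 1 \<le> (p - 1) * (p - 1)" using True by (intro mult_mono) auto
      then show ?thesis using p by (simp add: pos_divide_le_eq)
    qed
    then show ?thesis using ge2[OF True H] by (simp add: sharp_const_def)
  next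
    case False
    define q where "q = p / (p - 1)"
    note c = conjugate_exponent[OF p, folded q_def]
    have q2: "2 \<le> q" using p False by (simp add: q_def field_simps)
    have qp: "q / (q - 1) = p" using c(1,4) by (simp add: field_simps)
    have "q - 1 \<le> S"
    proof (rule ge2[OF q2])
      fix g A assume g: "finsupp g" and A: "finite (A :: (int \<times> int) set)"
      let ?T = "\<Sum>x\<in>A. \<bar>beurling_ahlfors_im g x\<bar> powr q" and ?G = "total (\<lambda>x. \<bar>g x\<bar> powr q)"
      let ?f = "duality_map q A (beurling_ahlfors_im g)"
      note f = duality_map_properties[OF c(1) A, of "beurling_ahlfors_im g", unfolded qp]
      let ?B = "beurling_ahlfors_im ?f"
      define X where "X = {x. g x \<noteq> 0}"
      have X: "finite X" using g by (simp add: X_def)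
      have "?T = total (\<lambda>x. ?B x * g x)" using f(2) total_sym[OF f(1) g] by simp
      also have "\<dots> = (\<Sum>x\<in>X. ?B x * g x)" by (intro total_superset X) (auto simp: X_def)
      also have "\<dots> \<le> (\<Sum>x\<in>X. (1 / S) powr p / p * \<bar>?B x\<bar> powr p + S powr q / q * \<bar>g x\<bar> powr q)"
      proof (rule sum_mono)
        fix x
        have "?B x * g x \<le> \<bar>?B x * g x\<bar>" by simp
        \<comment> \<open>Distributing \<open>S\<close> in this way before Young's inequality turns
          the first term into \<open>1 / p\<close> of the left side, to be absorbed.\<close>
        also have "\<dots> = (1 / S * \<bar>?B x\<bar>) * (S * \<bar>g x\<bar>)" using S by (simp add: abs_mult)
        also have "\<dots> \<le> (1 / S * \<bar>?B x\<bar>) powr p / p + (S * \<bar>g x\<bar>) powr q / q"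
          using p c S by (intro Youngs_inequality) auto
        also have "\<dots> = (1 / S) powr p / p * \<bar>?B x\<bar> powr p + S powr q / q * \<bar>g x\<bar> powr q"
          using S unfolding powr_mult by simp
        finally show "?B x * g x \<le> (1 / S) powr p / p * \<bar>?B x\<bar> powr p + S powr q / q * \<bar>g x\<bar> powr q" .
      qed
      also have "\<dots> = (1 / S) powr p / p * (\<Sum>x\<in>X. \<bar>?B x\<bar> powr p) + S powr q / q * (\<Sum>x\<in>X. \<bar>g x\<bar> powr q)"
        by (simp add: sum.distrib sum_distrib_left)
      also have "(\<Sum>x\<in>X. \<bar>g x\<bar> powr q) = ?G" by (rule total_superset[OF X, symmetric]) (auto simp: X_def)
      also have "(1 / S) powr p / p * (\<Sum>x\<in>X. \<bar>?B x\<bar> powr p) \<le> (1 / S) powr p / p * (S powr p * ?T)"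
        using H[OF f(1) X] p unfolding f(3) by (intro mult_left_mono) auto
      also have "(1 / S) powr p / p * (S powr p * ?T) = ?T / p"
      proof -
        have "(1 / S) powr p * S powr p = 1" using S by (simp add: powr_mult[symmetric])
        then show ?thesis by (simp add: mult.assoc[symmetric])
      qed
      finally have le: "?T \<le> ?T / p + S powr q / q * ?G" by simp
      have "1 / q = 1 - 1 / p" using c(2) by linarith
      then have "?T * (1 / q) = ?T * (1 - 1 / p)" by (simp only:)
      then have "?T / q = ?T - ?T / p" by (simp add: right_diff_distrib)
      with le have "?T / q \<le> S powr q * ?G / q" by simp
      then show "?T \<le> S powr q * ?G" using c(1) by (simp add: divide_le_cancel)
    qed
    moreover have "p - 1 \<le> q - 1"
      using p False c(1) q2 by linarith
    ultimately show ?thesis using c(5) by (simp add: sharp_const_def)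
  qed
qed

lemma lp_onorm_ba_extension:
  assumes p: "1 < p" shows "lp_onorm p (ba_extension p) = sharp_const p"
proof (rule antisym)
  let ?U = "{f \<in> lp p. lp_norm p f \<le> 1}" and ?C = "sharp_const p"
  have C: "0 < ?C" by (rule sharp_const_pos[OF p])
  have zero: "(\<lambda>_. 0) \<in> ?U" by (simp add: lp_iff lp_norm_def)
  have bound: "lp_norm p (ba_extension p f) \<le> ?C" if "f \<in> ?U" for f
  proof -
    have "lp_norm p (ba_extension p f) \<le> ?C * lp_norm p f" using ba_extension_bound(2)[OF p] that by blast
    also have "\<dots> \<le> ?C * 1" using that C by (intro mult_left_mono) auto
    finally show ?thesis by simp
  qed
  show "lp_onorm p (ba_extension p) \<le> ?C"
    unfolding lp_onorm_def using zero bound by (intro cSUP_least) auto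
  have bdd: "bdd_above ((\<lambda>f. lp_norm p (ba_extension p f)) ` ?U)"
    using bound by (intro bdd_aboveI2)
  define N where "N = lp_onorm p (ba_extension p)"
  have upper: "lp_norm p (ba_extension p f) \<le> N" if "f \<in> ?U" for f
    unfolding N_def lp_onorm_def by (rule cSUP_upper[OF that bdd])
  have N0: "0 \<le> N" using order_trans[OF lp_norm_nonneg upper[OF zero]] .
  have scaled: "lp_norm p (ba_extension p f) \<le> N * lp_norm p f" if f: "f \<in> lp p" for f
  proof (cases "lp_norm p f = 0")
    case True
    \<comment> \<open>A function of norm 0 cannot be normalised, but the upper bound already sends
      it to norm 0.\<close>
    then show ?thesis using ba_extension_bound(2)[OF p f] by simp
  next
    case False
    define r where "r = lp_norm p f"
    have r: "0 < r" using False lp_norm_nonneg[of p f] by (simp add: r_def)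
    have cm: "lp_norm p (\<lambda>x. c * h x) = c * lp_norm p h" if "0 < c" for c h
    proof -
      have "(\<Sum>\<^sub>\<infinity>x. \<bar>c * h x\<bar> powr p) = c powr p * (\<Sum>\<^sub>\<infinity>x. \<bar>h x\<bar> powr p)"
        using that by (simp add: abs_mult powr_mult infsum_cmult_right')
      then show ?thesis using that p by (simp add: lp_norm_def powr_mult powr_powr infsum_nonneg)
    qed
    have "(\<lambda>x. (1 / r) * f x) \<in> ?U" using lp_cmult[OF f, of "1 / r"] cm[of "1 / r" f] r by (simp add: r_def)
    from upper[OF this] have "lp_norm p (ba_extension p (\<lambda>x. (1 / r) * f x)) \<le> N" .
    moreover have "ba_extension p (\<lambda>x. (1 / r) * f x) = (\<lambda>x. (1 / r) * ba_extension p f x)"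
      using ba_extension_bounded_linear[OF p] f unfolding bounded_linear_lp_def by blast
    ultimately have "(1 / r) * lp_norm p (ba_extension p f) \<le> N" using cm[of "1 / r"] r by simp
    then show ?thesis using r by (simp add: r_def[symmetric] pos_divide_le_eq)
  qed
  show "?C \<le> lp_onorm p (ba_extension p)"
    unfolding N_def[symmetric]
  proof (rule field_le_epsilon)
    fix e :: real assume e: "0 < e"
    \<comment> \<open>The slack \<open>e\<close> supplies the positive constant that
      \<open>sharp_const_le\<close> asks for, as only \<open>0 \<le> N\<close> is known
      here.\<close>
    show "?C \<le> N + e"
    proof (rule sharp_const_le[OF p])
      show "0 < N + e" using N0 e by simp
      fix f A assume f: "finsupp f" and A: "finite (A :: (int \<times> int) set)"
      note fl = finsupp_lp[OF f, of p]
      have "lp_norm p (ba_extension p f) \<le> (N + e) * lp_norm p f"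
        using scaled[OF fl] mult_right_mono[of N "N + e" "lp_norm p f"] lp_norm_nonneg[of p f] e by linarith
      then have le: "(\<Sum>\<^sub>\<infinity>x. \<bar>ba_extension p f x\<bar> powr p) \<le> (N + e) powr p * (\<Sum>\<^sub>\<infinity>x. \<bar>f x\<bar> powr p)"
        using N0 e by (subst (asm) lp_norm_le_iff[OF p]) auto
      have "(\<Sum>x\<in>A. \<bar>ba_extension p f x\<bar> powr p) \<le> (\<Sum>\<^sub>\<infinity>x. \<bar>ba_extension p f x\<bar> powr p)"
        by (rule finite_sum_le_lp[OF ba_extension_bound(1)[OF p fl] A])
      with le show "(\<Sum>x\<in>A. \<bar>beurling_ahlfors_im f x\<bar> powr p) \<le> (N + e) powr p * total (\<lambda>x. \<bar>f x\<bar> powr p)"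
        by (simp add: ba_extension_finsupp[OF f] infsum_finsupp(1)[OF finsupp_powr[OF f]])
    qed
  qed
qed

theorem theorem1:
  fixes p :: real
  assumes "1 < p"
  shows "is_lp_extension p beurling_ahlfors_im (lp_extension p beurling_ahlfors_im) \<and>
         lp_onorm p (lp_extension p beurling_ahlfors_im) = max (p - 1) (1 / (p - 1))"
  unfolding lp_extension_eq[OF assms]
  using is_lp_extension_ba[OF assms] lp_onorm_ba_extension[OF assms] by (simp add: sharp_const_def)

end
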